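(* Assume $c_{bg}^u < c_{nl}^l$. Let $A\subset\Omega$ be measurable (the anomalous region), with associated material property $\gamma_A(x,s)=\gamma_{nl}(x,s)$ for $x\in A$ and $\gamma_A(x,s)=\gamma_{bg}(x)$ for $x\in\Omega\setminus A$. Let $T\subset\Omega$ be measurable (the region of a test anomaly), with associated material property $\gamma_T(x,s)=\gamma_{nl}(x,s)$ for $x\in T$ and $\gamma_T(x,s)=\gamma_{bg}(x)$ for $x\in\Omega\setminus T$. Let $F\subset\Omega$ be measurable and such that (i) $A\subseteq F$ and (ii) $T\not\subseteq F$. Let $\Lambda_F^u$ and $\Lambda_T^l$ be the (linear) Dirichlet-to-Neumann operators of the linear material properties $$\gamma_F^u(x)=\begin{cases} c_{nl}^u & \text{in } F\\ \gamma_{bg}(x) & \text{in } \Omega\setminus F,\end{cases}\qquad \gamma_T^l(x)=\begin{cases} c_{nl}^l & \text{in } T\\ \gamma_{bg}(x) & \text{in } \Omega\setminus T.\end{cases}$$ If $\Lambda_F^u-\Lambda_T^l$ has negative eigenvalues, then every nonzero element $f\in X_\diamond(\partial\Omega)$ of the span of the eigenfunctions corresponding to the negative eigenvalues of $\Lambda_F^u-\Lambda_T^l$ satisfies $$\langle\overline{\Lambda}_A(f)-\overline{\Lambda}_T(f),f\rangle<0,$$ where $\overline\Lambda_A$ and $\overline\Lambda_T$ are the average Dirichlet-to-Neumann operators of $\gamma_A$ and $\gamma_T$.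
   Context: Setting. $\Omega\subset\mathbb{R}^n$, $n\ge 2$, is an open bounded connected domain with Lipschitz boundary. $X_\diamond(\partial\Omega)=\{g\in H^{1/2}(\partial\Omega):\int_{\partial\Omega}g=0\}$, $X_\diamond'(\partial\Omega)$ is its dual, and $\langle\cdot,\cdot\rangle$ is the duality pairing extending the $L^2(\partial\Omega)$ inner product. Material properties. The linear background $\gamma_{bg}\in L^\infty(\Omega)$ satisfies $c_{bg}^l\le\gamma_{bg}(x)\le c_{bg}^u$ a.e., with positive constants $c_{bg}^l,c_{bg}^u$. The nonlinear material property $\gamma_{nl}:\overline\Omega\times[0,+\infty)\to\mathbb{R}$ satisfies: (H1) $\gamma_{nl}$ is a Carathéodory function (measurable in $x$ for every $s\geq 0$, continuous in $s$ for a.e. $x$); (H2) $s\mapsto\gamma_{nl}(x,s)s$ is strictly increasing on $[0,+\infty)$ for a.e. $x$; (H3) there are positive constants $c_{nl}^l<c_{nl}^u$ with $c_{nl}^l\le\gamma_{nl}(x,s)\le c_{nl}^u$ for a.e. $x$ and all $s\ge0$; (H4) there is $\kappa>0$ with $(\gamma_{nl}(x,|\mathbf s_2|)\mathbf s_2-\gamma_{nl}(x,|\mathbf s_1|)\mathbf s_1)\cdot(\mathbf s_2-\mathbf s_1)\ge\kappa|\mathbf s_2-\mathbf s_1|^2$ for a.e. $x\in\Omega$ and all $\mathbf s_1,\mathbf s_2\in\mathbb{R}^n$. Dirichlet-to-Neumann (DtN) operators. For a material property $\gamma(x,s)$ and $f\in X_\diamond(\partial\Omega)$, let $u\in H^1(\Omega)$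 be the unique weak solution of $\nabla\cdot(\gamma(x,|\nabla u|)\nabla u)=0$ in $\Omega$, $u=f$ on $\partial\Omega$. The DtN operator $\Lambda:X_\diamond(\partial\Omega)\to X_\diamond'(\partial\Omega)$ is $\Lambda(f)=\gamma\,\partial_n u|_{\partial\Omega}$, i.e. $\langle\Lambda(f),\varphi\rangle=\int_\Omega\gamma(x,|\nabla u|)\nabla u\cdot\nabla\tilde\varphi\,dx$ for any $\tilde\varphi\in H^1(\Omega)$ with trace $\varphi\in X_\diamond(\partial\Omega)$. The average DtN operator $\overline\Lambda$ is defined by $\langle\overline\Lambda(f),\varphi\rangle=\int_0^1\langle\Lambda(\alpha f),\varphi\rangle\,d\alpha$ for all $\varphi\in X_\diamond(\partial\Omega)$. Sub/superscripts on $\Lambda,\overline\Lambda$ match those of the corresponding $\gamma$. Eigenvalues. A real number $\delta$ is an eigenvalue of a linear operator $L:X_\diamond(\partial\Omega)\to X_\diamond'(\partial\Omega)$ with eigenfunction $\varphi\in X_\diamond(\partial\Omega)\setminus\{0\}$ if $\langle L\varphi,\psi\rangle=\delta\int_{\partial\Omega}\varphi\psi$ for all $\psi\in X_\diamond(\partial\Omega)$. "Span" means the set of finite linear combinations. *)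

theory Defs
  imports "HOL-Analysis.Analysis"
begin

section \<open>Lipschitz domains and surface measure\<close>

text \<open>Near each boundary point, and in suitable orthonormal coordinates, the set is the strict
  epigraph of a Lipschitz function. The vector \<open>\<nu>\<close> is the vertical direction and
  \<open>x - (x \<bullet> \<nu>) *\<^sub>R \<nu>\<close> is the horizontal part of \<open>x\<close>.\<close>

definition lipschitz_boundary :: "'a::euclidean_space set \<Rightarrow> bool" where
  "lipschitz_boundary \<Omega> \<longleftrightarrow>
     (\<forall>x0 \<in> frontier \<Omega>. \<exists>r>0. \<exists>\<nu>. \<exists>h :: 'a \<Rightarrow> real. \<exists>L.
        norm \<nu> = 1 \<and> L-lipschitz_on UNIV h \<and>
        \<Omega> \<inter> ball x0 r = {x \<in> ball x0 r. h (x - (x \<bullet> \<nu>) *\<^sub>R \<nu>) < x \<bullet> \<nu>})"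

text \<open>The normalised \<open>m\<close>-dimensional Hausdorff measure, for \<open>m \<ge> 1\<close>. (For \<open>m = 0\<close> the empty
  sets of a cover would be counted, since \<open>0 ^ 0 = 1\<close>.) The constant makes it agree with Lebesgue
  measure on \<open>m\<close>-dimensional planes. Boundedness is required because
  \<^const>\<open>diameter\<close> is meaningless on unbounded sets.\<close>

definition hausdorff_pre :: "nat \<Rightarrow> real \<Rightarrow> 'a::euclidean_space set \<Rightarrow> ennreal" where
  "hausdorff_pre m \<delta> S =
     (INF C \<in> {C :: nat \<Rightarrow> 'a set. S \<subseteq> (\<Union>i. C i) \<and> (\<forall>i. bounded (C i) \<and> diameter (C i) \<le> \<delta>)}.
        \<Sum>i. ennreal (unit_ball_vol (real m) * (diameter (C i) / 2) ^ m))"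

definition hausdorff_outer :: "nat \<Rightarrow> 'a::euclidean_space set \<Rightarrow> ennreal" where
  "hausdorff_outer m S = (SUP \<delta> \<in> {0<..}. hausdorff_pre m \<delta> S)"

definition hausdorff_measure :: "nat \<Rightarrow> 'a::euclidean_space measure" where
  "hausdorff_measure m = measure_of UNIV (sets borel) (hausdorff_outer m)"

definition surface_measure :: "'a::euclidean_space set \<Rightarrow> 'a measure" where
  "surface_measure \<Omega> = restrict_space (hausdorff_measure (DIM('a) - 1)) (frontier \<Omega>)"

section \<open>Sobolev space and traces\<close>

text \<open>Functions on \<open>\<Omega>\<close> and on its boundary are represented by total functions. Elements of
  \<open>L\<^sup>2\<close>-type spaces are representatives, and equality of classes is equality almost everywhere.\<close>

definition square_integrable :: "'a measure \<Rightarrow> ('a \<Rightarrow> 'b::euclidean_space) \<Rightarrow> bool" where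
  "square_integrable M f \<longleftrightarrow> f \<in> borel_measurable M \<and> integrable M (\<lambda>x. (norm (f x))\<^sup>2)"

primrec C_k :: "nat \<Rightarrow> ('a::euclidean_space \<Rightarrow> real) \<Rightarrow> bool" where
  "C_k 0 f \<longleftrightarrow> continuous_on UNIV f"
| "C_k (Suc k) f \<longleftrightarrow>
     f differentiable_on UNIV \<and> (\<forall>b\<in>Basis. C_k k (\<lambda>x. frechet_derivative f (at x) b))"

definition smooth :: "('a::euclidean_space \<Rightarrow> real) \<Rightarrow> bool" where
  "smooth f \<longleftrightarrow> (\<forall>k. C_k k f)"

definition grad :: "('a::euclidean_space \<Rightarrow> real) \<Rightarrow> 'a \<Rightarrow> 'a" where
  "grad f x = (\<Sum>b\<in>Basis. frechet_derivative f (at x) b *\<^sub>R b)"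

definition test_function :: "'a::euclidean_space set \<Rightarrow> ('a \<Rightarrow> real) \<Rightarrow> bool" where
  "test_function \<Omega> \<phi> \<longleftrightarrow>
     smooth \<phi> \<and> (\<exists>K. compact K \<and> K \<subseteq> \<Omega> \<and> (\<forall>x. x \<notin> K \<longrightarrow> \<phi> x = 0))"

definition has_weak_gradient ::
    "'a::euclidean_space set \<Rightarrow> ('a \<Rightarrow> real) \<Rightarrow> ('a \<Rightarrow> 'a) \<Rightarrow> bool" where
  "has_weak_gradient \<Omega> u G \<longleftrightarrow>
     (\<forall>\<phi>. test_function \<Omega> \<phi> \<longrightarrow>
        (\<forall>b\<in>Basis. (LINT x|lebesgue_on \<Omega>. u x * (grad \<phi> x \<bullet> b)) =
                    - (LINT x|lebesgue_on \<Omega>. (G x \<bullet> b) * \<phi> x)))"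

definition H1 :: "'a::euclidean_space set \<Rightarrow> ('a \<Rightarrow> real) set" where
  "H1 \<Omega> = {u. square_integrable (lebesgue_on \<Omega>) u \<and>
                (\<exists>G. square_integrable (lebesgue_on \<Omega>) G \<and> has_weak_gradient \<Omega> u G)}"

definition weak_grad :: "'a::euclidean_space set \<Rightarrow> ('a \<Rightarrow> real) \<Rightarrow> 'a \<Rightarrow> 'a" where
  "weak_grad \<Omega> u = (SOME G. square_integrable (lebesgue_on \<Omega>) G \<and> has_weak_gradient \<Omega> u G)"

text \<open>The trace as the closure, in \<open>H\<^sup>1(\<Omega>) \<times> L\<^sup>2(\<partial>\<Omega>)\<close>, of the restriction of functions
  smooth up to the boundary. On a bounded Lipschitz domain this relation is the graph of the usual
  trace operator. Convergence is expressed by the nonnegative integral because the Bochner integral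
  is 0 on non-integrable functions.\<close>

definition has_trace :: "'a::euclidean_space set \<Rightarrow> ('a \<Rightarrow> real) \<Rightarrow> ('a \<Rightarrow> real) \<Rightarrow> bool" where
  "has_trace \<Omega> u g \<longleftrightarrow>
     u \<in> H1 \<Omega> \<and> square_integrable (surface_measure \<Omega>) g \<and>
     (\<exists>w :: nat \<Rightarrow> 'a \<Rightarrow> real.
        (\<forall>k. smooth (w k)) \<and>
        (\<lambda>k. \<integral>\<^sup>+x. ennreal ((w k x - u x)\<^sup>2 + (norm (grad (w k) x - weak_grad \<Omega> u x))\<^sup>2)
               \<partial>lebesgue_on \<Omega>) \<longlonglongrightarrow> 0 \<and>
        (\<lambda>k. \<integral>\<^sup>+x. ennreal ((w k x - g x)\<^sup>2) \<partial>surface_measure \<Omega>) \<longlonglongrightarrow> 0)"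

text \<open>\<open>H\<^sup>1\<^sup>/\<^sup>2(\<partial>\<Omega>)\<close> is the trace space of \<open>H\<^sup>1(\<Omega>)\<close>.\<close>

definition H_half :: "'a::euclidean_space set \<Rightarrow> ('a \<Rightarrow> real) set" where
  "H_half \<Omega> = {g. \<exists>u. has_trace \<Omega> u g}"

definition X_diamond :: "'a::euclidean_space set \<Rightarrow> ('a \<Rightarrow> real) set" where
  "X_diamond \<Omega> = {g \<in> H_half \<Omega>. (LINT x|surface_measure \<Omega>. g x) = 0}"

definition boundary_zero :: "'a::euclidean_space set \<Rightarrow> ('a \<Rightarrow> real) \<Rightarrow> bool" where
  "boundary_zero \<Omega> g \<longleftrightarrow> (AE x in surface_measure \<Omega>. g x = 0)"

section \<open>Dirichlet-to-Neumann operators\<close>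

definition energy_form ::
    "'a::euclidean_space set \<Rightarrow> ('a \<Rightarrow> real \<Rightarrow> real) \<Rightarrow> ('a \<Rightarrow> real) \<Rightarrow> ('a \<Rightarrow> real) \<Rightarrow> real" where
  "energy_form \<Omega> \<gamma> u v =
     (LINT x|lebesgue_on \<Omega>.
        \<gamma> x (norm (weak_grad \<Omega> u x)) * (weak_grad \<Omega> u x \<bullet> weak_grad \<Omega> v x))"

definition weak_solution ::
    "'a::euclidean_space set \<Rightarrow> ('a \<Rightarrow> real \<Rightarrow> real) \<Rightarrow> ('a \<Rightarrow> real) \<Rightarrow> ('a \<Rightarrow> real) \<Rightarrow> bool" where
  "weak_solution \<Omega> \<gamma> f u \<longleftrightarrow>
     has_trace \<Omega> u f \<and> (\<forall>v. has_trace \<Omega> v (\<lambda>_. 0) \<longrightarrow> energy_form \<Omega> \<gamma> u v = 0)"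

text \<open>An operator from \<open>X_diamond \<Omega>\<close> to its dual is represented by the two-argument function
  \<open>f, \<phi> \<mapsto> \<langle>\<Lambda> f, \<phi>\<rangle>\<close>. The choices are immaterial: the weak solution is unique (as an
  element of \<open>H\<^sup>1\<close>), and its weak equation makes the value independent of the extension of
  \<open>\<phi>\<close>.\<close>

definition DtN ::
    "'a::euclidean_space set \<Rightarrow> ('a \<Rightarrow> real \<Rightarrow> real) \<Rightarrow> ('a \<Rightarrow> real) \<Rightarrow> ('a \<Rightarrow> real) \<Rightarrow> real" where
  "DtN \<Omega> \<gamma> f \<phi> =
     energy_form \<Omega> \<gamma> (SOME u. weak_solution \<Omega> \<gamma> f u) (SOME v. has_trace \<Omega> v \<phi>)"

definition avg_DtN ::
    "'a::euclidean_space set \<Rightarrow> ('a \<Rightarrow> real \<Rightarrow> real) \<Rightarrow> ('a \<Rightarrow> real) \<Rightarrow> ('a \<Rightarrow> real) \<Rightarrow> real" where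
  "avg_DtN \<Omega> \<gamma> f \<phi> = (LBINT \<alpha>:{0..1}. DtN \<Omega> \<gamma> (\<lambda>x. \<alpha> * f x) \<phi>)"

section \<open>Eigenvalues\<close>

definition is_eigenfunction ::
    "'a::euclidean_space set \<Rightarrow> (('a \<Rightarrow> real) \<Rightarrow> ('a \<Rightarrow> real) \<Rightarrow> real) \<Rightarrow> real \<Rightarrow> ('a \<Rightarrow> real) \<Rightarrow> bool"
  where
  "is_eigenfunction \<Omega> L \<delta> \<phi> \<longleftrightarrow>
     \<phi> \<in> X_diamond \<Omega> \<and> \<not> boundary_zero \<Omega> \<phi> \<and>
     (\<forall>\<psi> \<in> X_diamond \<Omega>. L \<phi> \<psi> = \<delta> * (LINT x|surface_measure \<Omega>. \<phi> x * \<psi> x))"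

definition is_eigenvalue ::
    "'a::euclidean_space set \<Rightarrow> (('a \<Rightarrow> real) \<Rightarrow> ('a \<Rightarrow> real) \<Rightarrow> real) \<Rightarrow> real \<Rightarrow> bool" where
  "is_eigenvalue \<Omega> L \<delta> \<longleftrightarrow> (\<exists>\<phi>. is_eigenfunction \<Omega> L \<delta> \<phi>)"

definition boundary_span :: "'a::euclidean_space set \<Rightarrow> ('a \<Rightarrow> real) set \<Rightarrow> ('a \<Rightarrow> real) set" where
  "boundary_span \<Omega> E =
     {f. f \<in> X_diamond \<Omega> \<and>
         (\<exists>S c. finite S \<and> S \<subseteq> E \<and> (AE x in surface_measure \<Omega>. f x = (\<Sum>\<phi>\<in>S. c \<phi> * \<phi> x)))}"

section \<open>Material properties\<close>

definition with_inclusion ::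
    "('a \<Rightarrow> real) \<Rightarrow> 'a set \<Rightarrow> ('a \<Rightarrow> real \<Rightarrow> real) \<Rightarrow> 'a \<Rightarrow> real \<Rightarrow> real" where
  "with_inclusion \<gamma>bg A \<gamma>in x s = (if x \<in> A then \<gamma>in x s else \<gamma>bg x)"

end

theory Submission
  imports Defs
begin

text \<open>For \<open>f\<close> on the boundary, the minimal energy \<open>E(f)\<close> of the extensions of \<open>f\<close> satisfies
  \<open>E(f) = \<langle>\<Lambda>'(f), f\<rangle>\<close>, where \<open>\<Lambda>'\<close> is the average DtN operator, because \<open>\<langle>\<Lambda>(\<alpha> f), f\<rangle>\<close> is a
  subgradient of \<open>\<alpha> \<mapsto> E(\<alpha> f)\<close>; for a linear material this is half of \<open>\<langle>\<Lambda>(f), f\<rangle>\<close>.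
  Since \<open>E\<close> is monotone in the material property, \<open>\<gamma>\<^sub>A \<le> \<gamma>\<^sub>F\<close> and \<open>\<gamma>\<^sub>T \<ge> \<gamma>\<^sub>T\<^sup>l\<close> bound the difference of
  the average operators by half of the quadratic form of \<open>\<Lambda>\<^sub>F - \<Lambda>\<^sub>T\<close>, which is negative on the span of
  the eigenfunctions with negative eigenvalues.

  Weak solutions exist by the direct method: strong convexity makes the gradients of a minimising
  sequence converge in \<open>L\<^sup>2\<close>, and the functions themselves converge by a Friedrichs inequality with
  boundary term, obtained by integrating along lines in a coordinate direction up to
  the exit point: the law of the exit point is dominated by the Hausdorff measure.\<close>

section \<open>Hausdorff measure\<close>

text \<open>Three features of the definitions shape the proof. \<open>measure_of\<close> takes the
  prescribed values only if the set function is countably additive on the sigma-algebra, so the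
  surface measure becomes usable only after Caratheodory's criterion has been checked for the
  Hausdorff outer measure. Traces are L2 limits of boundary values of smooth functions, so a
  function of trace zero comes with approximants that are merely small on the boundary; hence the
  Friedrichs inequality is proved for smooth functions with the boundary term kept, and that term
  vanishes only in the limit. Finally, \<open>DtN\<close> and \<open>weak_grad\<close> are choices,
  so existence of weak solutions and a.e. uniqueness of weak gradients come before any computation
  with them. Strong convexity of the energy comes from (H4) tested on parallel vectors, which makes
  \<open>\<gamma>nl x s * s\<close> strongly increasing in s. The contrast hypothesis enters in the
  comparison of the materials of A and F: on F - A the background must lie below
  \<open>cnlu\<close>.\<close>

definition metric_additive :: "('a::metric_space set \<Rightarrow> ennreal) \<Rightarrow> bool" where
  "metric_additive \<mu> \<longleftrightarrow>
     (\<forall>A B d. 0 < d \<longrightarrow> (\<forall>x\<in>A. \<forall>y\<in>B. d \<le> dist x y) \<longrightarrow> \<mu> (A \<union> B) = \<mu> A + \<mu> B)"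

lemma metric_additiveD:
  "metric_additive \<mu> \<Longrightarrow> 0 < d \<Longrightarrow> (\<And>x y. x \<in> A \<Longrightarrow> y \<in> B \<Longrightarrow> d \<le> dist x y) \<Longrightarrow>
    \<mu> (A \<union> B) = \<mu> A + \<mu> B"
  unfolding metric_additive_def by blast

lemma ennreal_suminf_tail_tendsto_0:
  fixes f :: "nat \<Rightarrow> ennreal"
  assumes "(\<Sum>i. f i) < \<infinity>"
  shows "(\<lambda>k. \<Sum>i. f (i + k)) \<longlonglongrightarrow> 0"
proof -
  define r where "r i = enn2real (f i)" for i
  have fin: "f i < \<infinity>" for i
    using ennreal_suminf_lessD[of f "\<infinity>"] assms by simp
  have fr: "f i = ennreal (r i)" for i
    using fin[of i] by (simp add: r_def less_top)
  have r0: "0 \<le> r i" for i by (simp add: r_def)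
  have sr: "summable r"
    using assms by (intro summable_suminf_not_top) (auto simp: r0 fr less_top)
  have "(\<lambda>k. \<Sum>i. r (i + k)) \<longlonglongrightarrow> 0"
  proof -
    have "(\<Sum>i. r (i + k)) = suminf r - sum r {..<k}" for k
      using suminf_split_initial_segment[OF sr, of k] by simp
    moreover have "(\<lambda>k. suminf r - sum r {..<k}) \<longlonglongrightarrow> suminf r - suminf r"
      by (intro tendsto_intros summable_LIMSEQ sr)
    ultimately show ?thesis by simp
  qed
  then have "(\<lambda>k. ennreal (\<Sum>i. r (i + k))) \<longlonglongrightarrow> ennreal 0"
    by (rule tendsto_ennrealI)
  moreover have "(\<Sum>i. f (i + k)) = ennreal (\<Sum>i. r (i + k))" for k
    unfolding fr using sr r0 by (intro suminf_ennreal_eq) (auto simp: summable_sums summable_iff_shift)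
  ultimately show ?thesis by simp
qed

text \<open>Caratheodory's criterion. E - C is exhausted by the sets \<open>G k\<close> at distance
  at least \<open>a k\<close> from C, for which additivity with E \<inter> C is exact. What remains
  of E - C is covered by rings \<open>R i\<close> whose outer measures form a convergent series, so
  the error is a vanishing tail.\<close>

lemma closed_in_lambda_system:
  fixes \<mu> :: "'a::metric_space set \<Rightarrow> ennreal"
  assumes oms: "outer_measure_space UNIV \<mu>" and add: "metric_additive \<mu>" and C: "closed C"
  shows "C \<in> lambda_system UNIV UNIV \<mu>"
proof -
  have pos: "\<mu> {} = 0" and mono: "\<And>A B. A \<subseteq> B \<Longrightarrow> \<mu> A \<le> \<mu> B"
    and csub: "countably_subadditive UNIV \<mu>"
    using oms unfolding outer_measure_space_def positive_def increasing_def by auto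
  interpret algebra "UNIV :: 'a set" "UNIV :: 'a set set"
    by (metis algebra_Pow Pow_UNIV)
  have sub: "\<mu> (A \<union> B) \<le> \<mu> A + \<mu> B" for A B
  proof -
    have "subadditive UNIV \<mu>"
      by (rule countably_subadditive_subadditive) (use csub pos in \<open>auto simp: positive_def\<close>)
    then have "\<mu> (A \<union> (B - A)) \<le> \<mu> A + \<mu> (B - A)"
      unfolding subadditive_def by blast
    also have "\<dots> \<le> \<mu> A + \<mu> B" by (intro add_left_mono mono) auto
    finally show ?thesis by simp
  qed
  have main: "\<mu> (E \<inter> C) + \<mu> (E - C) \<le> \<mu> E" if ne: "C \<noteq> {}" and fin: "\<mu> E < \<infinity>" for E
  proof -
    define a :: "nat \<Rightarrow> real" where "a k = inverse (real (Suc k))" for k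
    have a0: "0 < a k" for k by (simp add: a_def)
    have adec: "a (Suc k) < a k" for k by (simp add: a_def field_simps)
    have amono: "a j \<le> a i" if "i \<le> j" for i j
      using that by (simp add: a_def field_simps)
    define G where "G k = {x\<in>E. a k \<le> infdist x C}" for k
    define R where "R k = G (Suc k) - G k" for k
    have Gmono: "G i \<subseteq> G j" if "i \<le> j" for i j
      using amono[OF that] by (auto simp: G_def)
    \<comment> \<open>\<open>infdist\<close> to C is 1-Lipschitz, so passing from level
      \<open>a k\<close> to below level \<open>a (Suc k)\<close> takes a distance of at least
      \<open>a k - a (Suc k)\<close>.\<close>
    have sep: "\<mu> (A \<union> B) = \<mu> A + \<mu> B" if "A \<subseteq> G k" "B \<subseteq> E - G (Suc k)" for A B k
    proof (rule metric_additiveD[OF add, of "a k - a (Suc k)"])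
      show "0 < a k - a (Suc k)" using adec[of k] by simp
      fix x y assume "x \<in> A" "y \<in> B"
      then have "a k \<le> infdist x C" "infdist y C < a (Suc k)"
        using that by (auto simp: G_def)
      then show "a k - a (Suc k) \<le> dist x y"
        using infdist_triangle[of x C y] by linarith
    qed
    \<comment> \<open>Neighbouring rings may touch, but rings of equal parity have a whole ring
      between them, so their outer measures add exactly. This bounds each parity class by \<mu> E
      and the full series by twice that.\<close>
    have sumR: "(\<Sum>i<n. \<mu> (R (2 * i + j))) = \<mu> (\<Union>i<n. R (2 * i + j))" for n j
    proof (induction n)
      case 0 show ?case by (simp add: pos)
    next
      case (Suc n)
      have "\<mu> (R (2 * n + j) \<union> (\<Union>i<n. R (2 * i + j))) = \<mu> (\<Union>i<n. R (2 * i + j)) + \<mu> (R (2 * n + j))"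
      proof (cases "2 * n + j")
        case 0
        then show ?thesis by (simp add: pos)
      next
        case k: (Suc k)
        have "R (2 * i + j) \<subseteq> G k" if "i < n" for i
          using that k Gmono[of "Suc (2 * i + j)" k] by (auto simp: R_def)
        moreover have "R (2 * n + j) \<subseteq> E - G (Suc k)"
          unfolding k by (auto simp: R_def G_def)
        ultimately show ?thesis
          using sep[of "\<Union>i<n. R (2 * i + j)" k "R (2 * n + j)"]
          by (subst Un_commute) blast
      qed
      then show ?case using Suc.IH by (simp add: lessThan_Suc)
    qed
    have half: "(\<Sum>i. \<mu> (R (2 * i + j))) \<le> \<mu> E" for j
    proof (rule suminf_le_const)
      show "(\<Sum>i<n. \<mu> (R (2 * i + j))) \<le> \<mu> E" for n
        unfolding sumR by (rule mono) (auto simp: R_def G_def)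
    qed auto
    have "(\<Sum>i<n. \<mu> (R i)) \<le> \<mu> E + \<mu> E" for n
    proof -
      have "(\<Sum>i<n. \<mu> (R i)) \<le> (\<Sum>i<2*n. \<mu> (R i))"
        by (intro sum_mono2) auto
      also have "\<dots> = (\<Sum>i<n. \<mu> (R (2 * i + 0))) + (\<Sum>i<n. \<mu> (R (2 * i + 1)))"
        by (induction n) (auto simp: algebra_simps)
      also have "\<dots> \<le> \<mu> E + \<mu> E"
        by (intro add_mono order_trans[OF sum_le_suminf half]) auto
      finally show ?thesis .
    qed
    then have "(\<Sum>i. \<mu> (R i)) \<le> \<mu> E + \<mu> E"
      by (intro suminf_le_const) auto
    then have finR: "(\<Sum>i. \<mu> (R i)) < \<infinity>"
      using fin by (auto intro: le_less_trans)
    have cover: "E - C \<subseteq> G k \<union> (\<Union>i. R (i + k))" for k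
    proof
      fix x assume x: "x \<in> E - C"
      then have "0 < infdist x C"
        using C ne by (simp add: infdist_pos_not_in_closed)
      then obtain n where "inverse (real (Suc n)) < infdist x C"
        using reals_Archimedean by blast
      then have ex: "x \<in> G n" using x by (auto simp: G_def a_def)
      show "x \<in> G k \<union> (\<Union>i. R (i + k))"
      proof (cases "x \<in> G k")
        case False
        define N where "N = (LEAST n. x \<in> G n)"
        have N: "x \<in> G N" "\<And>m. m < N \<Longrightarrow> x \<notin> G m"
          unfolding N_def using ex by (auto intro: LeastI dest: not_less_Least)
        have "k < N" using False N(1) Gmono[of N k] by (cases "k < N") auto
        then obtain M where M: "N = Suc M" by (cases N) auto
        then have "x \<in> R ((M - k) + k)"
          using N \<open>k < N\<close> by (simp add: R_def)
        then show ?thesis by blast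
      qed auto
    qed
    have step: "\<mu> (E \<inter> C) + \<mu> (E - C) \<le> \<mu> E + (\<Sum>i. \<mu> (R (i + k)))" for k
    proof -
      have dj: "disjoint_family (\<lambda>i. R (i + k))"
      proof (unfold disjoint_family_on_def, intro ballI impI)
        have *: "R m \<inter> R n = {}" if "m < n" for m n
          using Gmono[of "Suc m" n] that by (auto simp: R_def)
        fix m n :: nat assume "m \<noteq> n"
        then show "R (m + k) \<inter> R (n + k) = {}"
          using *[of "m + k" "n + k"] *[of "n + k" "m + k"] by (cases "m < n") auto
      qed
      have "\<mu> (E - C) \<le> \<mu> (G k) + \<mu> (\<Union>i. R (i + k))"
        by (rule order_trans[OF mono[OF cover] sub])
      also have "\<mu> (\<Union>i. R (i + k)) \<le> (\<Sum>i. \<mu> (R (i + k)))"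
        using csub dj unfolding countably_subadditive_def by blast
      finally have 1: "\<mu> (E - C) \<le> \<mu> (G k) + (\<Sum>i. \<mu> (R (i + k)))"
        by (simp add: add_left_mono)
      have "\<mu> (G k) + \<mu> (E \<inter> C) = \<mu> (G k \<union> (E \<inter> C))"
        by (rule sep[of _ k, symmetric]) (use a0[of "Suc k"] in \<open>auto simp: G_def\<close>)
      also have "\<dots> \<le> \<mu> E" by (rule mono) (auto simp: G_def)
      finally have 2: "\<mu> (G k) + \<mu> (E \<inter> C) \<le> \<mu> E" .
      have "\<mu> (E \<inter> C) + \<mu> (E - C) \<le> \<mu> (G k) + \<mu> (E \<inter> C) + (\<Sum>i. \<mu> (R (i + k)))"
        using add_left_mono[OF 1, of "\<mu> (E \<inter> C)"] by (simp add: ac_simps)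
      also have "\<dots> \<le> \<mu> E + (\<Sum>i. \<mu> (R (i + k)))"
        by (rule add_right_mono[OF 2])
      finally show ?thesis .
    qed
    have "(\<lambda>k. \<mu> E + (\<Sum>i. \<mu> (R (i + k)))) \<longlonglongrightarrow> \<mu> E + 0"
      by (intro tendsto_intros ennreal_suminf_tail_tendsto_0[OF finR])
    then have "\<mu> (E \<inter> C) + \<mu> (E - C) \<le> \<mu> E + 0"
      using step by (intro LIMSEQ_le_const) auto
    then show ?thesis by simp
  qed
  have "\<mu> (E \<inter> C) + \<mu> (E - C) = \<mu> E" for E
  proof (rule antisym)
    show "\<mu> (E \<inter> C) + \<mu> (E - C) \<le> \<mu> E"
      \<comment> \<open>\<open>infdist\<close> to the empty set is 0 by convention, so C = {} is
        treated apart; for \<mu> E infinite there is nothing to prove.\<close>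
      using main[of E] by (cases "C = {} \<or> \<mu> E = \<infinity>") (auto simp: pos less_top)
    show "\<mu> E \<le> \<mu> (E \<inter> C) + \<mu> (E - C)"
      using sub[of "E \<inter> C" "E - C"] by (simp add: Int_Diff_Un)
  qed
  then show ?thesis by (simp add: lambda_system_eq)
qed

lemma measure_space_borel_of_metric_outer:
  fixes \<mu> :: "'a::metric_space set \<Rightarrow> ennreal"
  assumes oms: "outer_measure_space UNIV \<mu>" and add: "metric_additive \<mu>"
  shows "measure_space UNIV (sets borel) \<mu>"
proof -
  interpret S: sigma_algebra "UNIV :: 'a set" "UNIV :: 'a set set"
    by (metis sigma_algebra_Pow Pow_UNIV)
  have ms: "measure_space UNIV (lambda_system UNIV UNIV \<mu>) \<mu>"
    by (rule S.caratheodory_lemma[OF oms])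
  have "sigma_sets UNIV {S :: 'a set. closed S} \<subseteq> lambda_system UNIV UNIV \<mu>"
    using ms closed_in_lambda_system[OF oms add]
    by (intro sigma_algebra.sigma_sets_subset) (auto simp: measure_space_def)
  then have "sets borel \<subseteq> lambda_system UNIV UNIV \<mu>"
    by (simp add: borel_eq_closed)
  then have "countably_additive (sets borel) \<mu>"
    using ms unfolding measure_space_def countably_additive_def by (meson order_trans subsetD)
  moreover have "sigma_algebra UNIV (sets (borel :: 'a measure))"
    using sets.sigma_algebra_axioms[of "borel :: 'a measure"] by simp
  ultimately show ?thesis
    using ms unfolding measure_space_def positive_def by blast
qed

section \<open>The Hausdorff outer measure is metric\<close>

lemma hausdorff_pre_le:
  assumes "S \<subseteq> (\<Union>i. C i)" "\<And>i. bounded (C i)" "\<And>i. diameter (C i) \<le> \<delta>"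
  shows "hausdorff_pre m \<delta> S \<le> (\<Sum>i. ennreal (unit_ball_vol (real m) * (diameter (C i) / 2) ^ m))"
  unfolding hausdorff_pre_def using assms by (intro INF_lower) auto

lemma hausdorff_pre_mono: "S \<subseteq> S' \<Longrightarrow> hausdorff_pre m \<delta> S \<le> hausdorff_pre m \<delta> S'"
  unfolding hausdorff_pre_def by (intro INF_superset_mono) auto

lemma hausdorff_pre_antimono: "\<delta> \<le> \<delta>' \<Longrightarrow> hausdorff_pre m \<delta>' S \<le> hausdorff_pre m \<delta> S"
  unfolding hausdorff_pre_def by (intro INF_superset_mono) (auto intro: order_trans)

lemma hausdorff_pre_empty: "0 < \<delta> \<Longrightarrow> 0 < m \<Longrightarrow> hausdorff_pre m \<delta> {} = 0"
  by (rule antisym[OF order_trans[OF hausdorff_pre_le[of "{}" "\<lambda>_. {}"]]]) (auto simp: zero_power)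

lemma hausdorff_pre_countably_subadditive:
  "hausdorff_pre m \<delta> (\<Union>i. A i) \<le> (\<Sum>i. hausdorff_pre m \<delta> (A i))"
proof (rule ennreal_le_epsilon)
  let ?w = "\<lambda>C. ennreal (unit_ball_vol (real m) * (diameter C / 2) ^ m)"
  fix e :: real assume e: "0 < e" and fin: "(\<Sum>i. hausdorff_pre m \<delta> (A i)) < top"
  have "\<exists>C. A n \<subseteq> (\<Union>i. C i) \<and> (\<forall>i. bounded (C i) \<and> diameter (C i) \<le> \<delta>) \<and>
     (\<Sum>i. ?w (C i)) \<le> hausdorff_pre m \<delta> (A n) + e * (1/2) ^ Suc n" for n
  proof -
    have "hausdorff_pre m \<delta> (A n) < top" using fin by (rule ennreal_suminf_lessD)
    then have "hausdorff_pre m \<delta> (A n) < hausdorff_pre m \<delta> (A n) + e * (1/2) ^ Suc n"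
      using e by auto
    then show ?thesis
      unfolding hausdorff_pre_def[of m \<delta> "A n"] INF_less_iff by (auto intro: less_imp_le)
  qed
  then obtain B where B: "\<And>n. A n \<subseteq> (\<Union>i. B n i)" "\<And>n i. bounded (B n i)" "\<And>n i. diameter (B n i) \<le> \<delta>"
    and Ble: "\<And>n. (\<Sum>i. ?w (B n i)) \<le> hausdorff_pre m \<delta> (A n) + e * (1/2) ^ Suc n"
    by metis
  \<comment> \<open>The near-optimal covers are listed as a single sequence through the pairing of
    natural numbers; their errors e/2^(n+1) add up to e.\<close>
  define C where "C = case_prod B o prod_decode"
  have "hausdorff_pre m \<delta> (\<Union>i. A i) \<le> (\<Sum>i. ?w (C i))"
  proof (rule hausdorff_pre_le)
    show "(\<Union>i. A i) \<subseteq> (\<Union>i. C i)"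
      using B(1) by (auto simp: C_def subset_eq) (metis prod.case prod_encode_inverse)
  qed (auto simp: C_def split_def B)
  also have "\<dots> = (\<Sum>n. \<Sum>i. ?w (B n i))"
    unfolding C_def comp_def by (intro suminf_ennreal_2dimen[where f = "\<lambda>p. ?w (case_prod B p)"]) auto
  also have "\<dots> \<le> (\<Sum>n. hausdorff_pre m \<delta> (A n) + e * (1/2) ^ Suc n)"
    by (intro suminf_le allI Ble) auto
  also have "\<dots> = (\<Sum>n. hausdorff_pre m \<delta> (A n)) + (\<Sum>n. ennreal e * ennreal ((1/2) ^ Suc n))"
    using e by (subst suminf_add[symmetric])
      (auto simp del: ennreal_suminf_cmult simp add: ennreal_mult[symmetric])
  also have "\<dots> = (\<Sum>n. hausdorff_pre m \<delta> (A n)) + e"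
    unfolding ennreal_suminf_cmult
    by (subst suminf_ennreal_eq[OF zero_le_power power_half_series]) auto
  finally show "hausdorff_pre m \<delta> (\<Union>i. A i) \<le> (\<Sum>n. hausdorff_pre m \<delta> (A n)) + e" .
qed

lemma hausdorff_pre_le_outer: "0 < \<delta> \<Longrightarrow> hausdorff_pre m \<delta> S \<le> hausdorff_outer m S"
  unfolding hausdorff_outer_def by (intro SUP_upper) auto

lemma outer_measure_space_hausdorff:
  assumes "0 < m"
  shows "outer_measure_space UNIV (hausdorff_outer m)"
proof -
  have "hausdorff_outer m {} = 0"
    unfolding hausdorff_outer_def using assms by (simp add: hausdorff_pre_empty)
  moreover have "hausdorff_outer m S \<le> hausdorff_outer m S'" if "S \<subseteq> S'" for S S' :: "'a set"
    unfolding hausdorff_outer_def using that by (intro SUP_mono') (rule hausdorff_pre_mono)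
  moreover have "hausdorff_outer m (\<Union>i. A i) \<le> (\<Sum>i. hausdorff_outer m (A i))" for A :: "nat \<Rightarrow> 'a set"
    unfolding hausdorff_outer_def[of m "\<Union>i. A i"]
  proof (rule SUP_least)
    fix \<delta> :: real assume "\<delta> \<in> {0<..}"
    then show "hausdorff_pre m \<delta> (\<Union>i. A i) \<le> (\<Sum>i. hausdorff_outer m (A i))"
      by (intro order_trans[OF hausdorff_pre_countably_subadditive] suminf_le)
         (auto intro: hausdorff_pre_le_outer)
  qed
  ultimately show ?thesis
    unfolding outer_measure_space_def positive_def increasing_def countably_subadditive_def by auto
qed

text \<open>At a scale \<delta> below the separation d no covering set meets both A and B, so a
  cover of the union splits into a cover of each. A piece that becomes empty costs nothing because m
  is positive.\<close>

lemma hausdorff_pre_separated: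
  assumes m: "0 < m" and \<delta>: "0 < \<delta>" "\<delta> < d" and sep: "\<And>x y. x \<in> A \<Longrightarrow> y \<in> B \<Longrightarrow> d \<le> dist x y"
  shows "hausdorff_pre m \<delta> A + hausdorff_pre m \<delta> B \<le> hausdorff_pre m \<delta> (A \<union> B)"
  unfolding hausdorff_pre_def[of m \<delta> "A \<union> B"]
proof (rule INF_greatest, clarify)
  let ?w = "\<lambda>C. ennreal (unit_ball_vol (real m) * (diameter C / 2) ^ m)"
  fix C :: "nat \<Rightarrow> 'a set"
  assume cov: "A \<union> B \<subseteq> (\<Union>i. C i)" and C: "\<forall>i. bounded (C i) \<and> diameter (C i) \<le> \<delta>"
  have le: "diameter (C i \<inter> D) \<le> diameter (C i)" for i D
    using C by (intro diameter_subset) auto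
  have wle: "?w (C i \<inter> D) \<le> ?w (C i)" for i D
    using C le[of i D] diameter_ge_0[of "C i \<inter> D"] 
    by (intro ennreal_leI mult_left_mono power_mono) (auto intro: bounded_subset)
  have w: "?w (C i \<inter> A) + ?w (C i \<inter> B) \<le> ?w (C i)" for i
  proof (cases "C i \<inter> A = {} \<or> C i \<inter> B = {}")
    case True
    then show ?thesis using m wle[of i A] wle[of i B] by (auto simp: zero_power)
  next
    case False
    then obtain x y where xy: "x \<in> C i" "x \<in> A" "y \<in> C i" "y \<in> B" by blast
    then have "d \<le> diameter (C i)"
      using sep[of x y] diameter_bounded_bound[of "C i" x y] C by fastforce
    then show ?thesis using C \<delta> by (metis leD order_le_less_trans)
  qed
  have "hausdorff_pre m \<delta> A + hausdorff_pre m \<delta> B \<le> (\<Sum>i. ?w (C i \<inter> A)) + (\<Sum>i. ?w (C i \<inter> B))"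
    using cov C le by (intro add_mono hausdorff_pre_le) (auto intro: bounded_subset order_trans)
  also have "\<dots> = (\<Sum>i. ?w (C i \<inter> A) + ?w (C i \<inter> B))"
    by (intro suminf_add) auto
  also have "\<dots> \<le> (\<Sum>i. ?w (C i))"
    by (intro suminf_le w) auto
  finally show "hausdorff_pre m \<delta> A + hausdorff_pre m \<delta> B \<le> (\<Sum>i. ?w (C i))" .
qed

lemma metric_additive_hausdorff:
  assumes m: "0 < m"
  shows "metric_additive (hausdorff_outer m)"
  unfolding metric_additive_def
proof (intro allI impI antisym)
  fix A B :: "'a set" and d :: real
  assume d: "0 < d" and sep: "\<forall>x\<in>A. \<forall>y\<in>B. d \<le> dist x y"
  show "hausdorff_outer m (A \<union> B) \<le> hausdorff_outer m A + hausdorff_outer m B"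
    unfolding hausdorff_outer_def[of m "A \<union> B"]
  proof (rule SUP_least)
    fix \<delta> :: real assume \<delta>: "\<delta> \<in> {0<..}"
    have "hausdorff_pre m \<delta> (A \<union> B) = hausdorff_pre m \<delta> (\<Union>i. binaryset A B i)"
      by (simp add: Un_range_binary UN_binaryset_eq)
    also have "\<dots> \<le> (\<Sum>i. hausdorff_pre m \<delta> (binaryset A B i))"
      by (rule hausdorff_pre_countably_subadditive)
    also have "\<dots> = hausdorff_pre m \<delta> A + hausdorff_pre m \<delta> B"
      using \<delta> m by (intro suminf_binaryset_eq) (simp add: hausdorff_pre_empty)
    also have "\<dots> \<le> hausdorff_outer m A + hausdorff_outer m B"
      using \<delta> by (intro add_mono hausdorff_pre_le_outer) auto
    finally show "hausdorff_pre m \<delta> (A \<union> B) \<le> hausdorff_outer m A + hausdorff_outer m B" .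
  qed
  \<comment> \<open>Two independent scales are kept so that the suprema defining the two outer
    measures can be taken one after the other; both are compared with a common smaller scale \<eta>
    < d.\<close>
  have le: "hausdorff_pre m \<delta> A + hausdorff_pre m \<epsilon> B \<le> hausdorff_outer m (A \<union> B)"
    if "0 < \<delta>" "0 < \<epsilon>" for \<delta> \<epsilon>
  proof -
    define \<eta> where "\<eta> = min (min \<delta> \<epsilon>) (d / 2)"
    have \<eta>: "0 < \<eta>" "\<eta> < d" "\<eta> \<le> \<delta>" "\<eta> \<le> \<epsilon>" using that d by (auto simp: \<eta>_def)
    have "hausdorff_pre m \<delta> A + hausdorff_pre m \<epsilon> B \<le> hausdorff_pre m \<eta> A + hausdorff_pre m \<eta> B"
      by (intro add_mono hausdorff_pre_antimono \<eta>)
    also have "\<dots> \<le> hausdorff_pre m \<eta> (A \<union> B)"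
      using sep by (intro hausdorff_pre_separated[OF m \<eta>(1,2)]) auto
    also have "\<dots> \<le> hausdorff_outer m (A \<union> B)"
      by (rule hausdorff_pre_le_outer[OF \<eta>(1)])
    finally show ?thesis .
  qed
  have ne: "{0::real<..} \<noteq> {}" by auto
  have 1: "hausdorff_pre m \<delta> A + hausdorff_outer m B \<le> hausdorff_outer m (A \<union> B)" if "0 < \<delta>" for \<delta>
    unfolding hausdorff_outer_def[of m B] ennreal_SUP_add_right[OF ne]
    using le[OF that] by (intro SUP_least) auto
  have "hausdorff_outer m B + hausdorff_outer m A \<le> hausdorff_outer m (A \<union> B)"
    unfolding hausdorff_outer_def[of m A] ennreal_SUP_add_right[OF ne]
    using 1 by (intro SUP_least) (auto simp: add.commute)
  then show "hausdorff_outer m A + hausdorff_outer m B \<le> hausdorff_outer m (A \<union> B)"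
    by (simp add: add.commute)
qed

text \<open>\<open>measure_of\<close> evaluates to the given set function only when that function is
  a measure on the generated sigma-algebra; this is what metric additivity was established
  for.\<close>

lemma emeasure_hausdorff_measure:
  assumes "0 < m" "B \<in> sets borel"
  shows "emeasure (hausdorff_measure m) B = hausdorff_outer m B"
proof -
  have "measure_space UNIV (sets (borel :: 'a measure)) (hausdorff_outer m)"
    by (rule measure_space_borel_of_metric_outer
        [OF outer_measure_space_hausdorff metric_additive_hausdorff]) fact+
  then show ?thesis
    unfolding hausdorff_measure_def measure_space_def using assms
    by (intro emeasure_measure_of_sigma) auto
qed

lemma space_hausdorff_measure [simp]: "space (hausdorff_measure m) = UNIV"
  unfolding hausdorff_measure_def by (simp add: space_measure_of)

lemma sets_hausdorff_measure [simp, measurable_cong]: "sets (hausdorff_measure m) = sets borel"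
  unfolding hausdorff_measure_def
  by (metis sets.sigma_sets_eq sets_measure_of space_borel subset_UNIV Pow_UNIV)

section \<open>Smooth functions and the fundamental lemma\<close>

lemma C_k_cong_Suc:
  assumes "\<And>x. (f has_derivative f' x) (at x)"
  shows "C_k (Suc k) f \<longleftrightarrow> (\<forall>b\<in>Basis. C_k k (\<lambda>x. f' x b))"
proof -
  have "frechet_derivative f (at x) = f' x" for x
    using frechet_derivative_at[OF assms] by simp
  moreover have "f differentiable_on UNIV"
    using assms by (auto simp: differentiable_on_def differentiable_def)
  ultimately show ?thesis by simp
qed

lemma C_k_Suc_has_derivative:
  "C_k (Suc k) f \<Longrightarrow> (f has_derivative frechet_derivative f (at x)) (at x)"
  by (simp add: differentiable_on_def frechet_derivative_works)

lemma C_k_const: "C_k k (\<lambda>_. c)"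
proof (induction k arbitrary: c)
  case (Suc k)
  show ?case by (subst C_k_cong_Suc[where f' = "\<lambda>_ _. 0"]) (auto intro: Suc)
qed simp

lemma C_k_add: "C_k k f \<Longrightarrow> C_k k g \<Longrightarrow> C_k k (\<lambda>x. f x + g x)"
proof (induction k arbitrary: f g)
  case (Suc k)
  note d = C_k_Suc_has_derivative[OF Suc.prems(1)] C_k_Suc_has_derivative[OF Suc.prems(2)]
  show ?case
    unfolding C_k_cong_Suc[OF has_derivative_add[OF d]] using Suc by simp
qed (auto intro: continuous_intros)

lemma C_k_SucD: "C_k (Suc k) f \<Longrightarrow> C_k k f"
proof (induction k arbitrary: f)
  case 0
  then show ?case by (simp add: differentiable_imp_continuous_on)
next
  case (Suc k)
  then show ?case by (metis C_k.simps(2))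
qed

lemma C_k_mult: "C_k k f \<Longrightarrow> C_k k g \<Longrightarrow> C_k k (\<lambda>x. f x * g x)"
proof (induction k arbitrary: f g)
  case (Suc k)
  note d = C_k_Suc_has_derivative[OF Suc.prems(1)] C_k_Suc_has_derivative[OF Suc.prems(2)]
  show ?case
    unfolding C_k_cong_Suc[OF has_derivative_mult[OF d]]
  proof
    fix b :: 'a assume b: "b \<in> Basis"
    show "C_k k (\<lambda>x. f x * frechet_derivative g (at x) b + frechet_derivative f (at x) b * g x)"
      using Suc.prems b by (intro C_k_add Suc.IH) (auto intro: C_k_SucD)
  qed
qed (auto intro: continuous_intros)

text \<open>Differentiating along b moves n to n + 1 and produces a constant factor b \<bullet> v,
  which is absorbed into c. The induction on k therefore needs the statement for all n and
  c.\<close>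

lemma C_k_compose_affine:
  fixes p :: "nat \<Rightarrow> real \<Rightarrow> real" and v :: "'a::euclidean_space"
  assumes p: "\<And>n t. (p n has_real_derivative p (Suc n) t) (at t)"
  shows "C_k k (\<lambda>x. c * p n (x \<bullet> v + d))"
proof (induction k arbitrary: c n)
  case 0
  have "continuous_on UNIV (p n)"
    using p by (meson DERIV_continuous continuous_at_imp_continuous_on)
  then show ?case
    by (auto intro!: continuous_intros intro: continuous_on_compose2)
next
  case (Suc k)
  have "((\<lambda>x. c * p n (x \<bullet> v + d)) has_derivative (\<lambda>h. c * (p (Suc n) (x \<bullet> v + d) * (h \<bullet> v)))) (at x)" for x :: 'a
    by (rule has_derivative_mult_right has_derivative_compose[OF _ p[THEN has_field_derivative_imp_has_derivative]])+
       (auto intro!: derivative_eq_intros)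
  then show ?case
    using Suc[of "c * (_ \<bullet> v)" "Suc n"] by (subst C_k_cong_Suc) (auto simp: ac_simps)
qed

lemma smooth_const: "smooth (\<lambda>_. c)"
  by (simp add: smooth_def C_k_const)

lemma smooth_add: "smooth f \<Longrightarrow> smooth g \<Longrightarrow> smooth (\<lambda>x. f x + g x)"
  by (simp add: smooth_def C_k_add)

lemma smooth_mult: "smooth f \<Longrightarrow> smooth g \<Longrightarrow> smooth (\<lambda>x. f x * g x)"
  by (simp add: smooth_def C_k_mult)

lemma smooth_prod: "(\<And>i. i \<in> I \<Longrightarrow> smooth (f i)) \<Longrightarrow> smooth (\<lambda>x. \<Prod>i\<in>I. f i x)"
  by (induction I rule: infinite_finite_induct) (auto intro: smooth_const smooth_mult)

lemma smooth_has_derivative: "smooth f \<Longrightarrow> (f has_derivative frechet_derivative f (at x)) (at x)"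
  unfolding smooth_def using C_k_Suc_has_derivative[of 0] by blast

lemma smooth_continuous: "smooth f \<Longrightarrow> continuous_on S f"
  unfolding smooth_def by (metis C_k.simps(1) continuous_on_subset subset_UNIV)

lemma smooth_continuous_grad: "smooth f \<Longrightarrow> continuous_on S (grad f)"
proof -
  assume "smooth f"
  then have "C_k 1 f" by (simp only: smooth_def)
  then have "continuous_on UNIV (\<lambda>x. frechet_derivative f (at x) b)" if "b \<in> Basis" for b
    using that by simp
  then have "continuous_on S (\<lambda>x. frechet_derivative f (at x) b)" if "b \<in> Basis" for b
    using that continuous_on_subset by blast
  then show ?thesis
    unfolding grad_def by (intro continuous_intros) auto
qed

lemma smooth_derivative_grad:
  assumes "smooth f"
  shows "frechet_derivative f (at x) v = grad f x \<bullet> v"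
proof -
  interpret linear "frechet_derivative f (at x)"
    using smooth_has_derivative[OF assms] by (rule has_derivative_linear)
  have "frechet_derivative f (at x) v = frechet_derivative f (at x) (\<Sum>b\<in>Basis. (v \<bullet> b) *\<^sub>R b)"
    by (simp add: euclidean_representation)
  also have "\<dots> = grad f x \<bullet> v"
    by (simp add: sum scale grad_def inner_sum_left inner_commute[of v] mult.commute)
  finally show ?thesis .
qed

lemma grad_add:
  assumes "smooth f" "smooth g"
  shows "grad (\<lambda>x. f x + g x) x = grad f x + grad g x"
proof -
  have "frechet_derivative (\<lambda>x. f x + g x) (at x) =
      (\<lambda>h. frechet_derivative f (at x) h + frechet_derivative g (at x) h)"
    by (rule frechet_derivative_at[symmetric] has_derivative_add smooth_has_derivative assms)+
  then show ?thesis
    by (simp add: grad_def sum.distrib algebra_simps)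
qed

lemma grad_cmult:
  assumes "smooth f"
  shows "grad (\<lambda>x. c * f x) x = c *\<^sub>R grad f x"
proof -
  have "frechet_derivative (\<lambda>x. c * f x) (at x) = (\<lambda>h. c * frechet_derivative f (at x) h)"
    by (rule frechet_derivative_at[symmetric] has_derivative_mult_right smooth_has_derivative assms)+
  then show ?thesis
    by (simp add: grad_def scaleR_sum_right)
qed

text \<open>The iterated derivatives of \<open>exp (- 1 / t)\<close>, extended by 0 to \<open>t \<le> 0\<close>, have the form
  \<open>P (1 / t) * exp (- 1 / t)\<close>; with \<open>y = 1 / t\<close>, differentiation sends \<open>P\<close> to \<open>y\<^sup>2 (P - P')\<close>.\<close>

primrec flat_poly :: "nat \<Rightarrow> real poly" where
  "flat_poly 0 = 1"
| "flat_poly (Suc n) = monom 1 2 * (flat_poly n - pderiv (flat_poly n))"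

definition flat :: "nat \<Rightarrow> real \<Rightarrow> real" where
  "flat n t = (if 0 < t then poly (flat_poly n) (1 / t) * exp (- (1 / t)) else 0)"

lemma poly_times_exp_minus_tendsto_0:
  fixes p :: "real poly"
  shows "((\<lambda>y. poly p y * exp (- y)) \<longlongrightarrow> 0) at_top"
proof -
  have "((\<lambda>y. \<Sum>i\<le>degree p. coeff p i * (y ^ i / exp y)) \<longlongrightarrow> (\<Sum>i\<le>degree p. coeff p i * 0)) at_top"
    by (intro tendsto_sum tendsto_mult tendsto_const tendsto_power_div_exp_0)
  then show ?thesis
    by (simp add: poly_altdef sum_distrib_right exp_minus divide_inverse mult.assoc)
qed

lemma flat_has_derivative: "(flat n has_real_derivative flat (Suc n) t) (at t)"
proof -
  consider "t < 0" | "t = 0" | "0 < t" by linarith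
  then show ?thesis
  proof cases
    case 1
    have "((\<lambda>_. 0) has_real_derivative 0) (at t)" by simp
    then have "(flat n has_real_derivative 0) (at t)"
      by (rule has_field_derivative_transform_within_open[of _ _ _ "{..<0}"]) (use 1 in \<open>auto simp: flat_def\<close>)
    then show ?thesis using 1 by (simp add: flat_def)
  next
    case 2
    have r: "((\<lambda>h. flat n h / h) \<longlongrightarrow> 0) (at_right 0)"
      unfolding filterlim_at_right_to_top
    proof (rule Lim_transform_eventually)
      \<comment> \<open>With y = 1/h the difference quotient at 0 becomes y * P(y) * exp(-y);
        \<open>pCons 0\<close> is multiplication by y.\<close>
      show "((\<lambda>y. poly (pCons 0 (flat_poly n)) y * exp (- y)) \<longlongrightarrow> 0) at_top"
        by (rule poly_times_exp_minus_tendsto_0)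
      show "\<forall>\<^sub>F y in at_top. poly (pCons 0 (flat_poly n)) y * exp (- y) = flat n (inverse y) / inverse y"
        using eventually_gt_at_top[of 0] by eventually_elim (simp add: flat_def field_simps)
    qed
    have l: "((\<lambda>h. flat n h / h) \<longlongrightarrow> 0) (at_left 0)"
    proof (rule Lim_transform_eventually[OF tendsto_const])
      show "\<forall>\<^sub>F h in at_left 0. 0 = flat n h / h"
        unfolding eventually_at_filter by (auto simp: flat_def)
    qed
    have "(\<lambda>h. (flat n (0 + h) - flat n 0) / h) \<midarrow>0\<rightarrow> 0"
      using filterlim_split_at[OF l r] by (simp add: flat_def)
    then show ?thesis using 2 by (simp add: DERIV_def flat_def)
  next
    case 3
    have "((\<lambda>t. poly (flat_poly n) (1 / t) * exp (- (1 / t))) has_real_derivative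
        (poly (pderiv (flat_poly n)) (1 / t) * (- 1 / t\<^sup>2)) * exp (- (1 / t)) +
        poly (flat_poly n) (1 / t) * (exp (- (1 / t)) * (1 / t\<^sup>2))) (at t)"
      using 3 by (auto intro!: derivative_eq_intros DERIV_chain2[OF poly_DERIV] simp: power2_eq_square)
    also have "(poly (pderiv (flat_poly n)) (1 / t) * (- 1 / t\<^sup>2)) * exp (- (1 / t)) +
        poly (flat_poly n) (1 / t) * (exp (- (1 / t)) * (1 / t\<^sup>2)) = flat (Suc n) t"
      using 3 by (simp add: flat_def poly_monom power_one_over algebra_simps)
    finally have "((\<lambda>t. poly (flat_poly n) (1 / t) * exp (- (1 / t))) has_real_derivative flat (Suc n) t) (at t)" .
    then show ?thesis
      by (rule has_field_derivative_transform_within_open[of _ _ _ "{0<..}"]) (use 3 in \<open>auto simp: flat_def\<close>)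
  qed
qed

text \<open>A smooth substitute for the indicator of \<open>box a u\<close>: a factor
  \<open>flat 0 (r * s)\<close> is 0 for s \<le> 0 and exp(-1/(r s)) for s > 0, which tends to 1 as
  the sharpness r grows.\<close>

definition box_bump :: "real \<Rightarrow> 'a::euclidean_space \<Rightarrow> 'a \<Rightarrow> 'a \<Rightarrow> real" where
  "box_bump r a u x = (\<Prod>b\<in>Basis. flat 0 (r * ((x - a) \<bullet> b)) * flat 0 (r * ((u - x) \<bullet> b)))"

lemma flat_0_bounds: "0 \<le> flat 0 t" "flat 0 t \<le> 1"
  by (auto simp: flat_def)

lemma box_bump_bounds: "0 \<le> box_bump r a u x" "box_bump r a u x \<le> 1"
  unfolding box_bump_def by (auto intro!: prod_nonneg prod_le_1 mult_le_one simp: flat_0_bounds)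

lemma box_bump_outside: "0 \<le> r \<Longrightarrow> x \<notin> box a u \<Longrightarrow> box_bump r a u x = 0"
  unfolding box_bump_def mem_box
  by (auto simp: flat_def inner_diff_left not_less zero_less_mult_iff; rule bexI[rotated], assumption, simp)

lemma smooth_box_bump: "smooth (box_bump r a u)"
proof -
  have "smooth (\<lambda>x. flat 0 (r * ((x - a) \<bullet> b)))" for b
  proof -
    have "C_k k (\<lambda>x. 1 * flat 0 (x \<bullet> (r *\<^sub>R b) + - r * (a \<bullet> b)))" for k
      by (rule C_k_compose_affine[where p = flat and n = 0, OF flat_has_derivative])
    then show ?thesis by (simp add: smooth_def inner_diff_left algebra_simps)
  qed
  moreover have "smooth (\<lambda>x. flat 0 (r * ((u - x) \<bullet> b)))" for b
  proof -
    have "C_k k (\<lambda>x. 1 * flat 0 (x \<bullet> (- r *\<^sub>R b) + r * (u \<bullet> b)))" for k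
      by (rule C_k_compose_affine[where p = flat and n = 0, OF flat_has_derivative])
    then show ?thesis by (simp add: smooth_def inner_diff_left algebra_simps)
  qed
  ultimately show ?thesis
    unfolding box_bump_def[abs_def] by (intro smooth_prod smooth_mult)
qed

lemma test_function_box_bump:
  assumes "cbox a u \<subseteq> \<Omega>" "0 \<le> r"
  shows "test_function \<Omega> (box_bump r a u)"
  unfolding test_function_def using assms smooth_box_bump box_bump_outside box_subset_cbox
  by (metis compact_cbox in_mono)

lemma box_bump_tendsto_indicator:
  "(\<lambda>n. box_bump (real n) a u x) \<longlonglongrightarrow> indicator (box a u) x"
proof (cases "x \<in> box a u")
  case False
  then show ?thesis by (simp add: box_bump_outside)
next
  case True
  have fl: "(\<lambda>n. flat 0 (real n * s)) \<longlonglongrightarrow> 1" if "0 < s" for s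
  proof (rule Lim_transform_eventually)
    have "(\<lambda>n. inverse (real n) * inverse s) \<longlonglongrightarrow> 0"
      by (intro tendsto_mult_left_zero lim_inverse_n)
    then have "(\<lambda>n. exp (- (inverse (real n) * inverse s))) \<longlonglongrightarrow> exp (- 0)"
      by (intro tendsto_intros)
    then show "(\<lambda>n. exp (- (inverse (real n) * inverse s))) \<longlonglongrightarrow> 1" by simp
    show "\<forall>\<^sub>F n in sequentially. exp (- (inverse (real n) * inverse s)) = flat 0 (real n * s)"
      using eventually_gt_at_top[of 0]
      by eventually_elim (use that in \<open>simp add: flat_def inverse_eq_divide\<close>)
  qed
  have "(\<lambda>n. box_bump (real n) a u x) \<longlonglongrightarrow> (\<Prod>b\<in>(Basis::'a set). 1 * 1)"
    unfolding box_bump_def using True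
    by (intro tendsto_prod tendsto_mult fl) (auto simp: mem_box inner_diff_left)
  then show ?thesis using True by simp
qed

text \<open>The bumps are test functions with values in [0,1] that converge to the indicator of the
  box, so dominated convergence with bound |g| transfers the vanishing to boxes. The faces of the
  box are negligible.\<close>

lemma integral_box_zero_of_test_functions:
  fixes g :: "'a::euclidean_space \<Rightarrow> real"
  assumes \<Omega>: "open \<Omega>" and g: "integrable (lebesgue_on \<Omega>) g"
    and z: "\<And>\<phi>. test_function \<Omega> \<phi> \<Longrightarrow> (LINT x|lebesgue_on \<Omega>. g x * \<phi> x) = 0"
    and ab: "cbox a u \<subseteq> \<Omega>"
  shows "integral (cbox a u) g = 0"
proof -
  have S: "\<Omega> \<in> sets lebesgue" using \<Omega> by simp
  have bs: "box a u \<subseteq> \<Omega>" using ab box_subset_cbox by blast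
  have "(\<lambda>n. LINT x|lebesgue_on \<Omega>. g x * box_bump (real n) a u x)
      \<longlonglongrightarrow> (LINT x|lebesgue_on \<Omega>. g x * indicator (box a u) x)"
  proof (rule integral_dominated_convergence[where w = "\<lambda>x. \<bar>g x\<bar>"])
    have [measurable]: "g \<in> borel_measurable (lebesgue_on \<Omega>)" using g by auto
    have [measurable]: "box_bump (real n) a u \<in> borel_measurable (lebesgue_on \<Omega>)" for n
      by (intro measurable_restrict_space1 measurable_completion)
         (simp add: smooth_continuous[OF smooth_box_bump] borel_measurable_continuous_onI)
    have [measurable]: "(indicator (box a u) :: 'a \<Rightarrow> real) \<in> borel_measurable (lebesgue_on \<Omega>)"
      by (intro measurable_restrict_space1 measurable_completion) auto
    show "(\<lambda>x. g x * indicator (box a u) x) \<in> borel_measurable (lebesgue_on \<Omega>)"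
      "\<And>n. (\<lambda>x. g x * box_bump (real n) a u x) \<in> borel_measurable (lebesgue_on \<Omega>)"
      by measurable
    show "AE x in lebesgue_on \<Omega>. norm (g x * box_bump (real n) a u x) \<le> \<bar>g x\<bar>" for n
      using box_bump_bounds[of "real n" a u] by (auto simp: abs_mult intro!: mult_left_le)
    show "AE x in lebesgue_on \<Omega>. (\<lambda>n. g x * box_bump (real n) a u x) \<longlonglongrightarrow> g x * indicator (box a u) x"
      by (intro AE_I2 tendsto_mult tendsto_const box_bump_tendsto_indicator)
  qed (use g in auto)
  then have "(LINT x|lebesgue_on \<Omega>. g x * indicator (box a u) x) = 0"
    using z[OF test_function_box_bump[OF ab]] by (simp add: LIMSEQ_const_iff)
  moreover have "(LINT x|lebesgue_on \<Omega>. g x * indicator (box a u) x) =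
      (LINT x|lebesgue_on (box a u). g x)"
    using S bs by (subst (1 2) integral_restrict_space)
      (auto intro!: Bochner_Integration.integral_cong simp: indicator_def)
  moreover have "(LINT x|lebesgue_on (box a u). g x) = integral (box a u) g"
  proof (rule lebesgue_integral_eq_integral)
    show "integrable (lebesgue_on (box a u)) g"
      using set_integrable_subset[of lebesgue \<Omega> g "box a u"] g S bs
      by (simp add: set_integrable_def integrable_restrict_space)
  qed auto
  ultimately show ?thesis
    by (simp add: integral_open_interval)
qed

text \<open>Lebesgue differentiation along small cubes with corner x: almost every g x is a limit of
  cube averages, and these vanish once the cube lies in \<Omega>.\<close>

lemma fundamental_lemma_variations:
  fixes g :: "'a::euclidean_space \<Rightarrow> real"
  assumes \<Omega>: "open \<Omega>" and g: "integrable (lebesgue_on \<Omega>) g"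
    and z: "\<And>\<phi>. test_function \<Omega> \<phi> \<Longrightarrow> (LINT x|lebesgue_on \<Omega>. g x * \<phi> x) = 0"
  shows "AE x in lebesgue_on \<Omega>. g x = 0"
proof -
  have S: "\<Omega> \<in> sets lebesgue" using \<Omega> by simp
  \<comment> \<open>Extension by zero, since the differentiation theorem asks for integrability on
    every box of the whole space.\<close>
  define h where "h x = (if x \<in> \<Omega> then g x else 0)" for x
  have "g absolutely_integrable_on \<Omega>"
    using g S by (simp add: set_integrable_def integrable_restrict_space)
  then have "h absolutely_integrable_on UNIV"
    unfolding h_def by (simp add: absolutely_integrable_restrict_UNIV)
  then have int: "h integrable_on cbox a b" for a b
    using absolutely_integrable_on_def integrable_on_subcbox by blast
  obtain N where N: "negligible N" and
    conv: "\<And>x e. x \<notin> N \<Longrightarrow> 0 < e \<Longrightarrow>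
       \<exists>d>0. \<forall>r. 0 < r \<and> r < d \<longrightarrow> norm (integral (cbox x (x + r *\<^sub>R One)) h /\<^sub>R r ^ DIM('a) - h x) < e"
    using integrable_ccontinuous_explicit[OF int] by blast
  have "g x = 0" if x: "x \<in> \<Omega>" "x \<notin> N" for x
  proof (rule ccontr)
    assume "g x \<noteq> 0"
    then obtain d where d: "d > 0" and
      dd: "\<And>r. 0 < r \<Longrightarrow> r < d \<Longrightarrow> norm (integral (cbox x (x + r *\<^sub>R One)) h /\<^sub>R r ^ DIM('a) - h x) < \<bar>g x\<bar>"
      using conv[OF x(2), of "\<bar>g x\<bar>"] by auto
    obtain \<epsilon> where \<epsilon>: "0 < \<epsilon>" "cball x \<epsilon> \<subseteq> \<Omega>"
      using \<Omega> x open_contains_cball by blast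
    \<comment> \<open>A point of the cube of side r is at l1-distance at most r * DIM from the
      corner, so this r keeps the cube inside the ball of radius \<epsilon>.\<close>
    define r where "r = min (d / 2) (\<epsilon> / real DIM('a))"
    have r: "0 < r" "r < d" "r * real DIM('a) \<le> \<epsilon>"
      using d \<epsilon> by (auto simp: r_def min_def field_simps)
    have "cbox x (x + r *\<^sub>R One) \<subseteq> cball x \<epsilon>"
    proof
      fix y assume y: "y \<in> cbox x (x + r *\<^sub>R One)"
      have "norm (y - x) \<le> (\<Sum>b\<in>Basis. \<bar>(y - x) \<bullet> b\<bar>)" by (rule norm_le_l1)
      also have "\<dots> \<le> (\<Sum>b\<in>(Basis::'a set). r)"
        using y by (intro sum_mono) (auto simp: mem_box inner_diff_left inner_add_left abs_le_iff algebra_simps)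
      also have "\<dots> \<le> \<epsilon>" using r by (simp add: mult.commute)
      finally show "y \<in> cball x \<epsilon>" by (simp add: dist_norm norm_minus_commute)
    qed
    then have sub: "cbox x (x + r *\<^sub>R One) \<subseteq> \<Omega>" using \<epsilon> by blast
    have "integral (cbox x (x + r *\<^sub>R One)) h = integral (cbox x (x + r *\<^sub>R One)) g"
      using sub by (intro integral_cong) (auto simp: h_def)
    also have "\<dots> = 0"
      by (rule integral_box_zero_of_test_functions[OF \<Omega> g z sub])
    finally show False
      using dd[OF r(1,2)] x by (simp add: h_def)
  qed
  then show ?thesis
    using N S unfolding AE_restrict_space_iff[of \<Omega> lebesgue, simplified, OF S]
    by (intro AE_I'[of N]) (auto simp: negligible_iff_null_sets)
qed

section \<open>Friedrichs inequality with boundary term\<close>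

lemma surface_measure_borel:
  shows space_surface_measure: "space (surface_measure \<Omega>) = frontier \<Omega>"
    and sets_surface_measure: "sets (surface_measure \<Omega>) = sets (restrict_space borel (frontier \<Omega>))"
proof -
  show "space (surface_measure \<Omega>) = frontier \<Omega>"
    by (simp add: surface_measure_def space_restrict_space)
  show "sets (surface_measure \<Omega>) = sets (restrict_space borel (frontier \<Omega>))"
    unfolding surface_measure_def by (intro sets_restrict_space_cong) simp
qed

lemma emeasure_surface_measure:
  fixes \<Omega> :: "'a::euclidean_space set"
  assumes "2 \<le> DIM('a)" "B \<in> sets borel" "B \<subseteq> frontier \<Omega>"
  shows "emeasure (surface_measure \<Omega>) B = hausdorff_outer (DIM('a) - 1) B"
  unfolding surface_measure_def using assms
  by (subst emeasure_restrict_space) (auto simp: emeasure_hausdorff_measure)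

lemma borel_measurable_surface:
  "continuous_on UNIV f \<Longrightarrow> f \<in> borel_measurable (surface_measure \<Omega>)"
  unfolding measurable_cong_sets[OF sets_surface_measure refl]
  by (intro measurable_restrict_space1 borel_measurable_continuous_onI)

lemma borel_measurable_lebesgue_on:
  "continuous_on UNIV f \<Longrightarrow> f \<in> borel_measurable (lebesgue_on \<Omega>)"
  by (intro measurable_restrict_space1 measurable_completion) (simp add: borel_measurable_continuous_onI)

section \<open>Exit times and the law of the exit point\<close>

definition exit_time :: "'a::euclidean_space set \<Rightarrow> 'a \<Rightarrow> 'a \<Rightarrow> real" where
  "exit_time \<Omega> e x = Inf {t. 0 \<le> t \<and> x - t *\<^sub>R e \<notin> \<Omega>}"

definition exit_point :: "'a::euclidean_space set \<Rightarrow> 'a \<Rightarrow> 'a \<Rightarrow> 'a" where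
  "exit_point \<Omega> e x = x - exit_time \<Omega> e x *\<^sub>R e"

context
  fixes \<Omega> :: "'a::euclidean_space set" and e :: 'a and R :: real
  assumes op: "open \<Omega>" and e: "e \<in> Basis" and R: "0 < R" "\<Omega> \<subseteq> cball 0 R"
begin

text \<open>The times at which the backward ray is outside \<Omega> form a closed set, so the
  infimum is attained. The set contains 2 R + 1: a shift by this length moves a point of
  \<open>cball 0 R\<close> to norm at least R + 1.\<close>

lemma exit_time:
  assumes x: "x \<in> \<Omega>"
  shows exit_point_notin: "exit_point \<Omega> e x \<notin> \<Omega>"
    and exit_time_pos: "0 < exit_time \<Omega> e x"
    and exit_time_le: "exit_time \<Omega> e x \<le> 2 * R + 1"
    and before_exit: "0 \<le> s \<Longrightarrow> s < exit_time \<Omega> e x \<Longrightarrow> x - s *\<^sub>R e \<in> \<Omega>"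
proof -
  define Ts where "Ts = {t. 0 \<le> t \<and> x - t *\<^sub>R e \<notin> \<Omega>}"
  have Ts': "Ts = {0..} \<inter> ((\<lambda>t. x - t *\<^sub>R e) -` (- \<Omega>))" by (auto simp: Ts_def)
  have cl: "closed Ts"
    unfolding Ts' using op by (intro closed_Int closed_atLeast continuous_closed_vimage) (auto intro!: continuous_intros)
  have "2 * R + 1 \<in> Ts"
  proof -
    have "norm x \<le> R" using x R by auto
    moreover have "norm ((2 * R + 1) *\<^sub>R e) = 2 * R + 1" using e R by simp
    ultimately have "R < norm (x - (2 * R + 1) *\<^sub>R e)"
      using norm_triangle_ineq2[of "(2 * R + 1) *\<^sub>R e" x] by (simp add: norm_minus_commute)
    then have "x - (2 * R + 1) *\<^sub>R e \<notin> \<Omega>" using R by force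
    then show ?thesis using R by (simp add: Ts_def)
  qed
  moreover have bdd: "bdd_below Ts" by (auto simp: Ts_def intro: bdd_belowI[of _ 0])
  ultimately have mem: "Inf Ts \<in> Ts" and le: "Inf Ts \<le> 2 * R + 1"
    using closed_contains_Inf[OF _ bdd cl] cInf_lower[OF _ bdd] by auto
  have et: "exit_time \<Omega> e x = Inf Ts" by (simp add: exit_time_def Ts_def)
  show "exit_point \<Omega> e x \<notin> \<Omega>" using mem by (simp add: exit_point_def et Ts_def)
  have "Inf Ts \<noteq> 0" using mem x by (auto simp: Ts_def)
  then show "0 < exit_time \<Omega> e x" using mem by (simp add: et Ts_def)
  show "exit_time \<Omega> e x \<le> 2 * R + 1" using le by (simp add: et)
  show "x - s *\<^sub>R e \<in> \<Omega>" if "0 \<le> s" "s < exit_time \<Omega> e x"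
    using that cInf_lower[OF _ bdd, of s] unfolding et by (auto simp: Ts_def)
qed

lemma exit_point_frontier:
  assumes x: "x \<in> \<Omega>"
  shows "exit_point \<Omega> e x \<in> frontier \<Omega>"
proof -
  let ?t = "exit_time \<Omega> e x"
  have "exit_point \<Omega> e x \<in> closure \<Omega>"
    unfolding closure_approachable
  proof (intro allI impI)
    fix \<epsilon> :: real assume \<epsilon>: "0 < \<epsilon>"
    define s where "s = max 0 (?t - \<epsilon> / 2)"
    have s: "0 \<le> s" "s < ?t" "?t - s < \<epsilon>"
      using \<epsilon> exit_time_pos[OF x] by (auto simp: s_def)
    have "x - s *\<^sub>R e - exit_point \<Omega> e x = (?t - s) *\<^sub>R e"
      by (simp add: exit_point_def algebra_simps)
    then have "dist (x - s *\<^sub>R e) (exit_point \<Omega> e x) = ?t - s"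
      using s e by (simp add: dist_norm)
    then show "\<exists>y\<in>\<Omega>. dist y (exit_point \<Omega> e x) < \<epsilon>"
      using s before_exit[OF x s(1,2)] by metis
  qed
  then show ?thesis
    using exit_point_notin[OF x] op by (simp add: frontier_def interior_open)
qed

text \<open>Lower semicontinuity: within \<Omega>, the exit time is at most a exactly on the sum of
  the complement of \<Omega> and the segment [0,a] e, and a closed set plus a compact one is
  closed.\<close>

lemma exit_time_measurable: "exit_time \<Omega> e \<in> borel_measurable (restrict_space lborel \<Omega>)"
proof (rule borel_measurableI_greater)
  fix a :: real
  let ?U = "- {z. \<exists>s\<in>{0..a}. \<exists>y\<in>- \<Omega>. z = y + s *\<^sub>R e}"
  have "{x \<in> space (restrict_space lborel \<Omega>). a < exit_time \<Omega> e x} = \<Omega> \<inter> ?U"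
  proof -
    have "a < exit_time \<Omega> e x \<longleftrightarrow> x \<in> ?U" if x: "x \<in> \<Omega>" for x
    proof
      assume "a < exit_time \<Omega> e x"
      then show "x \<in> ?U" using before_exit[OF x] by fastforce
    next
      assume "x \<in> ?U"
      then have "exit_time \<Omega> e x \<notin> {0..a} \<or> exit_point \<Omega> e x \<notin> - \<Omega>"
        by (force simp: exit_point_def)
      then show "a < exit_time \<Omega> e x"
        using exit_point_notin[OF x] exit_time_pos[OF x] by auto
    qed
    then show ?thesis by (auto simp: space_restrict_space)
  qed
  moreover have "open ?U"
  proof -
    have "closed (\<Union>y\<in>- \<Omega>. \<Union>w\<in>(\<lambda>s. s *\<^sub>R e) ` {0..a}. {y + w})"
      using op by (intro closed_compact_sums compact_continuous_image) (auto intro!: continuous_intros)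
    also have "(\<Union>y\<in>- \<Omega>. \<Union>w\<in>(\<lambda>s. s *\<^sub>R e) ` {0..a}. {y + w}) = - ?U" by auto
    finally show ?thesis by (simp add: open_closed)
  qed
  ultimately show "{x \<in> space (restrict_space lborel \<Omega>). a < exit_time \<Omega> e x} \<in> sets (restrict_space lborel \<Omega>)"
    using op by (auto simp: sets_restrict_space_iff intro!: borel_open open_Int)
qed

lemma exit_point_measurable:
  "exit_point \<Omega> e \<in> measurable (restrict_space lborel \<Omega>) (surface_measure \<Omega>)"
proof -
  have [measurable]: "(\<lambda>x. x) \<in> borel_measurable (restrict_space lborel \<Omega>)"
    by (intro measurable_restrict_space1) simp
  note exit_time_measurable[measurable]
  have "exit_point \<Omega> e \<in> borel_measurable (restrict_space lborel \<Omega>)"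
    unfolding exit_point_def[abs_def] by measurable
  then show ?thesis
    unfolding measurable_cong_sets[OF refl sets_surface_measure]
    by (intro measurable_restrict_space2) (auto simp: space_restrict_space exit_point_frontier)
qed

text \<open>Quotient of the cylinder volume 2 R (2 d)^m by the Hausdorff weight
  \<open>unit_ball_vol m * (d / 2) ^ m\<close> of a set of diameter d, where m = DIM - 1.\<close>

definition exit_const :: real where
  "exit_const = 2 * R * 4 ^ (DIM('a) - 1) / unit_ball_vol (real (DIM('a) - 1))"

lemma exit_const_pos: "0 < exit_const"
  using R by (simp add: exit_const_def)

text \<open>A piece of the boundary of diameter \<open>d\<close> is hit only from a cylinder of cross-section
  \<open>(2 d)\<^sup>n\<^sup>-\<^sup>1\<close> and height \<open>2 R\<close>.\<close>

lemma emeasure_exit_point_vimage_le_cover: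
  assumes n: "2 \<le> DIM('a)" and B: "B \<in> sets (surface_measure \<Omega>)"
    and C: "B \<subseteq> (\<Union>i. C i)" "\<And>i. bounded (C i)"
  shows "emeasure lborel (exit_point \<Omega> e -` B \<inter> \<Omega>) \<le>
     ennreal exit_const * (\<Sum>i. ennreal (unit_ball_vol (real (DIM('a) - 1)) * (diameter (C i) / 2) ^ (DIM('a) - 1)))"
proof -
  define m where "m = DIM('a) - 1"
  have m: "0 < m" "DIM('a) = Suc m" using n by (auto simp: m_def)
  let ?w = "\<lambda>C :: 'a set. ennreal (unit_ball_vol (real m) * (diameter C / 2) ^ m)"
  \<comment> \<open>For an empty \<open>C i\<close> the chosen point is arbitrary, which is why
    \<open>D i\<close> is set to {} in that case.\<close>
  define P where "P i = (SOME p. p \<in> C i)" for i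
  define l where "l i = (\<Sum>b\<in>Basis. (if b = e then - R else P i \<bullet> b - diameter (C i)) *\<^sub>R b)" for i
  define u where "u i = (\<Sum>b\<in>Basis. (if b = e then R else P i \<bullet> b + diameter (C i)) *\<^sub>R b)" for i
  define D where "D i = (if C i = {} then {} else cbox (l i) (u i))" for i
  have sub: "exit_point \<Omega> e -` B \<inter> \<Omega> \<subseteq> (\<Union>i. D i)"
  proof
    fix x assume "x \<in> exit_point \<Omega> e -` B \<inter> \<Omega>"
    then obtain i where x: "x \<in> \<Omega>" and i: "exit_point \<Omega> e x \<in> C i" using C by auto
    then have P: "P i \<in> C i" unfolding P_def by (metis someI)
    have "x \<in> cbox (l i) (u i)"
      unfolding mem_box
    proof
      fix b :: 'a assume b: "b \<in> Basis"
      show "l i \<bullet> b \<le> x \<bullet> b \<and> x \<bullet> b \<le> u i \<bullet> b"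
      proof (cases "b = e")
        case True
        have "\<bar>x \<bullet> e\<bar> \<le> norm x" by (rule Basis_le_norm[OF e])
        also have "\<dots> \<le> R" using x R by auto
        finally show ?thesis using True e by (auto simp: l_def u_def)
      next
        case False
        have "\<bar>(exit_point \<Omega> e x - P i) \<bullet> b\<bar> \<le> norm (exit_point \<Omega> e x - P i)" by (rule Basis_le_norm[OF b])
        also have "\<dots> \<le> diameter (C i)"
          using diameter_bounded_bound[OF C(2) i P] by (simp add: dist_norm)
        also have "(exit_point \<Omega> e x - P i) \<bullet> b = x \<bullet> b - P i \<bullet> b"
          using False e b by (simp add: exit_point_def inner_diff_left inner_Basis)
        finally show ?thesis using False b by (auto simp: l_def u_def)
      qed
    qed
    then show "x \<in> (\<Union>i. D i)" using P by (auto simp: D_def)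
  qed
  have Dm: "D i \<in> sets lborel" for i by (simp add: D_def)
  have vol: "emeasure lborel (D i) \<le> ennreal exit_const * ?w (C i)" for i
  proof (cases "C i = {}")
    case False
    have d: "0 \<le> diameter (C i)" using C(2) by (rule diameter_ge_0)
    have "emeasure lborel (D i) = ennreal (\<Prod>b\<in>Basis. (u i - l i) \<bullet> b)"
      using False R d by (auto simp: D_def emeasure_lborel_cbox_eq l_def u_def)
    also have "(\<Prod>b\<in>Basis. (u i - l i) \<bullet> b) = (\<Prod>b\<in>Basis. if b = e then 2 * R else 2 * diameter (C i))"
      by (intro prod.cong) (auto simp: u_def l_def inner_diff_left)
    also have "\<dots> = 2 * R * (\<Prod>b\<in>Basis - {e}. 2 * diameter (C i))"
      using e by (subst prod.remove[OF _ e]) (auto intro!: prod.cong)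
    also have "\<dots> = 2 * R * (2 * diameter (C i)) ^ m"
      using e by (simp add: m_def)
    also have "\<dots> = exit_const * (unit_ball_vol (real m) * (diameter (C i) / 2) ^ m)"
    proof -
      have "(2 * diameter (C i)) ^ m = 4 ^ m * (diameter (C i) / 2) ^ m"
        unfolding power_mult_distrib[symmetric] by (rule arg_cong[where f = "\<lambda>s. s ^ m"]) simp
      moreover have "unit_ball_vol (real m) \<noteq> 0"
        using unit_ball_vol_pos[of "real m"] by linarith
      moreover have "exit_const = 2 * R * 4 ^ m / unit_ball_vol (real m)"
        by (simp only: exit_const_def m_def)
      ultimately show ?thesis by simp
    qed
    finally show ?thesis
      using exit_const_pos by (simp add: ennreal_mult')
  qed (simp add: D_def)
  have "emeasure lborel (exit_point \<Omega> e -` B \<inter> \<Omega>) \<le> emeasure lborel (\<Union>i. D i)"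
    using sub Dm by (intro emeasure_mono) auto
  also have "\<dots> \<le> (\<Sum>i. emeasure lborel (D i))"
    using Dm by (intro emeasure_subadditive_countably) auto
  also have "\<dots> \<le> (\<Sum>i. ennreal exit_const * ?w (C i))"
    by (intro suminf_le vol) auto
  also have "\<dots> = ennreal exit_const * (\<Sum>i. ?w (C i))"
    by simp
  finally show ?thesis by (simp add: m_def)
qed

lemma emeasure_exit_point_vimage_le:
  assumes n: "2 \<le> DIM('a)" and B: "B \<in> sets (surface_measure \<Omega>)"
  shows "emeasure lborel (exit_point \<Omega> e -` B \<inter> \<Omega>) \<le> ennreal exit_const * emeasure (surface_measure \<Omega>) B"
proof -
  let ?m = "DIM('a) - 1" and ?E = "emeasure lborel (exit_point \<Omega> e -` B \<inter> \<Omega>)"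
  have B': "B \<in> sets borel" "B \<subseteq> frontier \<Omega>"
    using B unfolding sets_surface_measure by (auto simp: sets_restrict_space_iff)
  have inv: "ennreal (1 / exit_const) * (ennreal exit_const * z) = z" for z
    using exit_const_pos by (simp add: ennreal_mult'[symmetric] mult.assoc[symmetric])
  have inv': "ennreal exit_const * (ennreal (1 / exit_const) * z) = z" for z
    using exit_const_pos by (simp add: ennreal_mult'[symmetric] mult.assoc[symmetric])
  \<comment> \<open>The constant is moved to the left so that the infimum over covers stands alone
    on the right. Scale 1 serves as well as any other, since \<open>hausdorff_pre\<close> at a
    positive scale is below the outer measure.\<close>
  have "ennreal (1 / exit_const) * ?E \<le> hausdorff_pre ?m 1 B"
    unfolding hausdorff_pre_def
  proof (rule INF_greatest, clarify)
    fix C :: "nat \<Rightarrow> 'a set"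
    assume C: "B \<subseteq> (\<Union>i. C i)" "\<forall>i. bounded (C i) \<and> diameter (C i) \<le> 1"
    have "ennreal (1 / exit_const) * ?E \<le> ennreal (1 / exit_const) * (ennreal exit_const *
      (\<Sum>i. ennreal (unit_ball_vol (real ?m) * (diameter (C i) / 2) ^ ?m)))"
      using C by (intro mult_left_mono emeasure_exit_point_vimage_le_cover[OF n B]) auto
    then show "ennreal (1 / exit_const) * ?E \<le> (\<Sum>i. ennreal (unit_ball_vol (real ?m) * (diameter (C i) / 2) ^ ?m))"
      by (simp only: inv)
  qed
  also have "\<dots> \<le> hausdorff_outer ?m B"
    by (rule hausdorff_pre_le_outer) simp
  finally have "ennreal exit_const * (ennreal (1 / exit_const) * ?E) \<le> ennreal exit_const * hausdorff_outer ?m B"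
    by (intro mult_left_mono) auto
  then show ?thesis
    unfolding inv' using emeasure_surface_measure[OF n B'] by simp
qed

lemma nn_integral_exit_point_le:
  assumes n: "2 \<le> DIM('a)" and f: "f \<in> borel_measurable (surface_measure \<Omega>)"
  shows "(\<integral>\<^sup>+x. f (exit_point \<Omega> e x) \<partial>restrict_space lborel \<Omega>) \<le>
    ennreal exit_const * (\<integral>\<^sup>+x. f x \<partial>surface_measure \<Omega>)"
proof -
  let ?N = "distr (restrict_space lborel \<Omega>) (surface_measure \<Omega>) (exit_point \<Omega> e)"
  have "(\<integral>\<^sup>+x. f (exit_point \<Omega> e x) \<partial>restrict_space lborel \<Omega>) = (\<integral>\<^sup>+x. f x \<partial>?N)"
    using f by (subst nn_integral_distr[OF exit_point_measurable]) auto
  also have "\<dots> \<le> (\<integral>\<^sup>+x. f x \<partial>scale_measure (ennreal exit_const) (surface_measure \<Omega>))"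
  proof (rule nn_integral_mono_measure)
    show "?N \<le> scale_measure (ennreal exit_const) (surface_measure \<Omega>)"
    proof (subst le_measure)
      show "\<forall>A\<in>sets ?N. emeasure ?N A \<le> emeasure (scale_measure (ennreal exit_const) (surface_measure \<Omega>)) A"
        using op emeasure_exit_point_vimage_le[OF n]
        by (auto simp: emeasure_distr[OF exit_point_measurable] space_restrict_space emeasure_restrict_space)
    qed simp
  qed simp
  also have "\<dots> = ennreal exit_const * (\<integral>\<^sup>+x. f x \<partial>surface_measure \<Omega>)"
    using f by (rule nn_integral_scale_measure)
  finally show ?thesis .
qed

section \<open>The Friedrichs inequality for smooth functions\<close>

text \<open>Cauchy-Schwarz against the constant 1, from integrating (h - c)^2 \<ge> 0 with c the
  mean of h.\<close>

lemma square_integral_le: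
  fixes h :: "real \<Rightarrow> real"
  assumes h: "continuous_on {0..t} h" and t: "0 < t"
  shows "(integral {0..t} h)\<^sup>2 \<le> t * integral {0..t} (\<lambda>s. (h s)\<^sup>2)"
proof -
  define c where "c = integral {0..t} h / t"
  have int: "h integrable_on {0..t}" "(\<lambda>s. (h s)\<^sup>2) integrable_on {0..t}"
    using h by (auto intro!: integrable_continuous_interval continuous_intros)
  have "((\<lambda>s. (h s)\<^sup>2 - (2 * c * h s - c\<^sup>2)) has_integral
      integral {0..t} (\<lambda>s. (h s)\<^sup>2) - (2 * c * integral {0..t} h - (t - 0) *\<^sub>R c\<^sup>2)) {0..t}"
    using t by (intro has_integral_diff has_integral_mult_right integrable_integral int has_integral_const_real[THEN has_integral_eq_rhs]) auto
  then have "0 \<le> integral {0..t} (\<lambda>s. (h s)\<^sup>2) - (2 * c * integral {0..t} h - (t - 0) *\<^sub>R c\<^sup>2)"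
  proof (rule has_integral_nonneg)
    fix s
    have "(h s)\<^sup>2 - (2 * c * h s - c\<^sup>2) = (h s - c)\<^sup>2" by (simp add: power2_diff algebra_simps)
    then show "0 \<le> (h s)\<^sup>2 - (2 * c * h s - c\<^sup>2)" by simp
  qed
  moreover have "2 * c * integral {0..t} h - (t - 0) *\<^sub>R c\<^sup>2 = (integral {0..t} h)\<^sup>2 / t"
    using t by (simp add: c_def field_simps power2_eq_square)
  ultimately have "(integral {0..t} h)\<^sup>2 / t \<le> integral {0..t} (\<lambda>s. (h s)\<^sup>2)" by linarith
  then show ?thesis using t by (simp add: pos_divide_le_eq mult.commute)
qed

text \<open>v x differs from its value at the exit point by the integral of a directional derivative
  along the segment. The time integral is then enlarged to a fixed interval with a spatial
  indicator, which removes the exit time from the gradient term and prepares it for Tonelli.\<close>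

lemma square_le_exit:
  assumes v: "smooth v" and x: "x \<in> \<Omega>"
  shows "ennreal ((v x)\<^sup>2) \<le> 2 * ennreal ((v (exit_point \<Omega> e x))\<^sup>2) +
    ennreal (2 * (2 * R + 1)) *
    (\<integral>\<^sup>+s. indicator {0..2 * R + 1} s * (indicator \<Omega> (x - s *\<^sub>R e) * ennreal ((norm (grad v (x - s *\<^sub>R e)))\<^sup>2)) \<partial>lborel)"
proof -
  define t where "t = exit_time \<Omega> e x"
  have t: "0 < t" "t \<le> 2 * R + 1" using exit_time_pos[OF x] exit_time_le[OF x] by (auto simp: t_def)
  define h where "h s = grad v (x - s *\<^sub>R e) \<bullet> e" for s
  have hc: "continuous_on S h" for S
    unfolding h_def
    by (intro continuous_intros continuous_on_compose2[OF smooth_continuous_grad[OF v, of UNIV]]) auto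
  have "((\<lambda>s. - h s) has_integral (v (x - t *\<^sub>R e) - v (x - 0 *\<^sub>R e))) {0..t}"
  proof (rule fundamental_theorem_of_calculus)
    fix s assume "s \<in> {0..t}"
    have "((\<lambda>s. v (x - s *\<^sub>R e)) has_derivative (\<lambda>r. grad v (x - s *\<^sub>R e) \<bullet> (- r *\<^sub>R e))) (at s within {0..t})"
      unfolding smooth_derivative_grad[OF v, symmetric]
      by (rule has_derivative_compose[OF _ smooth_has_derivative[OF v]]) (auto intro!: derivative_eq_intros)
    then show "((\<lambda>s. v (x - s *\<^sub>R e)) has_vector_derivative - h s) (at s within {0..t})"
      by (simp add: has_vector_derivative_def h_def mult.commute)
  qed (use t in simp)
  from integral_unique[OF has_integral_neg[OF this]]
  have ftc: "integral {0..t} h = v x - v (exit_point \<Omega> e x)" by (simp add: exit_point_def t_def)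
  have "(v x)\<^sup>2 \<le> 2 * (v (exit_point \<Omega> e x))\<^sup>2 + 2 * (integral {0..t} h)\<^sup>2"
    using sum_squares_bound[of "v (exit_point \<Omega> e x)" "v x - v (exit_point \<Omega> e x)"]
    unfolding ftc by (simp add: power2_eq_square algebra_simps)
  also have "(integral {0..t} h)\<^sup>2 \<le> t * integral {0..t} (\<lambda>s. (h s)\<^sup>2)"
    by (rule square_integral_le[OF hc t(1)])
  also have "t * integral {0..t} (\<lambda>s. (h s)\<^sup>2) \<le> (2 * R + 1) * integral {0..t} (\<lambda>s. (h s)\<^sup>2)"
    using t hc by (intro mult_right_mono integral_nonneg integrable_continuous_interval) (auto intro!: continuous_intros)
  finally have "ennreal ((v x)\<^sup>2) \<le> ennreal (2 * (v (exit_point \<Omega> e x))\<^sup>2 + 2 * (2 * R + 1) * integral {0..t} (\<lambda>s. (h s)\<^sup>2))"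
    by (intro ennreal_leI) (simp add: algebra_simps)
  also have "\<dots> = 2 * ennreal ((v (exit_point \<Omega> e x))\<^sup>2) + ennreal (2 * (2 * R + 1)) * ennreal (integral {0..t} (\<lambda>s. (h s)\<^sup>2))"
    using R hc by (subst ennreal_plus) 
      (auto intro!: mult_nonneg_nonneg integral_nonneg integrable_continuous_interval continuous_intros simp: ennreal_mult ennreal_mult')
  also have "ennreal (integral {0..t} (\<lambda>s. (h s)\<^sup>2)) = (\<integral>\<^sup>+s. ennreal ((h s)\<^sup>2) * indicator {0..t} s \<partial>lborel)"
    using hc by (intro nn_integral_has_integral_lebesgue'[symmetric] integrable_integral
       integrable_continuous_interval) (auto intro!: continuous_intros)
  also have "\<dots> \<le> (\<integral>\<^sup>+s. indicator {0..2 * R + 1} s * (indicator \<Omega> (x - s *\<^sub>R e) * ennreal ((norm (grad v (x - s *\<^sub>R e)))\<^sup>2)) \<partial>lborel)"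
  proof (intro nn_integral_mono_AE)
    \<comment> \<open>At s = t the ray is at the exit point, outside \<Omega>, where the right side
      vanishes; a single time is negligible.\<close>
    have pt: "ennreal ((h s)\<^sup>2) * indicator {0..t} s \<le>
      indicator {0..2 * R + 1} s * (indicator \<Omega> (x - s *\<^sub>R e) * ennreal ((norm (grad v (x - s *\<^sub>R e)))\<^sup>2))" if "s \<noteq> t" for s
    proof (cases "0 \<le> s \<and> s < t")
      case True
      have "\<bar>h s\<bar> \<le> norm (grad v (x - s *\<^sub>R e))" unfolding h_def by (rule Basis_le_norm[OF e])
      then have "(h s)\<^sup>2 \<le> (norm (grad v (x - s *\<^sub>R e)))\<^sup>2"
        using power_mono[of "\<bar>h s\<bar>" _ 2] by simp
      then show ?thesis
        using True t before_exit[OF x, of s] by (simp add: t_def ennreal_leI)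
    qed (use that in \<open>auto simp: indicator_def\<close>)
    show "AE s in lborel. ennreal ((h s)\<^sup>2) * indicator {0..t} s \<le>
      indicator {0..2 * R + 1} s * (indicator \<Omega> (x - s *\<^sub>R e) * ennreal ((norm (grad v (x - s *\<^sub>R e)))\<^sup>2))"
      using AE_lborel_singleton[of t] by eventually_elim (rule pt)
  qed
  finally show ?thesis by (simp add: mult_left_mono add_left_mono)
qed

lemma nn_integral_translate_lborel:
  fixes f :: "'a \<Rightarrow> ennreal"
  assumes "f \<in> borel_measurable borel"
  shows "(\<integral>\<^sup>+x. f (x - c) \<partial>lborel) = (\<integral>\<^sup>+x. f x \<partial>lborel)"
proof -
  have "(\<integral>\<^sup>+x. f x \<partial>lborel) = (\<integral>\<^sup>+x. f x \<partial>distr lborel borel ((+) (- c)))"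
    by (simp only: lborel_distr_plus)
  also have "\<dots> = (\<integral>\<^sup>+x. f (x - c) \<partial>lborel)"
    using assms by (subst nn_integral_distr) auto
  finally show ?thesis by simp
qed

lemma nn_integral_lebesgue_on_borel:
  assumes f: "f \<in> borel_measurable borel"
  shows "(\<integral>\<^sup>+x. f x \<partial>lebesgue_on \<Omega>) = (\<integral>\<^sup>+x. f x \<partial>restrict_space lborel \<Omega>)"
proof -
  have "\<Omega> \<in> sets lebesgue" "\<Omega> \<in> sets lborel" using op by auto
  then show ?thesis
    using f by (simp add: nn_integral_restrict_space nn_integral_completion)
qed

text \<open>Once the pointwise bound is integrated, Tonelli and translation invariance give every
  time s the same Dirichlet integral, hence a second factor 2 R + 1; the exit term is controlled by
  the law of the exit point.\<close>

lemma friedrichs_smooth: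
  assumes n: "2 \<le> DIM('a)" and v: "smooth v"
  shows "(\<integral>\<^sup>+x. ennreal ((v x)\<^sup>2) \<partial>lebesgue_on \<Omega>) \<le>
     ennreal (2 * exit_const) * (\<integral>\<^sup>+x. ennreal ((v x)\<^sup>2) \<partial>surface_measure \<Omega>) +
     ennreal (2 * (2 * R + 1)\<^sup>2) * (\<integral>\<^sup>+x. ennreal ((norm (grad v x))\<^sup>2) \<partial>lebesgue_on \<Omega>)"
proof -
  let ?L = "restrict_space lborel \<Omega>"
  have \<Omega>[measurable]: "\<Omega> \<in> sets borel" using op by auto
  have [measurable]: "v \<in> borel_measurable borel"
    using smooth_continuous[OF v] by (rule borel_measurable_continuous_onI)
  have gm[measurable]: "grad v \<in> borel_measurable borel"
    using smooth_continuous_grad[OF v] by (rule borel_measurable_continuous_onI)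
  define G where "G y = indicator \<Omega> y * ennreal ((norm (grad v y))\<^sup>2)" for y
  have G[measurable]: "G \<in> borel_measurable borel" unfolding G_def[abs_def] by measurable
  define H where "H x = (\<integral>\<^sup>+s. indicator {0..2 * R + 1} s * G (x - s *\<^sub>R e) \<partial>lborel)" for x
  have H[measurable]: "H \<in> borel_measurable borel" unfolding H_def[abs_def] by measurable
  have "(\<integral>\<^sup>+x. H x \<partial>?L) \<le> (\<integral>\<^sup>+x. H x \<partial>lborel)"
    using \<Omega> by (subst nn_integral_restrict_space) (auto intro!: nn_integral_mono simp: indicator_def)
  also have "\<dots> = (\<integral>\<^sup>+s. (\<integral>\<^sup>+x. indicator {0..2 * R + 1} s * G (x - s *\<^sub>R e) \<partial>lborel) \<partial>lborel)"
    unfolding H_def by (rule lborel_pair.Fubini'[symmetric]) measurable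
  also have "\<dots> = (\<integral>\<^sup>+s. indicator {0..2 * R + 1} s * (\<integral>\<^sup>+x. G x \<partial>lborel) \<partial>lborel)"
    by (intro nn_integral_cong) (simp add: nn_integral_cmult nn_integral_translate_lborel)
  also have "\<dots> = ennreal (2 * R + 1) * (\<integral>\<^sup>+x. G x \<partial>lborel)"
    using R by (simp add: nn_integral_multc)
  also have "(\<integral>\<^sup>+x. G x \<partial>lborel) = (\<integral>\<^sup>+x. ennreal ((norm (grad v x))\<^sup>2) \<partial>?L)"
    using \<Omega> by (subst nn_integral_restrict_space) (auto simp: G_def[abs_def] mult.commute)
  finally have HL: "(\<integral>\<^sup>+x. H x \<partial>?L) \<le> ennreal (2 * R + 1) * (\<integral>\<^sup>+x. ennreal ((norm (grad v x))\<^sup>2) \<partial>?L)" .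
  have Hm: "H \<in> borel_measurable ?L" by (intro measurable_restrict_space1) simp
  have Sm: "(\<lambda>x. ennreal ((v x)\<^sup>2)) \<in> borel_measurable (surface_measure \<Omega>)"
    by (intro measurable_compose[OF _ measurable_ennreal] borel_measurable_surface) 
       (intro continuous_intros smooth_continuous[OF v])
  have vm: "(\<lambda>x. ennreal ((v (exit_point \<Omega> e x))\<^sup>2)) \<in> borel_measurable ?L"
    by (rule measurable_compose[OF exit_point_measurable Sm])
  have "(\<integral>\<^sup>+x. ennreal ((v x)\<^sup>2) \<partial>?L) \<le>
     (\<integral>\<^sup>+x. 2 * ennreal ((v (exit_point \<Omega> e x))\<^sup>2) + ennreal (2 * (2 * R + 1)) * H x \<partial>?L)"
    using square_le_exit[OF v] by (intro nn_integral_mono) (auto simp: space_restrict_space H_def G_def)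
  also have "\<dots> = 2 * (\<integral>\<^sup>+x. ennreal ((v (exit_point \<Omega> e x))\<^sup>2) \<partial>?L) + ennreal (2 * (2 * R + 1)) * (\<integral>\<^sup>+x. H x \<partial>?L)"
    using vm Hm by (simp add: nn_integral_add nn_integral_cmult)
  also have "\<dots> \<le> 2 * (ennreal exit_const * (\<integral>\<^sup>+x. ennreal ((v x)\<^sup>2) \<partial>surface_measure \<Omega>)) +
     ennreal (2 * (2 * R + 1)) * (ennreal (2 * R + 1) * (\<integral>\<^sup>+x. ennreal ((norm (grad v x))\<^sup>2) \<partial>?L))"
    by (intro add_mono mult_left_mono nn_integral_exit_point_le[OF n Sm] HL) auto
  also have "\<dots> = ennreal (2 * exit_const) * (\<integral>\<^sup>+x. ennreal ((v x)\<^sup>2) \<partial>surface_measure \<Omega>) +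
     ennreal (2 * (2 * R + 1)\<^sup>2) * (\<integral>\<^sup>+x. ennreal ((norm (grad v x))\<^sup>2) \<partial>?L)"
  proof -
    have "2 * ennreal exit_const = ennreal (2 * exit_const)"
      by (simp add: ennreal_mult')
    moreover have "ennreal (2 * (2 * R + 1)) * ennreal (2 * R + 1) = ennreal (2 * (2 * R + 1)\<^sup>2)"
      using R by (subst ennreal_mult'[symmetric]) (auto simp: power2_eq_square algebra_simps)
    ultimately show ?thesis by (simp only: mult.assoc[symmetric])
  qed
  finally show ?thesis
    by (simp add: nn_integral_lebesgue_on_borel)
qed

end

section \<open>Square integrable functions\<close>

lemma square_integrable_measurable: "square_integrable M f \<Longrightarrow> f \<in> borel_measurable M"
  by (simp add: square_integrable_def)

lemma norm_add_sq_le: "(norm (a + b))\<^sup>2 \<le> 2 * (norm a)\<^sup>2 + 2 * (norm b)\<^sup>2"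
  for a b :: "'b::real_normed_vector"
proof -
  have "(norm (a + b))\<^sup>2 \<le> (norm a + norm b)\<^sup>2"
    by (intro power_mono norm_triangle_ineq) simp
  also have "\<dots> \<le> 2 * (norm a)\<^sup>2 + 2 * (norm b)\<^sup>2"
    using sum_squares_bound[of "norm a" "norm b"] by (simp add: power2_sum)
  finally show ?thesis .
qed

lemma abs_inner_le_sq: "\<bar>a \<bullet> b\<bar> \<le> (norm a)\<^sup>2 + (norm b)\<^sup>2"
  for a b :: "'b::real_inner"
proof -
  have "\<bar>a \<bullet> b\<bar> \<le> norm a * norm b" by (rule Cauchy_Schwarz_ineq2)
  also have "\<dots> \<le> (norm a)\<^sup>2 + (norm b)\<^sup>2"
    using sum_squares_bound[of "norm a" "norm b"] mult_nonneg_nonneg[OF norm_ge_zero[of a] norm_ge_zero[of b]]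
    unfolding mult.assoc by linarith
  finally show ?thesis .
qed

lemma square_integrable_bound:
  assumes "f \<in> borel_measurable M" "square_integrable M g" "AE x in M. norm (f x) \<le> C * norm (g x)"
  shows "square_integrable M f"
  unfolding square_integrable_def
proof
  have "integrable M (\<lambda>x. C\<^sup>2 * (norm (g x))\<^sup>2)"
    using assms(2) by (simp add: square_integrable_def)
  then show "integrable M (\<lambda>x. (norm (f x))\<^sup>2)"
  proof (rule Bochner_Integration.integrable_bound)
    show "AE x in M. norm ((norm (f x))\<^sup>2) \<le> norm (C\<^sup>2 * (norm (g x))\<^sup>2)"
      using assms(3)
    proof eventually_elim
      case (elim x)
      then have "(norm (f x))\<^sup>2 \<le> (C * norm (g x))\<^sup>2" by (intro power_mono) auto
      then show ?case by (simp add: power_mult_distrib)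
    qed
  qed (use assms(1) in measurable)
qed fact

lemma square_integrable_0 [simp]: "square_integrable M (\<lambda>_. 0)"
  by (simp add: square_integrable_def)

lemma square_integrable_add:
  assumes f: "square_integrable M f" and g: "square_integrable M g"
  shows "square_integrable M (\<lambda>x. f x + g x)"
  unfolding square_integrable_def
proof
  note [measurable] = f[THEN square_integrable_measurable] g[THEN square_integrable_measurable]
  show "(\<lambda>x. f x + g x) \<in> borel_measurable M" by measurable
  have "integrable M (\<lambda>x. 2 * (norm (f x))\<^sup>2 + 2 * (norm (g x))\<^sup>2)"
    using f g by (simp add: square_integrable_def)
  then show "integrable M (\<lambda>x. (norm (f x + g x))\<^sup>2)"
    by (rule Bochner_Integration.integrable_bound) (auto simp: norm_add_sq_le)
qed

lemma square_integrable_scaleR: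
  "square_integrable M f \<Longrightarrow> square_integrable M (\<lambda>x. c *\<^sub>R f x)"
  by (auto simp: square_integrable_def power_mult_distrib)

lemma square_integrable_cmult:
  fixes f :: "'a \<Rightarrow> real"
  shows "square_integrable M f \<Longrightarrow> square_integrable M (\<lambda>x. c * f x)"
  using square_integrable_scaleR[of M f c] by simp

lemma square_integrable_diff:
  assumes "square_integrable M f" "square_integrable M g"
  shows "square_integrable M (\<lambda>x. f x - g x)"
  using square_integrable_add[OF assms(1) square_integrable_scaleR[OF assms(2), of "-1"]] by simp

lemma square_integrable_sum:
  "(\<And>i. i \<in> I \<Longrightarrow> square_integrable M (f i)) \<Longrightarrow> square_integrable M (\<lambda>x. \<Sum>i\<in>I. f i x)"
  by (induction I rule: infinite_finite_induct) (auto intro: square_integrable_add)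

lemma integrable_inner:
  assumes f: "square_integrable M f" and g: "square_integrable M g"
  shows "integrable M (\<lambda>x. f x \<bullet> g x)"
proof -
  note [measurable] = f[THEN square_integrable_measurable] g[THEN square_integrable_measurable]
  have "integrable M (\<lambda>x. (norm (f x))\<^sup>2 + (norm (g x))\<^sup>2)"
    using f g by (simp add: square_integrable_def)
  then show ?thesis
    by (rule Bochner_Integration.integrable_bound) (auto simp: abs_inner_le_sq intro!: order_trans[OF abs_inner_le_sq])
qed

lemma integrable_mult_square_integrable:
  fixes f g :: "'a \<Rightarrow> real"
  assumes "square_integrable M f" "square_integrable M g"
  shows "integrable M (\<lambda>x. f x * g x)"
  using integrable_inner[OF assms] by simp

text \<open>Extended-valued, so that a measurable function outside L2 gets the value infinity, where
  a Bochner integral would report 0.\<close>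

definition sqnorm :: "'a measure \<Rightarrow> ('a \<Rightarrow> 'b::euclidean_space) \<Rightarrow> ennreal" where
  "sqnorm M f = (\<integral>\<^sup>+x. ennreal ((norm (f x))\<^sup>2) \<partial>M)"

lemma sqnorm_eq_integral:
  "square_integrable M f \<Longrightarrow> sqnorm M f = ennreal (LINT x|M. (norm (f x))\<^sup>2)"
  unfolding sqnorm_def square_integrable_def by (intro nn_integral_eq_integral) auto

lemma square_integrable_iff_sqnorm:
  "f \<in> borel_measurable M \<Longrightarrow> square_integrable M f \<longleftrightarrow> sqnorm M f < \<infinity>"
  unfolding sqnorm_def square_integrable_def by (simp add: integrable_iff_bounded)

lemma sqnorm_cong_AE:
  assumes "AE x in M. f x = g x" shows "sqnorm M f = sqnorm M g"
  unfolding sqnorm_def by (rule nn_integral_cong_AE) (use assms in auto)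

lemma sqnorm_scaleR:
  "f \<in> borel_measurable M \<Longrightarrow> sqnorm M (\<lambda>x. c *\<^sub>R f x) = ennreal (c\<^sup>2) * sqnorm M f"
  unfolding sqnorm_def by (simp add: power_mult_distrib ennreal_mult' nn_integral_cmult)

lemma sqnorm_add_le:
  assumes [measurable]: "f \<in> borel_measurable M" "g \<in> borel_measurable M"
  shows "sqnorm M (\<lambda>x. f x + g x) \<le> 2 * sqnorm M f + 2 * sqnorm M g"
proof -
  have "ennreal ((norm (f x + g x))\<^sup>2) \<le> 2 * ennreal ((norm (f x))\<^sup>2) + 2 * ennreal ((norm (g x))\<^sup>2)" for x
    using ennreal_leI[OF norm_add_sq_le[of "f x" "g x"]] by (simp add: ennreal_plus ennreal_mult')
  then have "sqnorm M (\<lambda>x. f x + g x) \<le> (\<integral>\<^sup>+x. 2 * ennreal ((norm (f x))\<^sup>2) + 2 * ennreal ((norm (g x))\<^sup>2) \<partial>M)"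
    unfolding sqnorm_def by (intro nn_integral_mono)
  also have "\<dots> = 2 * sqnorm M f + 2 * sqnorm M g"
    unfolding sqnorm_def by (simp add: nn_integral_add nn_integral_cmult)
  finally show ?thesis .
qed

lemma sqnorm_minus_commute: "sqnorm M (\<lambda>x. f x - g x) = sqnorm M (\<lambda>x. g x - f x)"
  by (simp add: sqnorm_def norm_minus_commute)

lemma sqnorm_diff_triangle:
  assumes "f \<in> borel_measurable M" "g \<in> borel_measurable M" "h \<in> borel_measurable M"
  shows "sqnorm M (\<lambda>x. f x - h x) \<le> 2 * sqnorm M (\<lambda>x. f x - g x) + 2 * sqnorm M (\<lambda>x. g x - h x)"
  using sqnorm_add_le[of "\<lambda>x. f x - g x" M "\<lambda>x. g x - h x"] assms by simp

lemma tendsto_0_ennreal_le: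
  fixes f g :: "nat \<Rightarrow> ennreal"
  assumes "\<And>k. f k \<le> g k" "g \<longlonglongrightarrow> 0" shows "f \<longlonglongrightarrow> 0"
  by (rule tendsto_sandwich[OF _ _ tendsto_const assms(2)]) (use assms in auto)

lemma tendsto_0_ennreal_cmult:
  fixes f :: "nat \<Rightarrow> ennreal"
  assumes "f \<longlonglongrightarrow> 0" "c < \<infinity>" shows "(\<lambda>k. c * f k) \<longlonglongrightarrow> 0"
  using ennreal_tendsto_cmult[of c f 0 sequentially] assms by simp

text \<open>A sequence whose squared \<open>L\<^sup>2\<close> distances decay geometrically also converges almost
  everywhere: \<open>2 |d| \<le> 2\<^sup>-\<^sup>k + 2\<^sup>k |d|\<^sup>2\<close> makes the increments absolutely summable.\<close>

lemma L2_fast_Cauchy_limit: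
  fixes f :: "nat \<Rightarrow> 'a \<Rightarrow> 'b::euclidean_space"
  assumes f: "\<And>k. square_integrable M (f k)"
    and cau: "\<And>k j. k \<le> j \<Longrightarrow> sqnorm M (\<lambda>x. f j x - f k x) \<le> ennreal (K * (1/8) ^ k)"
  obtains g where "square_integrable M g" "(\<lambda>k. sqnorm M (\<lambda>x. f k x - g x)) \<longlonglongrightarrow> 0"
proof -
  note [measurable] = f[THEN square_integrable_measurable]
  \<comment> \<open>K is not assumed nonnegative; \<open>ennreal\<close> sends negative numbers to
    0, and K' does the same before the coercion.\<close>
  define K' where "K' = max K 0"
  have cau': "sqnorm M (\<lambda>x. f j x - f k x) \<le> ennreal (K' * (1/8) ^ k)" if "k \<le> j" for k j
    using cau[OF that] by (rule order_trans) (auto intro!: ennreal_leI mult_right_mono simp: K'_def)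
  let ?d = "\<lambda>k x. f (Suc k) x - f k x"
  have "(\<integral>\<^sup>+x. (\<Sum>k. ennreal (2 ^ k * (norm (?d k x))\<^sup>2)) \<partial>M) = (\<Sum>k. ennreal (2 ^ k) * sqnorm M (?d k))"
    by (subst nn_integral_suminf) (auto simp: sqnorm_def ennreal_mult' nn_integral_cmult)
  \<comment> \<open>The rate 1/8 leaves room for the weight 2^k: the products 2^k/8^k = 1/4^k are
    still summable.\<close>
  also have "\<dots> \<le> (\<Sum>k. ennreal (K' * (1/4) ^ k))"
  proof (intro suminf_le allI)
    fix k
    have "ennreal (2 ^ k) * sqnorm M (?d k) \<le> ennreal (2 ^ k) * ennreal (K' * (1/8) ^ k)"
      by (intro mult_left_mono cau') auto
    also have "\<dots> = ennreal (K' * (2 ^ k * (1/8) ^ k))"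
      by (simp add: ennreal_mult'[symmetric] mult.left_commute)
    also have "2 ^ k * (1/8) ^ k = (1/4 :: real) ^ k"
      unfolding power_mult_distrib[symmetric] by simp
    finally show "ennreal (2 ^ k) * sqnorm M (?d k) \<le> ennreal (K' * (1/4) ^ k)" .
  qed auto
  also have "\<dots> = ennreal (\<Sum>k. K' * (1/4) ^ k)"
    by (intro suminf_ennreal2 summable_mult summable_geometric) (auto simp: K'_def)
  also have "\<dots> < \<infinity>" by simp
  finally have "(\<integral>\<^sup>+x. (\<Sum>k. ennreal (2 ^ k * (norm (?d k x))\<^sup>2)) \<partial>M) \<noteq> \<infinity>" by simp
  then have "AE x in M. (\<Sum>k. ennreal (2 ^ k * (norm (?d k x))\<^sup>2)) \<noteq> \<infinity>"
    by (intro nn_integral_PInf_AE) auto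
  then have conv: "AE x in M. convergent (\<lambda>k. f k x)"
  proof eventually_elim
    case (elim x)
    then have "summable (\<lambda>k. 2 ^ k * (norm (?d k x))\<^sup>2)"
      by (intro summable_suminf_not_top) auto
    then have s: "summable (\<lambda>k. (1/2) ^ k + 2 ^ k * (norm (?d k x))\<^sup>2)"
      by (intro summable_add summable_geometric) auto
    have "summable (\<lambda>k. ?d k x)"
    proof (rule summable_comparison_test'[OF s])
      fix k
      have "0 \<le> (1 - 2 ^ k * norm (?d k x))\<^sup>2" by simp
      then have "2 * (2 ^ k * norm (?d k x)) \<le> 1 + (2 ^ k * norm (?d k x))\<^sup>2"
        by (simp add: power2_diff)
      then have "(1/2) ^ k * (2 * (2 ^ k * norm (?d k x))) \<le> (1/2) ^ k * (1 + (2 ^ k * norm (?d k x))\<^sup>2)"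
        by (intro mult_left_mono) auto
      also have "\<dots> = (1/2) ^ k + 2 ^ k * (norm (?d k x))\<^sup>2"
        by (simp add: field_simps power2_eq_square)
      also have "(1/2) ^ k * (2 * (2 ^ k * norm (?d k x))) = 2 * norm (?d k x)"
        by (simp add: field_simps)
      finally show "norm (?d k x) \<le> (1/2) ^ k + 2 ^ k * (norm (?d k x))\<^sup>2"
        using norm_ge_zero[of "?d k x"] by linarith
    qed
    then have "convergent (\<lambda>n. \<Sum>k<n. ?d k x)"
      by (simp add: summable_iff_convergent)
    then have "convergent (\<lambda>n. f n x - f 0 x)"
      by (simp only: sum_lessThan_telescope[of "\<lambda>n. f n x"])
    from convergent_add[OF this convergent_const[of "f 0 x"]] show ?case by simp
  qed
  define g where "g x = lim (\<lambda>k. f k x)" for x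
  have g[measurable]: "g \<in> borel_measurable M"
    unfolding g_def by measurable
  have lim: "AE x in M. (\<lambda>k. f k x) \<longlonglongrightarrow> g x"
    using conv by eventually_elim (simp add: g_def convergent_LIMSEQ_iff)
  \<comment> \<open>Fatou's lemma in j: the a.e. limit inherits the Cauchy bound, and this bound is
    also the L2 convergence.\<close>
  have bound: "sqnorm M (\<lambda>x. f k x - g x) \<le> ennreal (K' * (1/8) ^ k)" for k
  proof -
    have "sqnorm M (\<lambda>x. f k x - g x) = (\<integral>\<^sup>+x. liminf (\<lambda>j. ennreal ((norm (f k x - f j x))\<^sup>2)) \<partial>M)"
      unfolding sqnorm_def
    proof (intro nn_integral_cong_AE)
      show "AE x in M. ennreal ((norm (f k x - g x))\<^sup>2) = liminf (\<lambda>j. ennreal ((norm (f k x - f j x))\<^sup>2))"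
        using lim
      proof eventually_elim
        case (elim x)
        then have "(\<lambda>j. ennreal ((norm (f k x - f j x))\<^sup>2)) \<longlonglongrightarrow> ennreal ((norm (f k x - g x))\<^sup>2)"
          by (intro tendsto_intros tendsto_ennrealI)
        then show ?case by (intro lim_imp_Liminf[symmetric]) auto
      qed
    qed
    also have "\<dots> \<le> liminf (\<lambda>j. sqnorm M (\<lambda>x. f k x - f j x))"
      unfolding sqnorm_def by (intro nn_integral_liminf) measurable
    also have "\<dots> \<le> ennreal (K' * (1/8) ^ k)"
    proof (rule Liminf_le)
      show "\<forall>\<^sub>F j in sequentially. sqnorm M (\<lambda>x. f k x - f j x) \<le> ennreal (K' * (1/8) ^ k)"
        using eventually_ge_at_top[of k]
        by eventually_elim (subst sqnorm_minus_commute, rule cau')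
    qed simp
    finally show ?thesis .
  qed
  have "square_integrable M (\<lambda>x. f 0 x - g x)"
    using bound[of 0] by (subst square_integrable_iff_sqnorm) (auto simp: le_less_trans[OF _ ennreal_less_top])
  from square_integrable_diff[OF f[of 0] this] have "square_integrable M g" by simp
  moreover have "(\<lambda>k. sqnorm M (\<lambda>x. f k x - g x)) \<longlonglongrightarrow> 0"
  proof (rule tendsto_0_ennreal_le[OF bound])
    have "(\<lambda>k. K' * (1/8) ^ k) \<longlonglongrightarrow> K' * 0"
      by (intro tendsto_intros LIMSEQ_power_zero) auto
    then show "(\<lambda>k. ennreal (K' * (1/8) ^ k)) \<longlonglongrightarrow> 0"
      using tendsto_ennrealI by fastforce
  qed
  ultimately show ?thesis by (rule that)
qed

text \<open>Young's inequality with a free weight, applied to f times sqrt r and g divided by sqrt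
  r; a suitable r later plays the part of the Cauchy-Schwarz inequality.\<close>

lemma abs_integral_inner_le:
  assumes f: "square_integrable M f" and g: "square_integrable M g" and r: "0 < r"
  shows "\<bar>LINT x|M. f x \<bullet> g x\<bar> \<le> r * (LINT x|M. (norm (f x))\<^sup>2) + (1 / r) * (LINT x|M. (norm (g x))\<^sup>2)"
proof -
  have "\<bar>LINT x|M. f x \<bullet> g x\<bar> \<le> (LINT x|M. \<bar>f x \<bullet> g x\<bar>)"
    by (rule integral_abs_bound)
  also have "\<dots> \<le> (LINT x|M. r * (norm (f x))\<^sup>2 + (1 / r) * (norm (g x))\<^sup>2)"
  proof (rule integral_mono)
    fix x
    have "\<bar>(sqrt r *\<^sub>R f x) \<bullet> ((1 / sqrt r) *\<^sub>R g x)\<bar> \<le>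
      (norm (sqrt r *\<^sub>R f x))\<^sup>2 + (norm ((1 / sqrt r) *\<^sub>R g x))\<^sup>2"
      by (rule abs_inner_le_sq)
    then show "\<bar>f x \<bullet> g x\<bar> \<le> r * (norm (f x))\<^sup>2 + (1 / r) * (norm (g x))\<^sup>2"
      using r by (simp add: power_mult_distrib power_divide)
  qed (use f g integrable_inner[OF f g] in \<open>auto simp: square_integrable_def\<close>)
  also have "\<dots> = r * (LINT x|M. (norm (f x))\<^sup>2) + (1 / r) * (LINT x|M. (norm (g x))\<^sup>2)"
    using f g by (simp add: square_integrable_def)
  finally show ?thesis .
qed

lemma integral_inner_tendsto:
  assumes h: "square_integrable M h" and f: "\<And>k. square_integrable M (f k)" and g: "square_integrable M g"
    and lim: "(\<lambda>k. sqnorm M (\<lambda>x. f k x - g x)) \<longlonglongrightarrow> 0"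
  shows "(\<lambda>k. LINT x|M. h x \<bullet> f k x) \<longlonglongrightarrow> (LINT x|M. h x \<bullet> g x)"
proof -
  define a where "a = (LINT x|M. (norm (h x))\<^sup>2)"
  define b where "b k = (LINT x|M. (norm (f k x - g x))\<^sup>2)" for k
  have a: "0 \<le> a" by (simp add: a_def)
  have b0: "0 \<le> b k" for k by (simp add: b_def)
  have bl: "b \<longlonglongrightarrow> 0"
    using lim unfolding sqnorm_eq_integral[OF square_integrable_diff[OF f g]] b_def[symmetric]
    by (subst (asm) ennreal_0[symmetric], subst (asm) tendsto_ennreal_iff) (auto simp: b0)
  have le: "\<bar>(LINT x|M. h x \<bullet> f k x) - (LINT x|M. h x \<bullet> g x)\<bar> \<le> r * a + (1 / r) * b k" if "0 < r" for k r
    using abs_integral_inner_le[OF h square_integrable_diff[OF f[of k] g] that]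
    by (simp add: inner_diff_right a_def b_def integrable_inner[OF h f] integrable_inner[OF h g])
  show ?thesis
  proof (rule LIMSEQ_I)
    fix \<epsilon> :: real assume \<epsilon>: "0 < \<epsilon>"
    \<comment> \<open>Makes the first term of the bound at most \<epsilon>/2; the summand 1 in the
      denominator guards against a = 0. The index N is then chosen depending on r.\<close>
    define r where "r = \<epsilon> / (2 * (a + 1))"
    have r: "0 < r" "r * a \<le> \<epsilon> / 2" using \<epsilon> a by (auto simp: r_def field_simps)
    obtain N where N: "\<And>k. N \<le> k \<Longrightarrow> \<bar>b k\<bar> < r * \<epsilon> / 2"
      using LIMSEQ_D[OF bl, of "r * \<epsilon> / 2"] r \<epsilon> by auto
    have "norm ((LINT x|M. h x \<bullet> f k x) - (LINT x|M. h x \<bullet> g x)) < \<epsilon>" if "N \<le> k" for k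
    proof -
      have "(1 / r) * b k < \<epsilon> / 2" using N[OF that] r(1) by (simp add: field_simps)
      then show ?thesis using le[OF r(1), of k] r(2) unfolding real_norm_def by linarith
    qed
    then show "\<exists>N. \<forall>k\<ge>N. norm ((LINT x|M. h x \<bullet> f k x) - (LINT x|M. h x \<bullet> g x)) < \<epsilon>" by blast
  qed
qed

section \<open>Traces\<close>

locale bounded_domain =
  fixes \<Omega> :: "'a::euclidean_space set"
  assumes open_domain: "open \<Omega>" and bounded_domain: "bounded \<Omega>"
begin

abbreviation "M \<equiv> lebesgue_on \<Omega>"
abbreviation "S \<equiv> surface_measure \<Omega>"

lemma finite_measure_M: "finite_measure M"
  using open_domain bounded_domain by (intro finite_measure_lebesgue_on lmeasurable_open)

lemma square_integrable_continuous:
  fixes f :: "'a \<Rightarrow> 'b::euclidean_space"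
  assumes f: "continuous_on UNIV f"
  shows "square_integrable M f"
proof -
  interpret finite_measure M by (rule finite_measure_M)
  have "compact (closure \<Omega>)" using bounded_domain by (simp add: compact_closure)
  then have "bounded (f ` closure \<Omega>)"
    using f by (intro compact_imp_bounded compact_continuous_image) (auto intro: continuous_on_subset)
  then obtain B where B: "\<And>x. x \<in> closure \<Omega> \<Longrightarrow> norm (f x) \<le> B" by (auto simp: bounded_iff)
  have [measurable]: "f \<in> borel_measurable M" using f by (rule borel_measurable_lebesgue_on)
  have "integrable M (\<lambda>x. (norm (f x))\<^sup>2)"
  proof (rule integrable_const_bound[of _ "B\<^sup>2"])
    have "(norm (f x))\<^sup>2 \<le> B\<^sup>2" if "x \<in> \<Omega>" for x
      using B[of x] that closure_subset by (intro power_mono) auto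
    then show "AE x in M. norm ((norm (f x))\<^sup>2) \<le> B\<^sup>2" by (intro AE_I2) simp
  qed measurable
  then show ?thesis by (simp add: square_integrable_def)
qed

lemma square_integrable_test_function:
  assumes "test_function \<Omega> \<phi>"
  shows "square_integrable M \<phi>" "square_integrable M (\<lambda>x. grad \<phi> x \<bullet> b)" "square_integrable M (\<lambda>x. \<phi> x *\<^sub>R v)"
proof -
  have s: "smooth \<phi>" using assms by (simp add: test_function_def)
  show "square_integrable M \<phi>" "square_integrable M (\<lambda>x. grad \<phi> x \<bullet> b)" "square_integrable M (\<lambda>x. \<phi> x *\<^sub>R v)"
    by (rule square_integrable_continuous, intro continuous_intros
        smooth_continuous_grad[OF s] smooth_continuous[OF s])+
qed

text \<open>Makes the choice in \<open>weak_grad\<close> harmless: two candidates agree almost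
  everywhere, by the fundamental lemma applied to each coordinate of their difference.\<close>

lemma weak_gradient_unique:
  assumes G: "square_integrable M G" "has_weak_gradient \<Omega> u G"
    and H: "square_integrable M H" "has_weak_gradient \<Omega> u H"
  shows "AE x in M. G x = H x"
proof -
  have "AE x in M. (G x - H x) \<bullet> b = 0" if b: "b \<in> Basis" for b
  proof (rule fundamental_lemma_variations[OF open_domain])
    have "square_integrable M (\<lambda>_. b)" by (intro square_integrable_continuous continuous_intros)
    then show "integrable M (\<lambda>x. (G x - H x) \<bullet> b)"
      using G H by (intro integrable_inner square_integrable_diff)
    fix \<phi> assume \<phi>: "test_function \<Omega> \<phi>"
    have i: "integrable M (\<lambda>x. (K x \<bullet> b) * \<phi> x)" if "square_integrable M K" for K
      using integrable_inner[OF that square_integrable_test_function(3)[OF \<phi>, of b]]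
      by (simp add: mult.commute)
    have "(LINT x|M. (G x \<bullet> b) * \<phi> x) = (LINT x|M. (H x \<bullet> b) * \<phi> x)"
      using G(2)[unfolded has_weak_gradient_def, rule_format, OF \<phi> b]
        H(2)[unfolded has_weak_gradient_def, rule_format, OF \<phi> b] by linarith
    then show "(LINT x|M. ((G x - H x) \<bullet> b) * \<phi> x) = 0"
      using i[OF G(1)] i[OF H(1)] by (simp add: inner_diff_left left_diff_distrib)
  qed
  then have "AE x in M. \<forall>b\<in>Basis. (G x - H x) \<bullet> b = 0"
    by (intro AE_finite_allI) auto
  then show ?thesis
    by eventually_elim (auto intro: euclidean_eqI simp: inner_diff_left)
qed

lemma H1_weak_grad:
  assumes "u \<in> H1 \<Omega>"
  shows "square_integrable M u" "square_integrable M (weak_grad \<Omega> u)"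
    "has_weak_gradient \<Omega> u (weak_grad \<Omega> u)"
  using assms someI_ex[of "\<lambda>G. square_integrable M G \<and> has_weak_gradient \<Omega> u G"]
  unfolding H1_def weak_grad_def by auto

lemma H1_I:
  assumes "square_integrable M u" "square_integrable M G" "has_weak_gradient \<Omega> u G"
  shows "u \<in> H1 \<Omega>" "AE x in M. weak_grad \<Omega> u x = G x"
proof -
  show u: "u \<in> H1 \<Omega>" using assms unfolding H1_def by auto
  show "AE x in M. weak_grad \<Omega> u x = G x"
    by (rule weak_gradient_unique[OF H1_weak_grad(2,3)[OF u] assms(2,3)])
qed

lemma has_weak_gradient_add_cmult:
  assumes u: "square_integrable M u" "square_integrable M G" "has_weak_gradient \<Omega> u G"
    and v: "square_integrable M v" "square_integrable M H" "has_weak_gradient \<Omega> v H"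
  shows "has_weak_gradient \<Omega> (\<lambda>x. u x + c * v x) (\<lambda>x. G x + c *\<^sub>R H x)"
  unfolding has_weak_gradient_def
proof (intro allI impI ballI)
  fix \<phi> and b :: 'a assume \<phi>: "test_function \<Omega> \<phi>" and b: "b \<in> Basis"
  note t = square_integrable_test_function[OF \<phi>]
  have i: "integrable M (\<lambda>x. w x * (grad \<phi> x \<bullet> b))" if "square_integrable M w" for w
    by (rule integrable_mult_square_integrable[OF that t(2)])
  have j: "integrable M (\<lambda>x. (K x \<bullet> b) * \<phi> x)" if "square_integrable M K" for K
    using integrable_inner[OF that t(3)[of b]] by (simp add: mult.commute)
  have "(LINT x|M. (u x + c * v x) * (grad \<phi> x \<bullet> b)) =
      (LINT x|M. u x * (grad \<phi> x \<bullet> b)) + c * (LINT x|M. v x * (grad \<phi> x \<bullet> b))"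
    using i[OF u(1)] i[OF v(1)] by (simp add: distrib_right mult.assoc)
  also have "\<dots> = - ((LINT x|M. (G x \<bullet> b) * \<phi> x) + c * (LINT x|M. (H x \<bullet> b) * \<phi> x))"
    using u(3) v(3) \<phi> b unfolding has_weak_gradient_def by simp
  also have "(LINT x|M. (G x \<bullet> b) * \<phi> x) + c * (LINT x|M. (H x \<bullet> b) * \<phi> x) =
      (LINT x|M. ((G x + c *\<^sub>R H x) \<bullet> b) * \<phi> x)"
    using j[OF u(2)] j[OF v(2)] by (simp add: inner_add_left distrib_right mult.assoc)
  finally show "(LINT x|M. (u x + c * v x) * (grad \<phi> x \<bullet> b)) = - (LINT x|M. ((G x + c *\<^sub>R H x) \<bullet> b) * \<phi> x)" .
qed

text \<open>For a fixed test function both sides of the defining identity are L2 pairings, hence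
  continuous under L2 convergence.\<close>

lemma has_weak_gradient_limit:
  assumes uk: "\<And>k. square_integrable M (uk k)" "\<And>k. square_integrable M (Gk k)" "\<And>k. has_weak_gradient \<Omega> (uk k) (Gk k)"
    and u: "square_integrable M u" "square_integrable M G"
    and lim: "(\<lambda>k. sqnorm M (\<lambda>x. uk k x - u x)) \<longlonglongrightarrow> 0" "(\<lambda>k. sqnorm M (\<lambda>x. Gk k x - G x)) \<longlonglongrightarrow> 0"
  shows "has_weak_gradient \<Omega> u G"
  unfolding has_weak_gradient_def
proof (intro allI impI ballI)
  fix \<phi> and b :: 'a assume \<phi>: "test_function \<Omega> \<phi>" and b: "b \<in> Basis"
  note t = square_integrable_test_function[OF \<phi>]
  have 1: "(\<lambda>k. LINT x|M. (grad \<phi> x \<bullet> b) \<bullet> uk k x) \<longlonglongrightarrow> (LINT x|M. (grad \<phi> x \<bullet> b) \<bullet> u x)"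
    by (rule integral_inner_tendsto[OF t(2) uk(1) u(1) lim(1)])
  have 2: "(\<lambda>k. LINT x|M. (\<phi> x *\<^sub>R b) \<bullet> Gk k x) \<longlonglongrightarrow> (LINT x|M. (\<phi> x *\<^sub>R b) \<bullet> G x)"
    by (rule integral_inner_tendsto[OF t(3) uk(2) u(2) lim(2)])
  have "(LINT x|M. (grad \<phi> x \<bullet> b) \<bullet> uk k x) = - (LINT x|M. (\<phi> x *\<^sub>R b) \<bullet> Gk k x)" for k
    using uk(3)[of k] \<phi> b unfolding has_weak_gradient_def by (simp add: inner_commute mult.commute)
  then have "(LINT x|M. (grad \<phi> x \<bullet> b) \<bullet> u x) = - (LINT x|M. (\<phi> x *\<^sub>R b) \<bullet> G x)"
    using LIMSEQ_unique[OF 1] tendsto_minus[OF 2] by simp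
  then show "(LINT x|M. u x * (grad \<phi> x \<bullet> b)) = - (LINT x|M. (G x \<bullet> b) * \<phi> x)"
    by (simp add: inner_commute mult.commute)
qed

text \<open>The gradient is a separate argument so that a candidate G can be used before it is
  identified with \<open>weak_grad\<close>, and the convergences are split so that each is a
  statement about one \<open>sqnorm\<close>.\<close>

definition smooth_approx :: "(nat \<Rightarrow> 'a \<Rightarrow> real) \<Rightarrow> ('a \<Rightarrow> real) \<Rightarrow> ('a \<Rightarrow> 'a) \<Rightarrow> ('a \<Rightarrow> real) \<Rightarrow> bool" where
  "smooth_approx w u G g \<longleftrightarrow> (\<forall>k. smooth (w k)) \<and> (\<lambda>k. sqnorm M (\<lambda>x. w k x - u x)) \<longlonglongrightarrow> 0 \<and>
     (\<lambda>k. sqnorm M (\<lambda>x. grad (w k) x - G x)) \<longlonglongrightarrow> 0 \<and> (\<lambda>k. sqnorm S (\<lambda>x. w k x - g x)) \<longlonglongrightarrow> 0"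

lemma smooth_measurable:
  assumes "smooth w"
  shows "w \<in> borel_measurable M" "grad w \<in> borel_measurable M" "w \<in> borel_measurable S"
  using assms by (auto intro!: borel_measurable_lebesgue_on borel_measurable_surface smooth_continuous smooth_continuous_grad)

lemma has_trace_iff:
  "has_trace \<Omega> u g \<longleftrightarrow> u \<in> H1 \<Omega> \<and> square_integrable S g \<and> (\<exists>w. smooth_approx w u (weak_grad \<Omega> u) g)"
proof (cases "u \<in> H1 \<Omega>")
  case True
  note [measurable] = H1_weak_grad(1,2)[OF True, THEN square_integrable_measurable]
  have eq: "(\<integral>\<^sup>+x. ennreal ((w x - u x)\<^sup>2 + (norm (grad w x - weak_grad \<Omega> u x))\<^sup>2) \<partial>M) =
      sqnorm M (\<lambda>x. w x - u x) + sqnorm M (\<lambda>x. grad w x - weak_grad \<Omega> u x)" if "smooth w" for w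
  proof -
    note [measurable] = smooth_measurable[OF that]
    show ?thesis unfolding sqnorm_def by (simp add: nn_integral_add)
  qed
  have lim: "(\<lambda>k. f k + g k) \<longlonglongrightarrow> 0 \<longleftrightarrow> f \<longlonglongrightarrow> 0 \<and> g \<longlonglongrightarrow> 0" for f g :: "nat \<Rightarrow> ennreal"
  proof
    assume s: "(\<lambda>k. f k + g k) \<longlonglongrightarrow> 0"
    show "f \<longlonglongrightarrow> 0 \<and> g \<longlonglongrightarrow> 0"
      by (intro conjI tendsto_0_ennreal_le[OF _ s]) auto
  next
    assume "f \<longlonglongrightarrow> 0 \<and> g \<longlonglongrightarrow> 0"
    then show "(\<lambda>k. f k + g k) \<longlonglongrightarrow> 0" using tendsto_add[of f 0 _ g 0] by simp
  qed
  have "(\<forall>k. smooth (w k)) \<and>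
        (\<lambda>k. \<integral>\<^sup>+x. ennreal ((w k x - u x)\<^sup>2 + (norm (grad (w k) x - weak_grad \<Omega> u x))\<^sup>2) \<partial>M) \<longlonglongrightarrow> 0 \<and>
        (\<lambda>k. \<integral>\<^sup>+x. ennreal ((w k x - g x)\<^sup>2) \<partial>S) \<longlonglongrightarrow> 0 \<longleftrightarrow> smooth_approx w u (weak_grad \<Omega> u) g" for w
  proof (cases "\<forall>k. smooth (w k)")
    case True
    then have e: "(\<lambda>k. \<integral>\<^sup>+x. ennreal ((w k x - u x)\<^sup>2 + (norm (grad (w k) x - weak_grad \<Omega> u x))\<^sup>2) \<partial>M) =
      (\<lambda>k. sqnorm M (\<lambda>x. w k x - u x) + sqnorm M (\<lambda>x. grad (w k) x - weak_grad \<Omega> u x))"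
      by (intro ext eq) blast
    have "(\<lambda>k. \<integral>\<^sup>+x. ennreal ((w k x - g x)\<^sup>2) \<partial>S) = (\<lambda>k. sqnorm S (\<lambda>x. w k x - g x))"
      by (simp add: sqnorm_def)
    then show ?thesis
      unfolding smooth_approx_def e lim by (simp add: conj_assoc)
  qed (unfold smooth_approx_def, blast)
  then show ?thesis unfolding has_trace_def by simp
qed (simp add: has_trace_def)

lemma has_trace_H1: "has_trace \<Omega> u g \<Longrightarrow> u \<in> H1 \<Omega>"
  by (simp add: has_trace_def)

lemma has_trace_square_integrable: "has_trace \<Omega> u g \<Longrightarrow> square_integrable S g"
  by (simp add: has_trace_def)

lemmas has_trace_weak_grad = H1_weak_grad[OF has_trace_H1]

lemma smooth_approx_cong_AE:
  assumes "AE x in M. G x = H x" "AE x in S. f x = g x"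
  shows "smooth_approx w u G f \<longleftrightarrow> smooth_approx w u H g"
proof -
  have "sqnorm M (\<lambda>x. grad (w k) x - G x) = sqnorm M (\<lambda>x. grad (w k) x - H x)" for k
    by (rule sqnorm_cong_AE) (use assms(1) in auto)
  moreover have "sqnorm S (\<lambda>x. w k x - f x) = sqnorm S (\<lambda>x. w k x - g x)" for k
    by (rule sqnorm_cong_AE) (use assms(2) in auto)
  ultimately show ?thesis by (simp add: smooth_approx_def)
qed

lemma has_traceI:
  assumes u: "square_integrable M u" "square_integrable M G" "has_weak_gradient \<Omega> u G"
    and g: "square_integrable S g" and w: "smooth_approx w u G g"
  shows "has_trace \<Omega> u g" "AE x in M. weak_grad \<Omega> u x = G x"
  using H1_I[OF u] g w smooth_approx_cong_AE[of "weak_grad \<Omega> u" G g g w u]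
  unfolding has_trace_iff by auto

lemma has_trace_cong_AE:
  assumes "has_trace \<Omega> u f" "AE x in S. f x = g x" "square_integrable S g"
  shows "has_trace \<Omega> u g"
  using assms smooth_approx_cong_AE[of "weak_grad \<Omega> u" "weak_grad \<Omega> u" f g _ u]
  unfolding has_trace_iff by auto

lemma sqnorm_lincomb_tendsto_0:
  assumes m: "\<And>k. f k \<in> borel_measurable N" "\<And>k. g k \<in> borel_measurable N"
    and lim: "(\<lambda>k. sqnorm N (f k)) \<longlonglongrightarrow> 0" "(\<lambda>k. sqnorm N (g k)) \<longlonglongrightarrow> 0"
  shows "(\<lambda>k. sqnorm N (\<lambda>x. f k x + c *\<^sub>R g k x)) \<longlonglongrightarrow> 0"
proof (rule tendsto_0_ennreal_le)
  show "sqnorm N (\<lambda>x. f k x + c *\<^sub>R g k x) \<le> 2 * sqnorm N (f k) + (2 * ennreal (c\<^sup>2)) * sqnorm N (g k)" for k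
    using sqnorm_add_le[of "f k" N "\<lambda>x. c *\<^sub>R g k x"] m by (simp add: sqnorm_scaleR mult.assoc)
  have "2 * ennreal (c\<^sup>2) < \<infinity>"
    by (simp add: ennreal_mult_less_top)
  then have "(\<lambda>k. 2 * sqnorm N (f k) + (2 * ennreal (c\<^sup>2)) * sqnorm N (g k)) \<longlonglongrightarrow> 0 + 0"
    by (intro tendsto_add tendsto_0_ennreal_cmult lim) auto
  then show "(\<lambda>k. 2 * sqnorm N (f k) + (2 * ennreal (c\<^sup>2)) * sqnorm N (g k)) \<longlonglongrightarrow> 0" by simp
qed

lemma has_trace_lincomb:
  assumes u: "has_trace \<Omega> u f" and v: "has_trace \<Omega> v g"
  shows has_trace_add_cmult: "has_trace \<Omega> (\<lambda>x. u x + c * v x) (\<lambda>x. f x + c * g x)"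
    and weak_grad_add_cmult: "AE x in M. weak_grad \<Omega> (\<lambda>x. u x + c * v x) x = weak_grad \<Omega> u x + c *\<^sub>R weak_grad \<Omega> v x"
proof -
  note u' = has_trace_weak_grad[OF u] and v' = has_trace_weak_grad[OF v]
  note f' = has_trace_square_integrable[OF u] and g' = has_trace_square_integrable[OF v]
  obtain wu wv where w: "smooth_approx wu u (weak_grad \<Omega> u) f" "smooth_approx wv v (weak_grad \<Omega> v) g"
    using u v unfolding has_trace_iff by blast
  have s: "smooth (wu k)" "smooth (wv k)" for k using w by (auto simp: smooth_approx_def)
  have sc: "smooth (\<lambda>x. c * wv k x)" for k by (intro smooth_mult smooth_const s)
  have gr: "grad (\<lambda>x. wu k x + c * wv k x) x = grad (wu k) x + c *\<^sub>R grad (wv k) x" for k x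
    by (simp add: grad_add[OF s(1) sc] grad_cmult[OF s(2)])
  note [measurable] = smooth_measurable[OF s(1)] smooth_measurable[OF s(2)]
    u'(1,2)[THEN square_integrable_measurable] v'(1,2)[THEN square_integrable_measurable]
    f'[THEN square_integrable_measurable] g'[THEN square_integrable_measurable]
  have "smooth_approx (\<lambda>k x. wu k x + c * wv k x) (\<lambda>x. u x + c * v x)
      (\<lambda>x. weak_grad \<Omega> u x + c *\<^sub>R weak_grad \<Omega> v x) (\<lambda>x. f x + c * g x)"
    unfolding smooth_approx_def
  proof (intro conjI allI)
    show "smooth (\<lambda>x. wu k x + c * wv k x)" for k by (intro smooth_add s sc)
    have "(\<lambda>k. sqnorm M (\<lambda>x. (wu k x - u x) + c *\<^sub>R (wv k x - v x))) \<longlonglongrightarrow> 0"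
      using w by (intro sqnorm_lincomb_tendsto_0) (auto simp: smooth_approx_def)
    then show "(\<lambda>k. sqnorm M (\<lambda>x. wu k x + c * wv k x - (u x + c * v x))) \<longlonglongrightarrow> 0"
      by (simp add: algebra_simps)
    have "(\<lambda>k. sqnorm S (\<lambda>x. (wu k x - f x) + c *\<^sub>R (wv k x - g x))) \<longlonglongrightarrow> 0"
      using w by (intro sqnorm_lincomb_tendsto_0) (auto simp: smooth_approx_def)
    then show "(\<lambda>k. sqnorm S (\<lambda>x. wu k x + c * wv k x - (f x + c * g x))) \<longlonglongrightarrow> 0"
      by (simp add: algebra_simps)
    have "(\<lambda>k. sqnorm M (\<lambda>x. (grad (wu k) x - weak_grad \<Omega> u x) + c *\<^sub>R (grad (wv k) x - weak_grad \<Omega> v x))) \<longlonglongrightarrow> 0"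
      using w by (intro sqnorm_lincomb_tendsto_0) (auto simp: smooth_approx_def)
    then show "(\<lambda>k. sqnorm M (\<lambda>x. grad (\<lambda>x. wu k x + c * wv k x) x -
        (weak_grad \<Omega> u x + c *\<^sub>R weak_grad \<Omega> v x))) \<longlonglongrightarrow> 0"
      by (simp add: gr algebra_simps)
  qed
  note R = has_traceI[OF _ _ _ _ this]
  show "has_trace \<Omega> (\<lambda>x. u x + c * v x) (\<lambda>x. f x + c * g x)"
    "AE x in M. weak_grad \<Omega> (\<lambda>x. u x + c * v x) x = weak_grad \<Omega> u x + c *\<^sub>R weak_grad \<Omega> v x"
    by (rule R; intro square_integrable_add square_integrable_cmult square_integrable_scaleR
        has_weak_gradient_add_cmult u' v' f' g')+
qed

lemma has_trace_zero: "has_trace \<Omega> (\<lambda>_. 0) (\<lambda>_. 0)" "AE x in M. weak_grad \<Omega> (\<lambda>_. 0) x = 0"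
proof -
  have "smooth_approx (\<lambda>_ _. 0) (\<lambda>_. 0) (\<lambda>_. 0) (\<lambda>_. 0)"
    by (simp add: smooth_approx_def smooth_const sqnorm_def grad_def)
  moreover have "has_weak_gradient \<Omega> (\<lambda>_. 0) (\<lambda>_. 0)" by (simp add: has_weak_gradient_def)
  ultimately show "has_trace \<Omega> (\<lambda>_. 0) (\<lambda>_. 0)" "AE x in M. weak_grad \<Omega> (\<lambda>_. 0) x = 0"
    using has_traceI[of "\<lambda>_. 0" "\<lambda>_. 0" "\<lambda>_. 0"] by simp_all
qed

lemma has_trace_cmult:
  assumes "has_trace \<Omega> v g"
  shows "has_trace \<Omega> (\<lambda>x. c * v x) (\<lambda>x. c * g x)"
    "AE x in M. weak_grad \<Omega> (\<lambda>x. c * v x) x = c *\<^sub>R weak_grad \<Omega> v x"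
  using has_trace_add_cmult[OF has_trace_zero(1) assms, of c]
    weak_grad_add_cmult[OF has_trace_zero(1) assms, of c] has_trace_zero(2) by (auto elim: AE_mp)

lemma has_trace_sum:
  assumes "finite I" "\<And>i. i \<in> I \<Longrightarrow> has_trace \<Omega> (u i) (f i)"
  shows "has_trace \<Omega> (\<lambda>x. \<Sum>i\<in>I. c i * u i x) (\<lambda>x. \<Sum>i\<in>I. c i * f i x) \<and>
    (AE x in M. weak_grad \<Omega> (\<lambda>x. \<Sum>i\<in>I. c i * u i x) x = (\<Sum>i\<in>I. c i *\<^sub>R weak_grad \<Omega> (u i) x))"
  using assms
proof (induction I rule: finite_induct)
  case empty
  then show ?case using has_trace_zero by simp
next
  case (insert i I)
  then have IH: "has_trace \<Omega> (\<lambda>x. \<Sum>i\<in>I. c i * u i x) (\<lambda>x. \<Sum>i\<in>I. c i * f i x)"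
    "AE x in M. weak_grad \<Omega> (\<lambda>x. \<Sum>i\<in>I. c i * u i x) x = (\<Sum>i\<in>I. c i *\<^sub>R weak_grad \<Omega> (u i) x)"
    and i: "has_trace \<Omega> (u i) (f i)" by auto
  show ?case
    using has_trace_add_cmult[OF IH(1) i, of "c i"] weak_grad_add_cmult[OF IH(1) i, of "c i"] IH(2) insert.hyps
    by (auto simp: add.commute)
qed

text \<open>Diagonal argument: a smooth \<open>w k\<close> is chosen with all three squared
  distances to \<open>uk k\<close>, its gradient and g below 1/(k+1), so it follows
  \<open>uk k\<close> to the limit. The boundary datum g is the same for all k.\<close>

lemma has_trace_closed:
  assumes uk: "\<And>k. has_trace \<Omega> (uk k) g"
    and u: "square_integrable M u" "square_integrable M G"
    and lim: "(\<lambda>k. sqnorm M (\<lambda>x. uk k x - u x)) \<longlonglongrightarrow> 0" "(\<lambda>k. sqnorm M (\<lambda>x. weak_grad \<Omega> (uk k) x - G x)) \<longlonglongrightarrow> 0"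
  shows "has_trace \<Omega> u g" "AE x in M. weak_grad \<Omega> u x = G x"
proof -
  let ?\<epsilon> = "\<lambda>k :: nat. ennreal (inverse (real (Suc k)))"
  note uk' = has_trace_weak_grad[OF uk]
  have g: "square_integrable S g" using uk has_trace_square_integrable by blast
  have wg: "has_weak_gradient \<Omega> u G"
    by (rule has_weak_gradient_limit[OF uk' u lim])
  have ex: "\<exists>w. smooth w \<and> sqnorm M (\<lambda>x. w x - uk k x) < ?\<epsilon> k \<and>
      sqnorm M (\<lambda>x. grad w x - weak_grad \<Omega> (uk k) x) < ?\<epsilon> k \<and>
      sqnorm S (\<lambda>x. w x - g x) < ?\<epsilon> k" for k
  proof -
    obtain w where w: "smooth_approx w (uk k) (weak_grad \<Omega> (uk k)) g"
      using uk unfolding has_trace_iff by blast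
    have e: "0 < ?\<epsilon> k" by simp
    have "\<forall>\<^sub>F j in sequentially. sqnorm M (\<lambda>x. w j x - uk k x) < ?\<epsilon> k \<and>
        sqnorm M (\<lambda>x. grad (w j) x - weak_grad \<Omega> (uk k) x) < ?\<epsilon> k \<and>
        sqnorm S (\<lambda>x. w j x - g x) < ?\<epsilon> k"
      using w unfolding smooth_approx_def by (intro eventually_conj order_tendstoD(2)[OF _ e]) auto
    from eventually_happens'[OF sequentially_bot this] obtain j where "sqnorm M (\<lambda>x. w j x - uk k x) < ?\<epsilon> k \<and>
        sqnorm M (\<lambda>x. grad (w j) x - weak_grad \<Omega> (uk k) x) < ?\<epsilon> k \<and>
        sqnorm S (\<lambda>x. w j x - g x) < ?\<epsilon> k"
      by blast
    then show ?thesis using w unfolding smooth_approx_def by blast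
  qed
  have "\<forall>k. \<exists>w. smooth w \<and> sqnorm M (\<lambda>x. w x - uk k x) < ?\<epsilon> k \<and>
      sqnorm M (\<lambda>x. grad w x - weak_grad \<Omega> (uk k) x) < ?\<epsilon> k \<and>
      sqnorm S (\<lambda>x. w x - g x) < ?\<epsilon> k"
    by (intro allI ex)
  from choice[OF this] obtain w where s: "\<And>k. smooth (w k)"
    and w: "\<And>k. sqnorm M (\<lambda>x. w k x - uk k x) < ?\<epsilon> k"
      "\<And>k. sqnorm M (\<lambda>x. grad (w k) x - weak_grad \<Omega> (uk k) x) < ?\<epsilon> k"
      "\<And>k. sqnorm S (\<lambda>x. w k x - g x) < ?\<epsilon> k"
    by blast
  have inv0: "(\<lambda>k. ?\<epsilon> k) \<longlonglongrightarrow> 0"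
    using tendsto_ennrealI[OF LIMSEQ_inverse_real_of_nat] by simp
  note [measurable] = smooth_measurable[OF s] u[THEN square_integrable_measurable]
    uk'(1,2)[THEN square_integrable_measurable]
  have comb: "(\<lambda>k. 2 * a k + 2 * b k) \<longlonglongrightarrow> 0"
    if "\<And>k. a k < ?\<epsilon> k" "b \<longlonglongrightarrow> 0" for a b :: "nat \<Rightarrow> ennreal"
  proof -
    have "a \<longlonglongrightarrow> 0" by (rule tendsto_0_ennreal_le[OF less_imp_le[OF that(1)] inv0])
    then have "(\<lambda>k. 2 * a k + 2 * b k) \<longlonglongrightarrow> 0 + 0"
      using that(2) by (intro tendsto_add tendsto_0_ennreal_cmult) auto
    then show ?thesis by simp
  qed
  have "smooth_approx w u G g"
    unfolding smooth_approx_def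
  proof (intro conjI allI s)
    show "(\<lambda>k. sqnorm M (\<lambda>x. w k x - u x)) \<longlonglongrightarrow> 0"
      by (rule tendsto_0_ennreal_le[OF sqnorm_diff_triangle comb[OF w(1) lim(1)]]) measurable
    show "(\<lambda>k. sqnorm M (\<lambda>x. grad (w k) x - G x)) \<longlonglongrightarrow> 0"
      by (rule tendsto_0_ennreal_le[OF sqnorm_diff_triangle comb[OF w(2) lim(2)]]) measurable
    show "(\<lambda>k. sqnorm S (\<lambda>x. w k x - g x)) \<longlonglongrightarrow> 0"
      by (rule tendsto_0_ennreal_le[OF less_imp_le[OF w(3)] inv0])
  qed
  then show "has_trace \<Omega> u g" "AE x in M. weak_grad \<Omega> u x = G x"
    using has_traceI[OF u wg g] by auto
qed

text \<open>The smooth inequality is applied to approximants of v, whose boundary values tend to 0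
  in L2. The factor 4 on c comes from splitting a square twice, once for v and once for its
  gradient.\<close>

lemma friedrichs_trace_zero:
  assumes n: "2 \<le> DIM('a)"
  obtains C where "0 \<le> C" "\<And>v. has_trace \<Omega> v (\<lambda>_. 0) \<Longrightarrow> sqnorm M v \<le> ennreal C * sqnorm M (weak_grad \<Omega> v)"
proof -
  obtain R where R: "0 < R" "\<Omega> \<subseteq> cball 0 R"
    using bounded_subset_ballD[OF bounded_domain, of 0] ball_subset_cball[of 0] by blast
  obtain e :: 'a where e: "e \<in> Basis" using nonempty_Basis by blast
  define a where "a = 2 * exit_const TYPE('a) R"
  define c where "c = 2 * (2 * R + 1)\<^sup>2"
  have fr: "sqnorm M w \<le> ennreal a * sqnorm S w + ennreal c * sqnorm M (grad w)" if "smooth w" for w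
    using friedrichs_smooth[OF open_domain e R n that] by (simp add: sqnorm_def a_def c_def)
  have "sqnorm M v \<le> ennreal (4 * c) * sqnorm M (weak_grad \<Omega> v)" if v: "has_trace \<Omega> v (\<lambda>_. 0)" for v
  proof -
    obtain w where w: "smooth_approx w v (weak_grad \<Omega> v) (\<lambda>_. 0)"
      using v unfolding has_trace_iff by blast
    then have s: "smooth (w k)" for k by (simp add: smooth_approx_def)
    note [measurable] = smooth_measurable[OF s] has_trace_weak_grad(1,2)[OF v, THEN square_integrable_measurable]
    \<comment> \<open>The part of the bound that tends to 0 along the approximation.\<close>
    let ?e = "\<lambda>k. 2 * sqnorm M (\<lambda>x. w k x - v x) + (2 * ennreal a) * sqnorm S (\<lambda>x. w k x - 0) +
       (4 * ennreal c) * sqnorm M (\<lambda>x. grad (w k) x - weak_grad \<Omega> v x)"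
    have le: "sqnorm M v \<le> ?e k + (4 * ennreal c) * sqnorm M (weak_grad \<Omega> v)" for k
    proof -
      have "sqnorm M v \<le> 2 * sqnorm M (\<lambda>x. w k x - v x) + 2 * sqnorm M (w k)"
        using sqnorm_diff_triangle[of v M "w k" "\<lambda>_. 0"] by (simp add: sqnorm_minus_commute[of M v])
      also have "sqnorm M (w k) \<le> ennreal a * sqnorm S (w k) + ennreal c * sqnorm M (grad (w k))"
        by (rule fr[OF s])
      also have "sqnorm M (grad (w k)) \<le> 2 * sqnorm M (\<lambda>x. grad (w k) x - weak_grad \<Omega> v x) + 2 * sqnorm M (weak_grad \<Omega> v)"
        using sqnorm_diff_triangle[of "grad (w k)" M "weak_grad \<Omega> v" "\<lambda>_. 0"] by simp
      finally have "sqnorm M v \<le> 2 * sqnorm M (\<lambda>x. w k x - v x) + 2 * (ennreal a * sqnorm S (w k) +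
          ennreal c * (2 * sqnorm M (\<lambda>x. grad (w k) x - weak_grad \<Omega> v x) + 2 * sqnorm M (weak_grad \<Omega> v)))"
        by (simp add: add_left_mono mult_left_mono)
      also have "\<dots> = ?e k + (4 * ennreal c) * sqnorm M (weak_grad \<Omega> v)"
        by (simp add: algebra_simps)
      finally show ?thesis .
    qed
    have "(\<lambda>k. ?e k + (4 * ennreal c) * sqnorm M (weak_grad \<Omega> v)) \<longlonglongrightarrow> 0 + 0 + 0 + (4 * ennreal c) * sqnorm M (weak_grad \<Omega> v)"
      using w by (intro tendsto_add tendsto_0_ennreal_cmult tendsto_const) (auto simp: smooth_approx_def ennreal_mult_less_top)
    then have "sqnorm M v \<le> 0 + 0 + 0 + (4 * ennreal c) * sqnorm M (weak_grad \<Omega> v)"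
      by (rule LIMSEQ_le_const) (use le in blast)
    then show ?thesis by (simp add: ennreal_mult' c_def)
  qed
  then show ?thesis using that[of "4 * c"] by (simp add: c_def)
qed

end

section \<open>Energy minimisation\<close>

text \<open>On each cell the subgradient at the left end bounds the increment of F from below and
  the one at the right end from above; right and left sums differ by the telescoping quantity (f b -
  f 0) b / n.\<close>

lemma left_sums_bounds:
  fixes f F :: "real \<Rightarrow> real"
  assumes sub: "\<And>s t. s \<in> {0..b} \<Longrightarrow> t \<in> {0..b} \<Longrightarrow> f s * (t - s) \<le> F t - F s"
    and b: "0 \<le> b" and n: "0 < n"
  shows "(\<Sum>i<n. f (b * (real i / real n)) * (b / real n)) \<le> F b - F 0"
    and "F b - F 0 \<le> (\<Sum>i<n. f (b * (real i / real n)) * (b / real n)) + (f b - f 0) * (b / real n)"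
proof -
  define t where "t i = b * (real i / real n)" for i :: nat
  have t: "t i \<in> {0..b}" if "i \<le> n" for i
    using that b n mult_left_le[of "real i / real n" b] by (auto simp: t_def)
  have step: "t (Suc i) - t i = b / real n" for i
    by (simp add: t_def add_divide_distrib distrib_left)
  have ends: "t 0 = 0" "t n = b" using n by (auto simp: t_def)
  have tel: "(\<Sum>i<n. F (t (Suc i)) - F (t i)) = F b - F 0"
    using sum_lessThan_telescope[of "\<lambda>i. F (t i)" n] by (simp add: ends)
  show "(\<Sum>i<n. f (b * (real i / real n)) * (b / real n)) \<le> F b - F 0"
    unfolding tel[symmetric] t_def[symmetric]
  proof (rule sum_mono)
    fix i assume "i \<in> {..<n}"
    then show "f (t i) * (b / real n) \<le> F (t (Suc i)) - F (t i)"
      using sub[OF t[of i] t[of "Suc i"]] unfolding step[of i] by simp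
  qed
  have "F (t (Suc i)) - F (t i) \<le> f (t (Suc i)) * (b / real n)" if "i < n" for i
    using sub[OF t[of "Suc i"] t[of i]] that unfolding step[of i, symmetric] by (simp add: algebra_simps)
  then have "F b - F 0 \<le> (\<Sum>i<n. f (t (Suc i)) * (b / real n))"
    unfolding tel[symmetric] by (intro sum_mono) auto
  also have "\<dots> = (\<Sum>i<n. f (t i) * (b / real n)) + (f b - f 0) * (b / real n)"
  proof -
    have "(\<Sum>i<n. f (t (Suc i)) * (b / real n)) - (\<Sum>i<n. f (t i) * (b / real n)) =
        (\<Sum>i<n. f (t (Suc i)) * (b / real n) - f (t i) * (b / real n))"
      by (simp add: sum_subtractf)
    also have "\<dots> = f (t n) * (b / real n) - f (t 0) * (b / real n)"
      by (rule sum_lessThan_telescope[of "\<lambda>i. f (t i) * (b / real n)"])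
    finally show ?thesis unfolding ends by (simp add: algebra_simps)
  qed
  finally show "F b - F 0 \<le> (\<Sum>i<n. f (b * (real i / real n)) * (b / real n)) + (f b - f 0) * (b / real n)"
    by (simp add: t_def)
qed

text \<open>Serves twice: it determines F from its subgradient, and it exhibits
  \<open>potential\<close> as a pointwise limit of measurable functions.\<close>

lemma left_sums_tendsto:
  fixes f F :: "real \<Rightarrow> real"
  assumes sub: "\<And>s t. s \<in> {0..b} \<Longrightarrow> t \<in> {0..b} \<Longrightarrow> f s * (t - s) \<le> F t - F s" and b: "0 \<le> b"
  shows "(\<lambda>n. \<Sum>i<n. f (b * (real i / real n)) * (b / real n)) \<longlonglongrightarrow> F b - F 0"
proof (rule tendsto_sandwich)
  have "(\<lambda>n. F b - F 0 - (f b - f 0) * b * inverse (real n)) \<longlonglongrightarrow> F b - F 0 - (f b - f 0) * b * 0"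
    by (intro tendsto_intros lim_inverse_n)
  then show "(\<lambda>n. F b - F 0 - (f b - f 0) * b * inverse (real n)) \<longlonglongrightarrow> F b - F 0" by simp
  show "\<forall>\<^sub>F n in sequentially. F b - F 0 - (f b - f 0) * b * inverse (real n) \<le> (\<Sum>i<n. f (b * (real i / real n)) * (b / real n))"
    using eventually_gt_at_top[of 0]
  proof eventually_elim
    case (elim n)
    have "(f b - f 0) * b * inverse (real n) = (f b - f 0) * (b / real n)"
      by (simp add: divide_inverse)
    then show ?case using left_sums_bounds(2)[of b f F, OF sub b elim] by linarith
  qed
  show "\<forall>\<^sub>F n in sequentially. (\<Sum>i<n. f (b * (real i / real n)) * (b / real n)) \<le> F b - F 0"
    using eventually_gt_at_top[of 0]
    by eventually_elim (use left_sums_bounds(1)[of b f F, OF sub b] in simp)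
qed (rule tendsto_const)

text \<open>A function admitting \<open>f\<close> as a subgradient is determined by \<open>f\<close> up to a constant, so no
  differentiability is needed to integrate \<open>f\<close>.\<close>

lemma set_integral_subgradient:
  fixes f F :: "real \<Rightarrow> real"
  assumes sub: "\<And>s t. s \<in> {0..1} \<Longrightarrow> t \<in> {0..1} \<Longrightarrow> f s * (t - s) \<le> F t - F s"
  shows "(LBINT t:{0..1}. f t) = F 1 - F 0"
proof -
  \<comment> \<open>A subgradient is monotone, which yields measurability and a bound by the end
    values, hence integrability.\<close>
  have mono: "f s \<le> f t" if "s \<in> {0..1}" "t \<in> {0..1}" "s \<le> t" for s t
  proof (cases "s = t")
    case False
    have "f s * (t - s) + f t * (s - t) \<le> 0"
      using sub[OF that(1,2)] sub[OF that(2,1)] by linarith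
    then have "(f s - f t) * (t - s) \<le> 0" by (simp add: algebra_simps)
    then show ?thesis using False that(3) by (simp add: mult_le_0_iff)
  qed simp
  have meas: "set_borel_measurable lborel {0..1} f"
    using borel_measurable_mono_on_fnc[of "{0..1}" f] mono
    by (simp add: set_borel_measurable_def borel_measurable_restrict_space_iff monotone_on_def)
  have int: "set_integrable lborel {0..1} f"
  proof (rule set_integrable_bound[of _ _ "\<lambda>_. \<bar>f 0\<bar> + \<bar>f 1\<bar>"])
    show "AE t in lborel. t \<in> {0..1} \<longrightarrow> norm (f t) \<le> norm (\<bar>f 0\<bar> + \<bar>f 1\<bar>)"
    proof (intro AE_I2 impI)
      fix t :: real assume t: "t \<in> {0..1}"
      then have "f 0 \<le> f t" "f t \<le> f 1" using mono[of 0 t] mono[of t 1] by auto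
      then show "norm (f t) \<le> norm (\<bar>f 0\<bar> + \<bar>f 1\<bar>)" by auto
    qed
  qed (use meas in \<open>auto simp: set_integrable_def\<close>)
  have HK: "f integrable_on {0..1}" and eq: "(LBINT t:{0..1}. f t) = integral {0..1} f"
    using set_borel_integral_eq_integral[OF int] by auto
  \<comment> \<open>The primitive of the monotone f also has f as a subgradient, so the increments
    of P and of F are limits of the same left sums.\<close>
  define P where "P t = integral {0..t} f" for t
  have "f s * (t - s) \<le> P t - P s" if st: "s \<in> {0..1}" "t \<in> {0..1}" for s t
  proof (cases "s \<le> t")
    case True
    have i: "f integrable_on {s..t}" "f integrable_on {0..t}"
      using HK st by (auto intro: integrable_on_subinterval)
    have "f s * (t - s) = integral {s..t} (\<lambda>_. f s)" using True by (simp add: mult.commute)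
    also have "\<dots> \<le> integral {s..t} f"
      using i st mono by (intro integral_le) auto
    also have "\<dots> = P t - P s"
      using Henstock_Kurzweil_Integration.integral_combine[OF _ True i(2)] st by (simp add: P_def)
    finally show ?thesis .
  next
    case False
    have i: "f integrable_on {t..s}" "f integrable_on {0..s}"
      using HK st by (auto intro: integrable_on_subinterval)
    have "P s - P t = integral {t..s} f"
      using Henstock_Kurzweil_Integration.integral_combine[OF _ _ i(2), of t] False st by (simp add: P_def)
    also have "\<dots> \<le> integral {t..s} (\<lambda>_. f s)"
      using i st mono by (intro integral_le) auto
    also have "\<dots> = f s * (s - t)" using False by (simp add: mult.commute)
    finally show ?thesis by (simp add: algebra_simps)
  qed
  from left_sums_tendsto[of 1 f P, OF this] left_sums_tendsto[of 1 f F, OF sub]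
  have "P 1 - P 0 = F 1 - F 0" by (intro LIMSEQ_unique) auto
  then show ?thesis by (simp add: eq P_def)
qed

section \<open>The energy density\<close>

text \<open>The energy density: for continuous g, the gradient of
  \<open>potential g (norm G)\<close> with respect to the vector G is the flux g(|G|) G.\<close>

definition potential :: "(real \<Rightarrow> real) \<Rightarrow> real \<Rightarrow> real" where
  "potential g s = integral {0..s} (\<lambda>t. g t * t)"

text \<open>Strong monotonicity puts the integrand above the line of slope \<kappa> through its
  value at s to the right of s, and below that line to the left; integrating the line gives the
  quadratic term.\<close>

lemma potential_strongly_convex:
  fixes g :: "real \<Rightarrow> real"
  assumes c: "continuous_on {0..} g" and mono: "\<And>s t. 0 \<le> s \<Longrightarrow> s \<le> t \<Longrightarrow> \<kappa> * (t - s) \<le> g t * t - g s * s"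
    and st: "0 \<le> s" "0 \<le> t"
  shows "g s * s * (t - s) + \<kappa> / 2 * (t - s)\<^sup>2 \<le> potential g t - potential g s"
proof -
  have c': "continuous_on {a..b} (\<lambda>t. g t * t)" if "0 \<le> a" for a b
    using that by (intro continuous_intros continuous_on_subset[OF c]) auto
  have i: "(\<lambda>t. g t * t) integrable_on {a..b}" if "0 \<le> a" for a b
    by (rule integrable_continuous_interval[OF c'[OF that]])
  have aff: "((\<lambda>r. g s * s + \<kappa> * (r - s)) has_integral
      (g s * s * b + \<kappa> / 2 * (b - s)\<^sup>2 - (g s * s * a + \<kappa> / 2 * (a - s)\<^sup>2))) {a..b}" if "a \<le> b" for a b
    by (rule fundamental_theorem_of_calculus[OF that])
       (auto intro!: derivative_eq_intros simp: has_real_derivative_iff_has_vector_derivative[symmetric])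
  show ?thesis
  proof (cases "s \<le> t")
    case True
    have "g s * s * t + \<kappa> / 2 * (t - s)\<^sup>2 - (g s * s * s + \<kappa> / 2 * (s - s)\<^sup>2) \<le> integral {s..t} (\<lambda>t. g t * t)"
    proof (rule has_integral_le[OF aff[OF True] integrable_integral[OF i[OF st(1)]]])
      fix r assume "r \<in> {s..t}"
      then show "g s * s + \<kappa> * (r - s) \<le> g r * r" using mono[of s r] st by auto
    qed
    moreover have "potential g s + integral {s..t} (\<lambda>t. g t * t) = potential g t"
      unfolding potential_def by (rule Henstock_Kurzweil_Integration.integral_combine) (use st True i in auto)
    ultimately show ?thesis by (simp add: algebra_simps)
  next
    case False
    then have ts: "t \<le> s" by simp
    have "integral {t..s} (\<lambda>t. g t * t) \<le> g s * s * s + \<kappa> / 2 * (s - s)\<^sup>2 - (g s * s * t + \<kappa> / 2 * (t - s)\<^sup>2)"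
    proof (rule has_integral_le[OF integrable_integral[OF i[OF st(2)]] aff[OF ts]])
      fix r assume "r \<in> {t..s}"
      then show "g r * r \<le> g s * s + \<kappa> * (r - s)" using mono[of r s] st by (auto simp: algebra_simps)
    qed
    moreover have "potential g t + integral {t..s} (\<lambda>t. g t * t) = potential g s"
      unfolding potential_def by (rule Henstock_Kurzweil_Integration.integral_combine) (use st ts i in auto)
    ultimately show ?thesis by (simp add: algebra_simps)
  qed
qed

text \<open>Passing from norms to vectors introduces the Cauchy-Schwarz defect |a||b| - a \<bullet>
  b. It is subtracted with weight g(|a|) in the linear term and added with weight \<kappa> in the
  quadratic one, and for a \<noteq> 0 comparison with the argument 0 gives g(|a|) \<ge>
  \<kappa>.\<close>

lemma potential_norm_strongly_convex:
  fixes a b :: "'b::real_inner"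
  assumes c: "continuous_on {0..} g" and mono: "\<And>s t. 0 \<le> s \<Longrightarrow> s \<le> t \<Longrightarrow> \<kappa> * (t - s) \<le> g t * t - g s * s"
  shows "g (norm a) * (a \<bullet> (b - a)) + \<kappa> / 2 * (norm (b - a))\<^sup>2 \<le> potential g (norm b) - potential g (norm a)"
proof -
  have CS: "0 \<le> norm a * norm b - a \<bullet> b" using norm_cauchy_schwarz[of a b] by simp
  have "\<kappa> * (norm a * norm b - a \<bullet> b) \<le> g (norm a) * (norm a * norm b - a \<bullet> b)"
  proof (cases "a = 0")
    case False
    then have "\<kappa> \<le> g (norm a)" using mono[of 0 "norm a"] by simp
    then show ?thesis using CS by (rule mult_right_mono)
  qed simp
  moreover have "g (norm a) * norm a * (norm b - norm a) + \<kappa> / 2 * (norm b - norm a)\<^sup>2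
      \<le> potential g (norm b) - potential g (norm a)"
    by (rule potential_strongly_convex[OF c mono]) auto
  moreover have "g (norm a) * norm a * (norm b - norm a) =
      g (norm a) * (norm a * norm b - a \<bullet> b) + g (norm a) * (a \<bullet> (b - a))"
    by (simp add: inner_diff_right power2_norm_eq_inner[symmetric] power2_eq_square algebra_simps)
  moreover have "(norm (b - a))\<^sup>2 = (norm b - norm a)\<^sup>2 + 2 * (norm a * norm b - a \<bullet> b)"
    by (simp add: power2_norm_eq_inner power2_diff inner_diff_left inner_diff_right inner_commute)
  then have "\<kappa> / 2 * (norm (b - a))\<^sup>2 = \<kappa> / 2 * (norm b - norm a)\<^sup>2 + \<kappa> * (norm a * norm b - a \<bullet> b)"
    by (simp add: distrib_left)
  ultimately show ?thesis by linarith
qed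

lemma potential_0 [simp]: "potential g 0 = 0"
  by (simp add: potential_def)

text \<open>Lebesgue measure is complete, so measurability survives changes on null sets. This
  matters because the coefficient is continuous in s only for almost every x.\<close>

lemma borel_measurable_lebesgue_on_AE:
  fixes f g :: "'a::euclidean_space \<Rightarrow> real"
  assumes S: "S \<in> sets lebesgue" and f: "f \<in> borel_measurable (lebesgue_on S)"
    and ae: "AE x in lebesgue_on S. f x = g x"
  shows "g \<in> borel_measurable (lebesgue_on S)"
proof -
  have "(\<lambda>x. indicator S x *\<^sub>R f x) \<in> borel_measurable lebesgue"
    using f S by (simp add: borel_measurable_restrict_space_iff)
  moreover have "AE x in lebesgue. indicator S x *\<^sub>R f x = indicator S x *\<^sub>R g x"
    using ae S by (subst (asm) AE_restrict_space_iff) (auto elim!: eventually_mono simp: indicator_def)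
  ultimately have "(\<lambda>x. indicator S x *\<^sub>R g x) \<in> borel_measurable lebesgue"
    by (rule borel_measurable_AE)
  then show ?thesis using S by (simp add: borel_measurable_restrict_space_iff)
qed

lemma borel_measurable_lebesgue_on_AE_limit:
  fixes f :: "nat \<Rightarrow> 'a::euclidean_space \<Rightarrow> real"
  assumes S: "S \<in> sets lebesgue" and f[measurable]: "\<And>k. f k \<in> borel_measurable (lebesgue_on S)"
    and lim: "AE x in lebesgue_on S. (\<lambda>k. f k x) \<longlonglongrightarrow> g x"
  shows "g \<in> borel_measurable (lebesgue_on S)"
proof (rule borel_measurable_lebesgue_on_AE[OF S])
  show "(\<lambda>x. lim (\<lambda>k. f k x)) \<in> borel_measurable (lebesgue_on S)" by measurable
  show "AE x in lebesgue_on S. lim (\<lambda>k. f k x) = g x"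
    using lim by eventually_elim (rule limI)
qed

section \<open>Admissible coefficients and the energy functional\<close>

text \<open>One condition covering linear, nonlinear and mixed materials. Ellipticity sits in the
  strong monotonicity of \<gamma>(x,s) s, so only nonnegativity and an upper bound are asked of
  \<gamma> itself.\<close>

definition coefficient :: "'a::euclidean_space set \<Rightarrow> real \<Rightarrow> real \<Rightarrow> ('a \<Rightarrow> real \<Rightarrow> real) \<Rightarrow> bool" where
  "coefficient \<Omega> \<kappa> C \<gamma> \<longleftrightarrow> 0 < \<kappa> \<and> (\<forall>s\<ge>0. (\<lambda>x. \<gamma> x s) \<in> borel_measurable (lebesgue_on \<Omega>)) \<and>
     (AE x in lebesgue_on \<Omega>. continuous_on {0..} (\<gamma> x) \<and> (\<forall>s\<ge>0. 0 \<le> \<gamma> x s \<and> \<gamma> x s \<le> C) \<and>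
        (\<forall>s t. 0 \<le> s \<longrightarrow> s \<le> t \<longrightarrow> \<kappa> * (t - s) \<le> \<gamma> x t * t - \<gamma> x s * s))"

locale dirichlet_problem = bounded_domain \<Omega> for \<Omega> :: "'a::euclidean_space set" +
  fixes \<gamma> :: "'a \<Rightarrow> real \<Rightarrow> real" and \<kappa> C :: real
  assumes dimension: "2 \<le> DIM('a)" and coefficient: "coefficient \<Omega> \<kappa> C \<gamma>"
begin

lemma domain_sets: "\<Omega> \<in> sets lebesgue"
  using open_domain by simp

lemma kappa_pos: "0 < \<kappa>"
  using coefficient by (simp add: coefficient_def)

lemma AE_coefficient:
  "AE x in M. continuous_on {0..} (\<gamma> x) \<and> (\<forall>s\<ge>0. 0 \<le> \<gamma> x s \<and> \<gamma> x s \<le> C) \<and>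
        (\<forall>s t. 0 \<le> s \<longrightarrow> s \<le> t \<longrightarrow> \<kappa> * (t - s) \<le> \<gamma> x t * t - \<gamma> x s * s)"
  using coefficient by (simp add: coefficient_def)

text \<open>Composition with a Caratheodory function: g is approximated from below by multiples of
  1/(k+1). Such approximants have countably many values, so measurability in x suffices for them,
  and continuity in s gives the limit.\<close>

lemma measurable_coefficient:
  assumes g[measurable]: "g \<in> borel_measurable M" and g0: "\<And>x. 0 \<le> g x"
  shows "(\<lambda>x. \<gamma> x (g x)) \<in> borel_measurable M"
proof (rule borel_measurable_lebesgue_on_AE_limit[OF domain_sets])
  define s where "s k x = real (nat \<lfloor>real (Suc k) * g x\<rfloor>) / real (Suc k)" for k x
  show "(\<lambda>x. \<gamma> x (s k x)) \<in> borel_measurable M" for k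
  proof -
    have "(\<lambda>x. \<gamma> x (real i / real (Suc k))) \<in> borel_measurable M" for i :: nat
      using coefficient by (simp add: coefficient_def)
    moreover have "(\<lambda>x. nat \<lfloor>real (Suc k) * g x\<rfloor>) \<in> measurable M (count_space UNIV)"
      by measurable
    ultimately show ?thesis
      unfolding s_def by (rule measurable_compose_countable)
  qed
  have s: "(\<lambda>k. s k x) \<longlonglongrightarrow> g x" for x
  proof (rule tendsto_sandwich)
    have fl: "real (nat \<lfloor>real (Suc k) * g x\<rfloor>) = of_int \<lfloor>real (Suc k) * g x\<rfloor>" for k
      using g0[of x] by (simp del: of_nat_Suc)
    have 1: "g x - inverse (real (Suc k)) \<le> s k x" for k
    proof -
      have "real (Suc k) * g x - 1 \<le> of_int \<lfloor>real (Suc k) * g x\<rfloor>" by linarith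
      then have "(real (Suc k) * g x - 1) / real (Suc k) \<le> s k x"
        unfolding s_def fl by (intro divide_right_mono) auto
      then show ?thesis by (simp add: field_simps del: of_nat_Suc)
    qed
    have 2: "s k x \<le> g x" for k
    proof -
      have "s k x \<le> (real (Suc k) * g x) / real (Suc k)"
        unfolding s_def fl by (intro divide_right_mono of_int_floor_le) auto
      then show ?thesis by (simp del: of_nat_Suc)
    qed
    show "\<forall>\<^sub>F k in sequentially. g x - inverse (real (Suc k)) \<le> s k x" "\<forall>\<^sub>F k in sequentially. s k x \<le> g x"
      using 1 2 by auto
    have "(\<lambda>k. g x - inverse (real (Suc k))) \<longlonglongrightarrow> g x - 0"
      by (intro tendsto_intros LIMSEQ_inverse_real_of_nat)
    then show "(\<lambda>k. g x - inverse (real (Suc k))) \<longlonglongrightarrow> g x" by simp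
  qed simp
  show "AE x in M. (\<lambda>k. \<gamma> x (s k x)) \<longlonglongrightarrow> \<gamma> x (g x)"
    using AE_coefficient
  proof eventually_elim
    case (elim x)
    show ?case
      by (rule continuous_on_tendsto_compose[OF conjunct1[OF elim] s]) (auto simp: g0 s_def)
  qed
qed

text \<open>The point x occurs both in the integrand and in the upper limit. Left Riemann sums are
  measurable in x term by term, and they converge because \<gamma>(x,t) t is a subgradient of the
  potential.\<close>

lemma measurable_potential:
  assumes g[measurable]: "g \<in> borel_measurable M" and g0: "\<And>x. 0 \<le> g x"
  shows "(\<lambda>x. potential (\<gamma> x) (g x)) \<in> borel_measurable M"
proof (rule borel_measurable_lebesgue_on_AE_limit[OF domain_sets])
  let ?f = "\<lambda>x t. \<gamma> x t * t"
  show "(\<lambda>x. \<Sum>i<n. ?f x (g x * (real i / real n)) * (g x / real n)) \<in> borel_measurable M" for n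
  proof (rule borel_measurable_sum)
    fix i
    have [measurable]: "(\<lambda>x. \<gamma> x (g x * (real i / real n))) \<in> borel_measurable M"
      using g0 by (intro measurable_coefficient) auto
    show "(\<lambda>x. ?f x (g x * (real i / real n)) * (g x / real n)) \<in> borel_measurable M" by measurable
  qed
  show "AE x in M. (\<lambda>n. \<Sum>i<n. ?f x (g x * (real i / real n)) * (g x / real n)) \<longlonglongrightarrow> potential (\<gamma> x) (g x)"
    using AE_coefficient
  proof eventually_elim
    case (elim x)
    have "?f x s * (t - s) \<le> potential (\<gamma> x) t - potential (\<gamma> x) s" if "s \<in> {0..g x}" "t \<in> {0..g x}" for s t
    proof -
      have "?f x s * (t - s) + \<kappa> / 2 * (t - s)\<^sup>2 \<le> potential (\<gamma> x) t - potential (\<gamma> x) s"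
        by (rule potential_strongly_convex) (use elim that in auto)
      moreover have "0 \<le> \<kappa> / 2 * (t - s)\<^sup>2" using kappa_pos by simp
      ultimately show ?thesis by linarith
    qed
    from left_sums_tendsto[of "g x" "?f x" "potential (\<gamma> x)", OF this g0] show ?case by simp
  qed
qed

definition flux :: "('a \<Rightarrow> 'a) \<Rightarrow> 'a \<Rightarrow> 'a" where
  "flux G x = \<gamma> x (norm (G x)) *\<^sub>R G x"

definition energy :: "('a \<Rightarrow> 'a) \<Rightarrow> real" where
  "energy G = (LINT x|M. potential (\<gamma> x) (norm (G x)))"

lemma flux_square_integrable:
  assumes G: "square_integrable M G" shows "square_integrable M (flux G)"
proof (rule square_integrable_bound[OF _ G])
  note [measurable] = square_integrable_measurable[OF G]
  have [measurable]: "(\<lambda>x. \<gamma> x (norm (G x))) \<in> borel_measurable M"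
    by (intro measurable_coefficient) auto
  show "flux G \<in> borel_measurable M" unfolding flux_def[abs_def] by measurable
  show "AE x in M. norm (flux G x) \<le> C * norm (G x)"
    using AE_coefficient by eventually_elim (auto simp: flux_def intro!: mult_right_mono)
qed

text \<open>Strong convexity between 0 and s, used in both directions: based at 0 it gives the lower
  bound, based at s the upper one.\<close>

lemma AE_potential_bounds:
  "AE x in M. \<forall>s\<ge>0. 0 \<le> potential (\<gamma> x) s \<and> potential (\<gamma> x) s \<le> C * s\<^sup>2"
  using AE_coefficient
proof eventually_elim
  case (elim x)
  show ?case
  proof (intro allI impI)
    fix s :: real assume s: "0 \<le> s"
    have k: "0 \<le> \<kappa> / 2 * s\<^sup>2" using kappa_pos by simp
    have 1: "\<gamma> x 0 * 0 * (s - 0) + \<kappa> / 2 * (s - 0)\<^sup>2 \<le> potential (\<gamma> x) s - potential (\<gamma> x) 0"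
      by (rule potential_strongly_convex) (use elim s in auto)
    have 2: "\<gamma> x s * s * (0 - s) + \<kappa> / 2 * (0 - s)\<^sup>2 \<le> potential (\<gamma> x) 0 - potential (\<gamma> x) s"
      by (rule potential_strongly_convex) (use elim s in auto)
    have "\<gamma> x s * s\<^sup>2 \<le> C * s\<^sup>2" using elim s by (intro mult_right_mono) auto
    then show "0 \<le> potential (\<gamma> x) s \<and> potential (\<gamma> x) s \<le> C * s\<^sup>2"
      using 1 2 k by (simp add: power2_eq_square algebra_simps)
  qed
qed

lemma integrable_potential:
  assumes G: "square_integrable M G"
  shows "integrable M (\<lambda>x. potential (\<gamma> x) (norm (G x)))"
proof (rule Bochner_Integration.integrable_bound)
  show "integrable M (\<lambda>x. C * (norm (G x))\<^sup>2)"
    using G by (simp add: square_integrable_def)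
  note [measurable] = square_integrable_measurable[OF G]
  show "(\<lambda>x. potential (\<gamma> x) (norm (G x))) \<in> borel_measurable M"
    by (intro measurable_potential) auto
  show "AE x in M. norm (potential (\<gamma> x) (norm (G x))) \<le> norm (C * (norm (G x))\<^sup>2)"
    using AE_potential_bounds
  proof eventually_elim
    case (elim x)
    then have "0 \<le> potential (\<gamma> x) (norm (G x))" "potential (\<gamma> x) (norm (G x)) \<le> C * (norm (G x))\<^sup>2" by auto
    then show ?case unfolding real_norm_def by linarith
  qed
qed

lemma energy_nonneg: "0 \<le> energy G"
  unfolding energy_def
proof (rule integral_nonneg_AE)
  show "AE x in M. 0 \<le> potential (\<gamma> x) (norm (G x))"
    using AE_potential_bounds by eventually_elim simp
qed

lemma energy_cong_AE:
  assumes GH: "square_integrable M G" "square_integrable M H" and ae: "AE x in M. G x = H x"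
  shows "energy G = energy H"
  unfolding energy_def
proof (rule integral_cong_AE)
  show "AE x in M. potential (\<gamma> x) (norm (G x)) = potential (\<gamma> x) (norm (H x))"
    using ae by eventually_elim simp
  show "(\<lambda>x. potential (\<gamma> x) (norm (G x))) \<in> borel_measurable M"
    "(\<lambda>x. potential (\<gamma> x) (norm (H x))) \<in> borel_measurable M"
    using integrable_potential[OF GH(1)] integrable_potential[OF GH(2)] by auto
qed

lemma energy_strongly_convex:
  assumes G: "square_integrable M G" and H: "square_integrable M H"
  shows "(LINT x|M. flux G x \<bullet> (H x - G x)) + \<kappa> / 2 * (LINT x|M. (norm (H x - G x))\<^sup>2) \<le> energy H - energy G"
proof -
  note d = square_integrable_diff[OF H G]
  have i1: "integrable M (\<lambda>x. flux G x \<bullet> (H x - G x))"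
    by (rule integrable_inner[OF flux_square_integrable[OF G] d])
  have i2: "integrable M (\<lambda>x. (norm (H x - G x))\<^sup>2)"
    using d by (simp add: square_integrable_def)
  have "(LINT x|M. flux G x \<bullet> (H x - G x)) + \<kappa> / 2 * (LINT x|M. (norm (H x - G x))\<^sup>2) =
      (LINT x|M. flux G x \<bullet> (H x - G x) + \<kappa> / 2 * (norm (H x - G x))\<^sup>2)"
    using i1 i2 by simp
  also have "\<dots> \<le> (LINT x|M. potential (\<gamma> x) (norm (H x)) - potential (\<gamma> x) (norm (G x)))"
  proof (rule integral_mono_AE)
    show "AE x in M. flux G x \<bullet> (H x - G x) + \<kappa> / 2 * (norm (H x - G x))\<^sup>2
        \<le> potential (\<gamma> x) (norm (H x)) - potential (\<gamma> x) (norm (G x))"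
      using AE_coefficient
    proof eventually_elim
      case (elim x)
      have "\<gamma> x (norm (G x)) * (G x \<bullet> (H x - G x)) + \<kappa> / 2 * (norm (H x - G x))\<^sup>2 
          \<le> potential (\<gamma> x) (norm (H x)) - potential (\<gamma> x) (norm (G x))"
        by (rule potential_norm_strongly_convex) (use elim in auto)
      then show ?case by (simp add: flux_def)
    qed
  qed (use i1 i2 integrable_potential[OF G] integrable_potential[OF H] in auto)
  also have "\<dots> = energy H - energy G"
    unfolding energy_def using integrable_potential[OF G] integrable_potential[OF H] by simp
  finally show ?thesis .
qed

lemma energy_subgradient:
  assumes G: "square_integrable M G" and H: "square_integrable M H"
  shows "(LINT x|M. flux G x \<bullet> (H x - G x)) \<le> energy H - energy G"
proof -
  have "0 \<le> \<kappa> / 2 * (LINT x|M. (norm (H x - G x))\<^sup>2)"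
    using kappa_pos by simp
  then show ?thesis using energy_strongly_convex[OF G H] by linarith
qed

lemma energy_form_eq_flux: "energy_form \<Omega> \<gamma> u v = (LINT x|M. flux (weak_grad \<Omega> u) x \<bullet> weak_grad \<Omega> v x)"
  by (simp add: energy_form_def flux_def)

text \<open>Strong convexity based at the midpoint m, towards both gradients: the first-order terms
  cancel because the increments are opposite, and each quadratic term carries a factor (1/2)^2. The
  midpoint function has trace f, so its energy is at least I.\<close>

lemma energy_midpoint:
  assumes u: "has_trace \<Omega> u f" and v: "has_trace \<Omega> v f"
    and I: "\<And>w. has_trace \<Omega> w f \<Longrightarrow> I \<le> energy (weak_grad \<Omega> w)"
  shows "\<kappa> / 4 * (LINT x|M. (norm (weak_grad \<Omega> v x - weak_grad \<Omega> u x))\<^sup>2) \<le>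
    energy (weak_grad \<Omega> u) + energy (weak_grad \<Omega> v) - 2 * I"
proof -
  let ?u = "weak_grad \<Omega> u" and ?v = "weak_grad \<Omega> v"
  note u' = has_trace_weak_grad(2)[OF u] and v' = has_trace_weak_grad(2)[OF v]
  define m where "m x = ?u x + (1 / 2) *\<^sub>R (?v x - ?u x)" for x
  have m: "square_integrable M m"
    unfolding m_def by (intro square_integrable_add square_integrable_scaleR square_integrable_diff u' v')
  have I': "I \<le> energy m"
  proof -
    have d: "has_trace \<Omega> (\<lambda>x. v x + (- 1) * u x) (\<lambda>x. f x + (- 1) * f x)"
      "AE x in M. weak_grad \<Omega> (\<lambda>x. v x + (- 1) * u x) x = ?v x + (- 1) *\<^sub>R ?u x"
      by (rule has_trace_add_cmult[OF v u] weak_grad_add_cmult[OF v u])+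
    have e: "has_trace \<Omega> (\<lambda>x. u x + (1 / 2) * (v x + (- 1) * u x)) (\<lambda>x. f x + (1 / 2) * (f x + (- 1) * f x))"
      "AE x in M. weak_grad \<Omega> (\<lambda>x. u x + (1 / 2) * (v x + (- 1) * u x)) x =
         ?u x + (1 / 2) *\<^sub>R weak_grad \<Omega> (\<lambda>x. v x + (- 1) * u x) x"
      by (rule has_trace_add_cmult[OF u d(1)] weak_grad_add_cmult[OF u d(1)])+
    have "I \<le> energy (weak_grad \<Omega> (\<lambda>x. u x + (1 / 2) * (v x + (- 1) * u x)))"
      using e(1) by (intro I) simp
    also have "\<dots> = energy m"
    proof (rule energy_cong_AE[OF has_trace_weak_grad(2)[OF e(1)] m])
      show "AE x in M. weak_grad \<Omega> (\<lambda>x. u x + (1 / 2) * (v x + (- 1) * u x)) x = m x"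
        using d(2) e(2) by eventually_elim (simp add: m_def)
    qed
    finally show ?thesis .
  qed
  have um: "?u x - m x = (- 1 / 2) *\<^sub>R (?v x - ?u x)" and vm: "?v x - m x = (1 / 2) *\<^sub>R (?v x - ?u x)" for x
  proof -
    show "?u x - m x = (- 1 / 2) *\<^sub>R (?v x - ?u x)" by (simp add: m_def)
    have "?v x - ?u x = (1 / 2) *\<^sub>R (?v x - ?u x) + (1 / 2) *\<^sub>R (?v x - ?u x)"
      by (simp only: scaleR_left_distrib[symmetric]) simp
    then show "?v x - m x = (1 / 2) *\<^sub>R (?v x - ?u x)"
      unfolding m_def by (metis add_diff_cancel_left' diff_diff_add)
  qed
  have n: "(norm (?u x - m x))\<^sup>2 = (1 / 4) * (norm (?v x - ?u x))\<^sup>2"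
      "(norm (?v x - m x))\<^sup>2 = (1 / 4) * (norm (?v x - ?u x))\<^sup>2" for x
    unfolding um vm by (simp_all add: power_mult_distrib power_divide)
  have "(LINT x|M. flux m x \<bullet> (?u x - m x)) = - (LINT x|M. flux m x \<bullet> (?v x - m x))"
    unfolding um vm by simp
  then show ?thesis
    using energy_strongly_convex[OF m u'] energy_strongly_convex[OF m v'] I'
    by (simp add: n)
qed

section \<open>Existence of weak solutions\<close>

lemma exists_minimizer:
  assumes f: "f \<in> H_half \<Omega>"
  obtains u where "has_trace \<Omega> u f" "\<And>w. has_trace \<Omega> w f \<Longrightarrow> energy (weak_grad \<Omega> u) \<le> energy (weak_grad \<Omega> w)"
proof -
  define E where "E = (\<lambda>u. energy (weak_grad \<Omega> u)) ` {u. has_trace \<Omega> u f}"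
  have ne: "E \<noteq> {}" using f by (auto simp: E_def H_half_def)
  have bdd: "bdd_below E" by (auto simp: E_def energy_nonneg intro: bdd_belowI[of _ 0])
  have I: "Inf E \<le> energy (weak_grad \<Omega> w)" if "has_trace \<Omega> w f" for w
    using that by (intro cInf_lower[OF _ bdd]) (auto simp: E_def)
  \<comment> \<open>The excess (1/8)^k over the infimum is matched to the rate in
    \<open>L2_fast_Cauchy_limit\<close>.\<close>
  have "\<forall>k. \<exists>u. has_trace \<Omega> u f \<and> energy (weak_grad \<Omega> u) < Inf E + (1/8) ^ k"
  proof
    fix k :: nat
    have "Inf E < Inf E + (1/8) ^ k" by simp
    then show "\<exists>u. has_trace \<Omega> u f \<and> energy (weak_grad \<Omega> u) < Inf E + (1/8) ^ k"
      unfolding cInf_less_iff[OF ne bdd] by (auto simp: E_def)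
  qed
  from choice[OF this] obtain uk where uk: "\<And>k. has_trace \<Omega> (uk k) f"
    and ek: "\<And>k. energy (weak_grad \<Omega> (uk k)) < Inf E + (1/8) ^ k"
    by blast
  let ?G = "\<lambda>k. weak_grad \<Omega> (uk k)"
  note uk' = has_trace_weak_grad[OF uk]
  have cau: "sqnorm M (\<lambda>x. ?G j x - ?G k x) \<le> ennreal (8 / \<kappa> * (1/8) ^ k)" if "k \<le> j" for k j
  proof -
    have "\<kappa> / 4 * (LINT x|M. (norm (?G j x - ?G k x))\<^sup>2) \<le> energy (?G k) + energy (?G j) - 2 * Inf E"
      by (rule energy_midpoint[OF uk uk I])
    also have "\<dots> \<le> (1/8) ^ k + (1/8) ^ j" using ek[of k] ek[of j] by linarith
    also have "\<dots> \<le> 2 * (1/8) ^ k" using power_decreasing[OF that, of "1/8 :: real"] by simp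
    finally have "(LINT x|M. (norm (?G j x - ?G k x))\<^sup>2) \<le> 8 / \<kappa> * (1/8) ^ k"
      using kappa_pos by (simp add: field_simps)
    then show ?thesis
      using sqnorm_eq_integral[OF square_integrable_diff[OF uk'(2) uk'(2)]] by (simp add: ennreal_leI)
  qed
  obtain G where G: "square_integrable M G" and Glim: "(\<lambda>k. sqnorm M (\<lambda>x. ?G k x - G x)) \<longlonglongrightarrow> 0"
    using L2_fast_Cauchy_limit[OF uk'(2) cau] by blast
  obtain P where P: "0 \<le> P" "\<And>v. has_trace \<Omega> v (\<lambda>_. 0) \<Longrightarrow> sqnorm M v \<le> ennreal P * sqnorm M (weak_grad \<Omega> v)"
    using friedrichs_trace_zero[OF dimension] by blast
  \<comment> \<open>Differences of competitors have trace zero, so the Friedrichs inequality carries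
    the Cauchy property from the gradients to the functions.\<close>
  have cau': "sqnorm M (\<lambda>x. uk j x - uk k x) \<le> ennreal (P * (8 / \<kappa>) * (1/8) ^ k)" if "k \<le> j" for k j
  proof -
    have d: "has_trace \<Omega> (\<lambda>x. uk j x + (- 1) * uk k x) (\<lambda>x. f x + (- 1) * f x)"
      "AE x in M. weak_grad \<Omega> (\<lambda>x. uk j x + (- 1) * uk k x) x = ?G j x + (- 1) *\<^sub>R ?G k x"
      by (rule has_trace_add_cmult[OF uk uk] weak_grad_add_cmult[OF uk uk])+
    have "sqnorm M (\<lambda>x. uk j x - uk k x) \<le> ennreal P * sqnorm M (weak_grad \<Omega> (\<lambda>x. uk j x + (- 1) * uk k x))"
      using P(2)[of "\<lambda>x. uk j x + (- 1) * uk k x"] d(1) by simp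
    also have "sqnorm M (weak_grad \<Omega> (\<lambda>x. uk j x + (- 1) * uk k x)) = sqnorm M (\<lambda>x. ?G j x - ?G k x)"
      using d(2) by (intro sqnorm_cong_AE) simp
    also have "ennreal P * \<dots> \<le> ennreal P * ennreal (8 / \<kappa> * (1/8) ^ k)"
      by (intro mult_left_mono cau that) auto
    also have "\<dots> = ennreal (P * (8 / \<kappa>) * (1/8) ^ k)"
      using P(1) by (simp add: ennreal_mult'[symmetric] mult.assoc)
    finally show ?thesis .
  qed
  obtain u where u: "square_integrable M u" and ulim: "(\<lambda>k. sqnorm M (\<lambda>x. uk k x - u x)) \<longlonglongrightarrow> 0"
    using L2_fast_Cauchy_limit[OF uk'(1) cau'] by blast
  have tr: "has_trace \<Omega> u f" and wg: "AE x in M. weak_grad \<Omega> u x = G x"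
    by (rule has_trace_closed[OF uk u G ulim Glim])+
  \<comment> \<open>Lower semicontinuity by the subgradient at the limit G: the linear term pairs
    the fixed flux of G with \<open>?G k - G\<close> and tends to 0.\<close>
  have "energy G \<le> Inf E"
  proof -
    have "(\<lambda>k. LINT x|M. flux G x \<bullet> ?G k x) \<longlonglongrightarrow> (LINT x|M. flux G x \<bullet> G x)"
      by (rule integral_inner_tendsto[OF flux_square_integrable[OF G] uk'(2) G Glim])
    then have "(\<lambda>k. Inf E + (1/8) ^ k - ((LINT x|M. flux G x \<bullet> ?G k x) - (LINT x|M. flux G x \<bullet> G x)))
        \<longlonglongrightarrow> Inf E + 0 - ((LINT x|M. flux G x \<bullet> G x) - (LINT x|M. flux G x \<bullet> G x))"
      by (intro tendsto_intros LIMSEQ_power_zero) auto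
    moreover have "energy G \<le> Inf E + (1/8) ^ k - ((LINT x|M. flux G x \<bullet> ?G k x) - (LINT x|M. flux G x \<bullet> G x))" for k
    proof -
      have "(LINT x|M. flux G x \<bullet> (?G k x - G x)) = (LINT x|M. flux G x \<bullet> ?G k x) - (LINT x|M. flux G x \<bullet> G x)"
        using integrable_inner[OF flux_square_integrable[OF G] uk'(2)[of k]] integrable_inner[OF flux_square_integrable[OF G] G]
        by (simp add: inner_diff_right)
      then show ?thesis using energy_subgradient[OF G uk'(2)[of k]] ek[of k] by linarith
    qed
    ultimately have "energy G \<le> Inf E + 0 - ((LINT x|M. flux G x \<bullet> G x) - (LINT x|M. flux G x \<bullet> G x))"
      by (intro LIMSEQ_le_const) auto
    then show ?thesis by simp
  qed
  then have "energy (weak_grad \<Omega> u) \<le> Inf E"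
    using energy_cong_AE[OF has_trace_weak_grad(2)[OF tr] G wg] by simp
  then show ?thesis using that[OF tr] I order_trans by blast
qed

text \<open>Continuity of \<gamma> in s and dominated convergence. In the majorant, 2|G|^2 + 2|H|^2
  comes from the perturbed gradient and one further |H|^2 from the pairing with H.\<close>

lemma flux_directional_limit:
  assumes G: "square_integrable M G" and H: "square_integrable M H"
  shows "(\<lambda>n. LINT x|M. flux (\<lambda>x. G x + inverse (real (Suc n)) *\<^sub>R H x) x \<bullet> H x) \<longlonglongrightarrow> (LINT x|M. flux G x \<bullet> H x)"
proof (rule integral_dominated_convergence)
  let ?r = "\<lambda>n. inverse (real (Suc n))"
  have GH: "square_integrable M (\<lambda>x. G x + ?r n *\<^sub>R H x)" for n
    by (intro square_integrable_add square_integrable_scaleR G H)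
  show "(\<lambda>x. flux G x \<bullet> H x) \<in> borel_measurable M"
    using integrable_inner[OF flux_square_integrable[OF G] H] by simp
  show "(\<lambda>x. flux (\<lambda>x. G x + ?r n *\<^sub>R H x) x \<bullet> H x) \<in> borel_measurable M" for n
    using integrable_inner[OF flux_square_integrable[OF GH] H] by simp
  show "integrable M (\<lambda>x. C * (2 * (norm (G x))\<^sup>2 + 3 * (norm (H x))\<^sup>2))"
    using G H by (simp add: square_integrable_def)
  show "AE x in M. (\<lambda>n. flux (\<lambda>x. G x + ?r n *\<^sub>R H x) x \<bullet> H x) \<longlonglongrightarrow> flux G x \<bullet> H x"
    using AE_coefficient
  proof eventually_elim
    case (elim x)
    have "(\<lambda>n. G x + ?r n *\<^sub>R H x) \<longlonglongrightarrow> G x + 0 *\<^sub>R H x"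
      by (intro tendsto_intros LIMSEQ_inverse_real_of_nat)
    then have l: "(\<lambda>n. G x + ?r n *\<^sub>R H x) \<longlonglongrightarrow> G x" by simp
    have "(\<lambda>n. \<gamma> x (norm (G x + ?r n *\<^sub>R H x))) \<longlonglongrightarrow> \<gamma> x (norm (G x))"
      by (rule continuous_on_tendsto_compose[OF conjunct1[OF elim] tendsto_norm[OF l]]) auto
    then show ?case unfolding flux_def by (intro tendsto_intros l)
  qed
  show "AE x in M. norm (flux (\<lambda>x. G x + ?r n *\<^sub>R H x) x \<bullet> H x) \<le> C * (2 * (norm (G x))\<^sup>2 + 3 * (norm (H x))\<^sup>2)" for n
    using AE_coefficient
  proof eventually_elim
    case (elim x)
    let ?a = "G x + ?r n *\<^sub>R H x"
    have "norm (?r n *\<^sub>R H x) \<le> norm (H x)"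
      by (simp add: mult_left_le_one_le inverse_le_1_iff del: of_nat_Suc)
    then have "(norm (?r n *\<^sub>R H x))\<^sup>2 \<le> (norm (H x))\<^sup>2" by (intro power_mono) auto
    then have "(norm ?a)\<^sup>2 \<le> 2 * (norm (G x))\<^sup>2 + 2 * (norm (H x))\<^sup>2"
      using norm_add_sq_le[of "G x" "?r n *\<^sub>R H x"] by linarith
    then have 1: "\<bar>?a \<bullet> H x\<bar> \<le> 2 * (norm (G x))\<^sup>2 + 3 * (norm (H x))\<^sup>2"
      using abs_inner_le_sq[of ?a "H x"] by linarith
    have "norm (flux (\<lambda>x. G x + ?r n *\<^sub>R H x) x \<bullet> H x) = \<gamma> x (norm ?a) * \<bar>?a \<bullet> H x\<bar>"
      using elim by (simp add: flux_def abs_mult)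
    also have "\<dots> \<le> C * (2 * (norm (G x))\<^sup>2 + 3 * (norm (H x))\<^sup>2)"
      using elim by (intro mult_mono 1) (auto intro: order_trans[of 0 "\<gamma> x 0"])
    finally show ?case .
  qed
qed

text \<open>The energy is never differentiated: the subgradient is taken at the competitor G + r H,
  where minimality forces the pairing of its flux with H to be nonnegative, and then r tends to 0.
  Applying this to v and -v gives equality.\<close>

lemma minimizer_weak_solution:
  assumes u: "has_trace \<Omega> u f" and min: "\<And>w. has_trace \<Omega> w f \<Longrightarrow> energy (weak_grad \<Omega> u) \<le> energy (weak_grad \<Omega> w)"
  shows "weak_solution \<Omega> \<gamma> f u"
proof -
  let ?G = "weak_grad \<Omega> u"
  note G = has_trace_weak_grad(2)[OF u]
  have ge: "0 \<le> (LINT x|M. flux ?G x \<bullet> weak_grad \<Omega> v x)" if v: "has_trace \<Omega> v (\<lambda>_. 0)" for v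
  proof -
    let ?H = "weak_grad \<Omega> v"
    note H = has_trace_weak_grad(2)[OF v]
    have "0 \<le> (LINT x|M. flux (\<lambda>x. ?G x + inverse (real (Suc n)) *\<^sub>R ?H x) x \<bullet> ?H x)" for n
    proof -
      define r where "r = inverse (real (Suc n))"
      have r: "0 < r" by (simp add: r_def)
      let ?K = "\<lambda>x. ?G x + r *\<^sub>R ?H x"
      have K: "square_integrable M ?K" by (intro square_integrable_add square_integrable_scaleR G H)
      have tr: "has_trace \<Omega> (\<lambda>x. u x + r * v x) f" and wg: "AE x in M. weak_grad \<Omega> (\<lambda>x. u x + r * v x) x = ?K x"
        using has_trace_add_cmult[OF u v, of r] weak_grad_add_cmult[OF u v, of r] by auto
      have "energy ?G \<le> energy ?K"
        using min[OF tr] energy_cong_AE[OF has_trace_weak_grad(2)[OF tr] K wg] by simp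
      moreover have "(LINT x|M. flux ?K x \<bullet> (?G x - ?K x)) \<le> energy ?G - energy ?K"
        by (rule energy_subgradient[OF K G])
      moreover have "(LINT x|M. flux ?K x \<bullet> (?G x - ?K x)) = - r * (LINT x|M. flux ?K x \<bullet> ?H x)"
        by simp
      ultimately have "0 \<le> r * (LINT x|M. flux ?K x \<bullet> ?H x)" by linarith
      then show ?thesis using r by (simp add: zero_le_mult_iff r_def)
    qed
    then show ?thesis by (intro LIMSEQ_le_const[OF flux_directional_limit[OF G H]]) auto
  qed
  have "(LINT x|M. flux ?G x \<bullet> weak_grad \<Omega> v x) = 0" if v: "has_trace \<Omega> v (\<lambda>_. 0)" for v
  proof -
    have tr: "has_trace \<Omega> (\<lambda>x. - 1 * v x) (\<lambda>x. 0)" and wg: "AE x in M. weak_grad \<Omega> (\<lambda>x. - 1 * v x) x = - 1 *\<^sub>R weak_grad \<Omega> v x"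
      using has_trace_cmult[OF v, of "- 1"] by auto
    note H = has_trace_weak_grad(2)[OF v] has_trace_weak_grad(2)[OF tr]
    have "(LINT x|M. flux ?G x \<bullet> weak_grad \<Omega> (\<lambda>x. - 1 * v x) x) = (LINT x|M. - (flux ?G x \<bullet> weak_grad \<Omega> v x))"
    proof (rule integral_cong_AE)
      show "AE x in M. flux ?G x \<bullet> weak_grad \<Omega> (\<lambda>x. - 1 * v x) x = - (flux ?G x \<bullet> weak_grad \<Omega> v x)"
        using wg by eventually_elim simp
    qed (use integrable_inner[OF flux_square_integrable[OF G] H(1)] integrable_inner[OF flux_square_integrable[OF G] H(2)] in auto)
    then show ?thesis using ge[OF v] ge[OF tr] by simp
  qed
  then show ?thesis
    using u by (simp add: weak_solution_def energy_form_eq_flux)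
qed

end

section \<open>Dirichlet-to-Neumann operators\<close>

context dirichlet_problem
begin

definition solution :: "('a \<Rightarrow> real) \<Rightarrow> 'a \<Rightarrow> real" where
  "solution f = (SOME u. weak_solution \<Omega> \<gamma> f u)"

lemma weak_solution_solution:
  assumes "f \<in> H_half \<Omega>" shows "weak_solution \<Omega> \<gamma> f (solution f)"
proof -
  have "\<exists>u. weak_solution \<Omega> \<gamma> f u"
    using exists_minimizer[OF assms] minimizer_weak_solution by metis
  then show ?thesis unfolding solution_def by (rule someI_ex)
qed

lemma has_trace_solution: "f \<in> H_half \<Omega> \<Longrightarrow> has_trace \<Omega> (solution f) f"
  using weak_solution_solution by (simp add: weak_solution_def)

lemma weak_solution_flux_zero:
  assumes "weak_solution \<Omega> \<gamma> f u" "has_trace \<Omega> v (\<lambda>_. 0)"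
  shows "(LINT x|M. flux (weak_grad \<Omega> u) x \<bullet> weak_grad \<Omega> v x) = 0"
  using assms by (simp add: weak_solution_def energy_form_eq_flux)

lemma integral_inner_cong_AE:
  assumes F: "square_integrable M F" and GH: "square_integrable M G" "square_integrable M H"
    and ae: "AE x in M. G x = H x"
  shows "(LINT x|M. F x \<bullet> G x) = (LINT x|M. F x \<bullet> H x)"
proof (rule integral_cong_AE)
  show "AE x in M. F x \<bullet> G x = F x \<bullet> H x" using ae by eventually_elim simp
qed (use integrable_inner[OF F GH(1)] integrable_inner[OF F GH(2)] in auto)

text \<open>Two extensions of \<phi> differ by a function of trace zero, which the weak equation
  annihilates; the choice of extension in \<open>DtN\<close> is thus immaterial.\<close>

lemma flux_pairing_trace:
  assumes u: "weak_solution \<Omega> \<gamma> f u" and v: "has_trace \<Omega> v \<phi>" and w: "has_trace \<Omega> w \<phi>"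
  shows "(LINT x|M. flux (weak_grad \<Omega> u) x \<bullet> weak_grad \<Omega> v x) = (LINT x|M. flux (weak_grad \<Omega> u) x \<bullet> weak_grad \<Omega> w x)"
proof -
  have "has_trace \<Omega> u f" using u by (simp add: weak_solution_def)
  note F = flux_square_integrable[OF has_trace_weak_grad(2)[OF this]]
  note G = has_trace_weak_grad(2)[OF v] has_trace_weak_grad(2)[OF w]
  have d: "has_trace \<Omega> (\<lambda>x. v x + (- 1) * w x) (\<lambda>x. \<phi> x + (- 1) * \<phi> x)"
    "AE x in M. weak_grad \<Omega> (\<lambda>x. v x + (- 1) * w x) x = weak_grad \<Omega> v x + (- 1) *\<^sub>R weak_grad \<Omega> w x"
    by (rule has_trace_add_cmult[OF v w] weak_grad_add_cmult[OF v w])+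
  have "0 = (LINT x|M. flux (weak_grad \<Omega> u) x \<bullet> weak_grad \<Omega> (\<lambda>x. v x + (- 1) * w x) x)"
    using weak_solution_flux_zero[OF u, of "\<lambda>x. v x + (- 1) * w x"] d(1) by simp
  also have "\<dots> = (LINT x|M. flux (weak_grad \<Omega> u) x \<bullet> (weak_grad \<Omega> v x - weak_grad \<Omega> w x))"
    using d(2) by (intro integral_inner_cong_AE F has_trace_weak_grad(2)[OF d(1)] square_integrable_diff G) simp
  also have "\<dots> = (LINT x|M. flux (weak_grad \<Omega> u) x \<bullet> weak_grad \<Omega> v x) - (LINT x|M. flux (weak_grad \<Omega> u) x \<bullet> weak_grad \<Omega> w x)"
    using integrable_inner[OF F G(1)] integrable_inner[OF F G(2)] by (simp add: inner_diff_right)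
  finally show ?thesis by simp
qed

lemma DtN_eq:
  assumes f: "f \<in> H_half \<Omega>" and v: "has_trace \<Omega> v \<phi>"
  shows "DtN \<Omega> \<gamma> f \<phi> = (LINT x|M. flux (weak_grad \<Omega> (solution f)) x \<bullet> weak_grad \<Omega> v x)"
proof -
  have "has_trace \<Omega> (SOME v. has_trace \<Omega> v \<phi>) \<phi>" using v by (rule someI[of "\<lambda>v. has_trace \<Omega> v \<phi>"])
  then show ?thesis
    unfolding DtN_def solution_def[symmetric] energy_form_eq_flux
    by (rule flux_pairing_trace[OF weak_solution_solution[OF f] _ v])
qed

section \<open>Minimal energy and the average operator\<close>

definition min_energy :: "('a \<Rightarrow> real) \<Rightarrow> real" where
  "min_energy f = energy (weak_grad \<Omega> (solution f))"

text \<open>Convexity turns a weak solution into a minimiser: the first-order term at the solution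
  vanishes on differences of functions with equal trace. In particular \<open>min_energy\<close> is
  independent of the solution chosen.\<close>

lemma min_energy_le:
  assumes v: "has_trace \<Omega> v f" shows "min_energy f \<le> energy (weak_grad \<Omega> v)"
proof -
  have f: "f \<in> H_half \<Omega>" using v by (auto simp: H_half_def)
  note s = weak_solution_solution[OF f] and t = has_trace_solution[OF f]
  note G = has_trace_weak_grad(2)[OF t] has_trace_weak_grad(2)[OF v]
  note F = flux_square_integrable[OF G(1)]
  have "(LINT x|M. flux (weak_grad \<Omega> (solution f)) x \<bullet> (weak_grad \<Omega> v x - weak_grad \<Omega> (solution f) x)) = 0"
    using flux_pairing_trace[OF s v t] integrable_inner[OF F G(1)] integrable_inner[OF F G(2)]
    by (simp add: inner_diff_right)
  then show ?thesis
    using energy_subgradient[OF G] by (simp add: min_energy_def)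
qed

lemma DtN_sum:
  assumes f: "f \<in> H_half \<Omega>" and I: "finite I" "\<And>i. i \<in> I \<Longrightarrow> \<phi> i \<in> H_half \<Omega>"
  shows "DtN \<Omega> \<gamma> f (\<lambda>x. \<Sum>i\<in>I. c i * \<phi> i x) = (\<Sum>i\<in>I. c i * DtN \<Omega> \<gamma> f (\<phi> i))"
proof -
  have tr: "has_trace \<Omega> (solution (\<phi> i)) (\<phi> i)" if "i \<in> I" for i
    by (rule has_trace_solution[OF I(2)[OF that]])
  note F = flux_square_integrable[OF has_trace_weak_grad(2)[OF has_trace_solution[OF f]]]
  note S = has_trace_sum[of I "\<lambda>i. solution (\<phi> i)" \<phi> c, OF I(1) tr]
  have "DtN \<Omega> \<gamma> f (\<lambda>x. \<Sum>i\<in>I. c i * \<phi> i x) =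
      (LINT x|M. flux (weak_grad \<Omega> (solution f)) x \<bullet> weak_grad \<Omega> (\<lambda>x. \<Sum>i\<in>I. c i * solution (\<phi> i) x) x)"
    by (rule DtN_eq[OF f conjunct1[OF S]])
  also have "\<dots> = (LINT x|M. flux (weak_grad \<Omega> (solution f)) x \<bullet> (\<Sum>i\<in>I. c i *\<^sub>R weak_grad \<Omega> (solution (\<phi> i)) x))"
    using S has_trace_weak_grad(2)[OF tr]
    by (intro integral_inner_cong_AE F has_trace_weak_grad(2)[OF conjunct1[OF S]] square_integrable_sum
        square_integrable_scaleR) auto
  also have "\<dots> = (\<Sum>i\<in>I. c i * (LINT x|M. flux (weak_grad \<Omega> (solution f)) x \<bullet> weak_grad \<Omega> (solution (\<phi> i)) x))"
    using integrable_inner[OF F has_trace_weak_grad(2)[OF tr]]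
    by (simp add: inner_sum_right Bochner_Integration.integral_sum)
  also have "\<dots> = (\<Sum>i\<in>I. c i * DtN \<Omega> \<gamma> f (\<phi> i))"
    using DtN_eq[OF f tr] by simp
  finally show ?thesis .
qed

lemma DtN_cong_AE:
  assumes f: "f \<in> H_half \<Omega>" and \<phi>: "\<phi> \<in> H_half \<Omega>" and \<psi>: "\<psi> \<in> H_half \<Omega>" and ae: "AE x in S. \<phi> x = \<psi> x"
  shows "DtN \<Omega> \<gamma> f \<phi> = DtN \<Omega> \<gamma> f \<psi>"
proof -
  have "has_trace \<Omega> (solution \<phi>) \<psi>"
    using has_trace_cong_AE[OF has_trace_solution[OF \<phi>] ae] \<psi> has_trace_square_integrable
    by (auto simp: H_half_def)
  then show ?thesis
    using DtN_eq[OF f] has_trace_solution[OF \<phi>] by simp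
qed

text \<open>The difference of the solutions for t f and s f extends (t - s) f, so the left side is
  the first-order term of the energy at the solution for s f.\<close>

lemma DtN_subgradient:
  assumes f: "f \<in> H_half \<Omega>"
  shows "DtN \<Omega> \<gamma> (\<lambda>x. s * f x) f * (t - s) \<le> min_energy (\<lambda>x. t * f x) - min_energy (\<lambda>x. s * f x)"
proof -
  have h: "(\<lambda>x. r * f x) \<in> H_half \<Omega>" for r
    using has_trace_cmult(1)[OF has_trace_solution[OF f]] by (auto simp: H_half_def)
  let ?u = "solution (\<lambda>x. s * f x)" and ?v = "solution (\<lambda>x. t * f x)"
  note u = has_trace_solution[OF h, of s] and v = has_trace_solution[OF h, of t]
  note G = has_trace_weak_grad(2)[OF u] has_trace_weak_grad(2)[OF v]
  note F = flux_square_integrable[OF G(1)]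
  have d: "has_trace \<Omega> (\<lambda>x. ?v x + (- 1) * ?u x) (\<lambda>x. t * f x + (- 1) * (s * f x))"
    "AE x in M. weak_grad \<Omega> (\<lambda>x. ?v x + (- 1) * ?u x) x = weak_grad \<Omega> ?v x + (- 1) *\<^sub>R weak_grad \<Omega> ?u x"
    by (rule has_trace_add_cmult[OF v u] weak_grad_add_cmult[OF v u])+
  have "DtN \<Omega> \<gamma> (\<lambda>x. s * f x) f * (t - s) = DtN \<Omega> \<gamma> (\<lambda>x. s * f x) (\<lambda>x. t * f x + (- 1) * (s * f x))"
    \<comment> \<open>A sum over the one-point index set \<open>{()}\<close> is used as homogeneity
      in the second argument.\<close>
    using DtN_sum[OF h[of s], of "{()}" "\<lambda>_. f" "\<lambda>_. t - s"] f by (simp add: algebra_simps)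
  also have "\<dots> = (LINT x|M. flux (weak_grad \<Omega> ?u) x \<bullet> weak_grad \<Omega> (\<lambda>x. ?v x + (- 1) * ?u x) x)"
    by (rule DtN_eq[OF h d(1)])
  also have "\<dots> = (LINT x|M. flux (weak_grad \<Omega> ?u) x \<bullet> (weak_grad \<Omega> ?v x - weak_grad \<Omega> ?u x))"
    using d(2) by (intro integral_inner_cong_AE F has_trace_weak_grad(2)[OF d(1)] square_integrable_diff G) simp
  also have "\<dots> \<le> min_energy (\<lambda>x. t * f x) - min_energy (\<lambda>x. s * f x)"
    unfolding min_energy_def by (rule energy_subgradient[OF G])
  finally show ?thesis .
qed

lemma min_energy_nonneg: "0 \<le> min_energy f"
  by (simp add: min_energy_def energy_nonneg)

lemma min_energy_0: "min_energy (\<lambda>_. 0) = 0"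
proof -
  have "min_energy (\<lambda>_. 0) \<le> energy (weak_grad \<Omega> (\<lambda>_. 0))"
    by (rule min_energy_le[OF has_trace_zero(1)])
  also have "\<dots> = energy (\<lambda>_. 0)"
    by (rule energy_cong_AE[OF has_trace_weak_grad(2)[OF has_trace_zero(1)] _ has_trace_zero(2)]) simp
  also have "\<dots> = 0" by (simp add: energy_def)
  finally show ?thesis using min_energy_nonneg[of "\<lambda>_. 0"] by linarith
qed

lemma avg_DtN_eq_min_energy:
  assumes f: "f \<in> H_half \<Omega>"
  shows "avg_DtN \<Omega> \<gamma> f f = min_energy f"
  unfolding avg_DtN_def
  using set_integral_subgradient[of "\<lambda>s. DtN \<Omega> \<gamma> (\<lambda>x. s * f x) f" "\<lambda>t. min_energy (\<lambda>x. t * f x)",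
      OF DtN_subgradient[OF f]] by (simp add: min_energy_0)

end

lemma potential_mono:
  assumes c: "continuous_on {0..} g" "continuous_on {0..} h" and le: "\<And>t. 0 \<le> t \<Longrightarrow> g t \<le> h t"
  shows "potential g s \<le> potential h s"
  unfolding potential_def
proof (rule integral_le)
  have "(\<lambda>t. k t * t) integrable_on {0..s}" if "continuous_on {0..} k" for k :: "real \<Rightarrow> real"
    by (intro integrable_continuous_interval continuous_intros continuous_on_subset[OF that]) auto
  then show "(\<lambda>t. g t * t) integrable_on {0..s}" "(\<lambda>t. h t * t) integrable_on {0..s}" using c by auto
qed (auto intro!: mult_right_mono le)

text \<open>The solution for the larger coefficient is a competitor for the smaller one, and the
  potentials are ordered like the coefficients.\<close>

lemma min_energy_mono:
  assumes "dirichlet_problem \<Omega> \<gamma>1 \<kappa>1 C1" "dirichlet_problem \<Omega> \<gamma>2 \<kappa>2 C2"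
    and f: "f \<in> H_half \<Omega>" and le: "AE x in lebesgue_on \<Omega>. \<forall>s\<ge>0. \<gamma>1 x s \<le> \<gamma>2 x s"
  shows "dirichlet_problem.min_energy \<Omega> \<gamma>1 f \<le> dirichlet_problem.min_energy \<Omega> \<gamma>2 f"
proof -
  interpret P1: dirichlet_problem \<Omega> \<gamma>1 \<kappa>1 C1 by fact
  interpret P2: dirichlet_problem \<Omega> \<gamma>2 \<kappa>2 C2 by fact
  note tr = P2.has_trace_solution[OF f]
  note G = P1.has_trace_weak_grad(2)[OF tr]
  have "P1.min_energy f \<le> P1.energy (weak_grad \<Omega> (P2.solution f))"
    by (rule P1.min_energy_le[OF tr])
  also have "\<dots> \<le> P2.energy (weak_grad \<Omega> (P2.solution f))"
    unfolding P1.energy_def P2.energy_def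
  proof (rule integral_mono_AE[OF P1.integrable_potential[OF G] P2.integrable_potential[OF G]])
    show "AE x in lebesgue_on \<Omega>. potential (\<gamma>1 x) (norm (weak_grad \<Omega> (P2.solution f) x))
        \<le> potential (\<gamma>2 x) (norm (weak_grad \<Omega> (P2.solution f) x))"
      using P1.AE_coefficient P2.AE_coefficient le by eventually_elim (auto intro!: potential_mono)
  qed
  also have "\<dots> = P2.min_energy f" by (simp add: P2.min_energy_def)
  finally show ?thesis .
qed

locale linear_dirichlet_problem = dirichlet_problem \<Omega> "\<lambda>x s. g x" \<kappa> C
  for \<Omega> :: "'a::euclidean_space set" and g \<kappa> C
begin

lemma DtN_commute:
  assumes "f \<in> H_half \<Omega>" "\<phi> \<in> H_half \<Omega>"
  shows "DtN \<Omega> (\<lambda>x s. g x) f \<phi> = DtN \<Omega> (\<lambda>x s. g x) \<phi> f"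
  using assms by (simp add: DtN_eq[OF _ has_trace_solution] flux_def inner_commute)

text \<open>For a coefficient independent of s the potential is c s^2 / 2, half of the integrand of
  the quadratic form.\<close>

lemma DtN_eq_min_energy:
  assumes f: "f \<in> H_half \<Omega>"
  shows "DtN \<Omega> (\<lambda>x s. g x) f f = 2 * min_energy f"
proof -
  have p: "potential (\<lambda>s. c) s = c * s\<^sup>2 / 2" if "0 \<le> s" for c s :: real
  proof -
    have h: "((\<lambda>t. c * t) has_integral (c * s\<^sup>2 / 2 - c * 0\<^sup>2 / 2)) {0..s}"
      by (rule fundamental_theorem_of_calculus[OF that])
         (auto intro!: derivative_eq_intros simp: has_real_derivative_iff_has_vector_derivative[symmetric])
    show ?thesis unfolding potential_def integral_unique[OF h] by simp
  qed
  show ?thesis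
    using f by (simp add: DtN_eq[OF _ has_trace_solution] flux_def min_energy_def energy_def p power2_norm_eq_inner)
qed

end

text \<open>Eigenfunctions for distinct eigenvalues are orthogonal because the form is symmetric; grouping
  by eigenvalue diagonalises it on the span.\<close>

lemma negative_on_span_of_negative_eigenfunctions:
  fixes L :: "('a::euclidean_space \<Rightarrow> real) \<Rightarrow> ('a \<Rightarrow> real) \<Rightarrow> real"
  assumes sym: "\<And>\<phi> \<psi>. \<phi> \<in> X_diamond \<Omega> \<Longrightarrow> \<psi> \<in> X_diamond \<Omega> \<Longrightarrow> L \<phi> \<psi> = L \<psi> \<phi>"
    and lin: "\<And>f I c. f \<in> X_diamond \<Omega> \<Longrightarrow> finite I \<Longrightarrow> I \<subseteq> X_diamond \<Omega> \<Longrightarrow>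
       AE x in surface_measure \<Omega>. f x = (\<Sum>\<phi>\<in>I. c \<phi> * \<phi> x) \<Longrightarrow> L f f = (\<Sum>\<phi>\<in>I. c \<phi> * L f \<phi>)"
    and f: "f \<in> boundary_span \<Omega> {\<phi>. \<exists>\<delta><0. is_eigenfunction \<Omega> L \<delta> \<phi>}"
    and nz: "\<not> boundary_zero \<Omega> f"
  shows "L f f < 0"
proof -
  let ?S = "surface_measure \<Omega>"
  have fX: "f \<in> X_diamond \<Omega>" using f by (simp add: boundary_span_def)
  from f obtain I c where I: "finite I" "I \<subseteq> {\<phi>. \<exists>\<delta><0. is_eigenfunction \<Omega> L \<delta> \<phi>}"
    and fI: "AE x in ?S. f x = (\<Sum>\<phi>\<in>I. c \<phi> * \<phi> x)" unfolding boundary_span_def by auto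
  \<comment> \<open>One negative eigenvalue is fixed for each eigenfunction, so that I can be
    partitioned by \<delta>.\<close>
  define \<delta> where "\<delta> \<phi> = (SOME d. d < 0 \<and> is_eigenfunction \<Omega> L d \<phi>)" for \<phi>
  have \<delta>: "\<delta> \<phi> < 0" "is_eigenfunction \<Omega> L (\<delta> \<phi>) \<phi>" if "\<phi> \<in> I" for \<phi>
    using someI_ex[of "\<lambda>d. d < 0 \<and> is_eigenfunction \<Omega> L d \<phi>"] I(2) that unfolding \<delta>_def by auto
  have X: "\<phi> \<in> X_diamond \<Omega>" if "\<phi> \<in> I" for \<phi> using \<delta>(2)[OF that] by (simp add: is_eigenfunction_def)
  have sq: "square_integrable ?S \<phi>" if "\<phi> \<in> X_diamond \<Omega>" for \<phi>
    using that by (auto simp: X_diamond_def H_half_def has_trace_def)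
  have eig: "L \<phi> \<psi> = \<delta> \<phi> * (LINT x|?S. \<phi> x * \<psi> x)" if "\<phi> \<in> I" "\<psi> \<in> X_diamond \<Omega>" for \<phi> \<psi>
    using \<delta>(2)[OF that(1)] that(2) by (simp add: is_eigenfunction_def)
  have orth: "(LINT x|?S. \<phi> x * \<psi> x) = 0" if "\<phi> \<in> I" "\<psi> \<in> I" "\<delta> \<phi> \<noteq> \<delta> \<psi>" for \<phi> \<psi>
  proof -
    have "(LINT x|?S. \<psi> x * \<phi> x) = (LINT x|?S. \<phi> x * \<psi> x)"
      by (simp add: mult.commute)
    then have "\<delta> \<phi> * (LINT x|?S. \<phi> x * \<psi> x) = \<delta> \<psi> * (LINT x|?S. \<phi> x * \<psi> x)"
      using eig[OF that(1) X[OF that(2)]] eig[OF that(2) X[OF that(1)]] sym[OF X[OF that(1)] X[OF that(2)]]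
      by metis
    then show ?thesis using that(3) by auto
  qed
  \<comment> \<open>Eigenfunctions of one eigenvalue need not be orthogonal to each other, so they
    are collected into one component \<open>g d\<close>; distinct components are orthogonal.\<close>
  define g where "g d x = (\<Sum>\<phi>\<in>{\<phi>\<in>I. \<delta> \<phi> = d}. c \<phi> * \<phi> x)" for d x
  have gsq: "square_integrable ?S (g d)" for d
    unfolding g_def[abs_def] by (intro square_integrable_sum square_integrable_cmult sq X) auto
  have fg: "AE x in ?S. f x = (\<Sum>d\<in>\<delta> ` I. g d x)"
    using fI unfolding g_def sum.image_gen[OF I(1), symmetric] .
  have gg: "(LINT x|?S. g d x * g e x) = 0" if "d \<noteq> e" for d e
  proof -
    have "(LINT x|?S. g d x * g e x) =
        (LINT x|?S. (\<Sum>\<phi>\<in>{\<phi>\<in>I. \<delta> \<phi> = d}. \<Sum>\<psi>\<in>{\<psi>\<in>I. \<delta> \<psi> = e}. (c \<phi> * c \<psi>) * (\<phi> x * \<psi> x)))"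
      unfolding g_def sum_product by (simp add: ac_simps)
    also have "\<dots> = (\<Sum>\<phi>\<in>{\<phi>\<in>I. \<delta> \<phi> = d}. \<Sum>\<psi>\<in>{\<psi>\<in>I. \<delta> \<psi> = e}. (c \<phi> * c \<psi>) * (LINT x|?S. \<phi> x * \<psi> x))"
    proof -
      have i: "integrable ?S (\<lambda>x. (c \<phi> * c \<psi>) * (\<phi> x * \<psi> x))" if "\<phi> \<in> I" "\<psi> \<in> I" for \<phi> \<psi>
        by (intro integrable_mult_right integrable_mult_square_integrable sq X that)
      have "(LINT x|?S. (\<Sum>\<phi>\<in>{\<phi>\<in>I. \<delta> \<phi> = d}. \<Sum>\<psi>\<in>{\<psi>\<in>I. \<delta> \<psi> = e}. (c \<phi> * c \<psi>) * (\<phi> x * \<psi> x))) =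
          (\<Sum>\<phi>\<in>{\<phi>\<in>I. \<delta> \<phi> = d}. (LINT x|?S. (\<Sum>\<psi>\<in>{\<psi>\<in>I. \<delta> \<psi> = e}. (c \<phi> * c \<psi>) * (\<phi> x * \<psi> x))))"
        by (rule Bochner_Integration.integral_sum) (rule Bochner_Integration.integrable_sum, use i in blast)
      also have "\<dots> = (\<Sum>\<phi>\<in>{\<phi>\<in>I. \<delta> \<phi> = d}. \<Sum>\<psi>\<in>{\<psi>\<in>I. \<delta> \<psi> = e}. (LINT x|?S. (c \<phi> * c \<psi>) * (\<phi> x * \<psi> x)))"
        by (rule sum.cong[OF refl], rule Bochner_Integration.integral_sum) (use i in blast)
      finally show ?thesis by simp
    qed
    also have "\<dots> = 0"
      using that orth by (intro sum.neutral ballI) auto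
    finally show ?thesis .
  qed
  have gf: "(LINT x|?S. g d x * f x) = (LINT x|?S. (g d x)\<^sup>2)" if d: "d \<in> \<delta> ` I" for d
  proof -
    have "(LINT x|?S. g d x * f x) = (LINT x|?S. (\<Sum>e\<in>\<delta> ` I. g d x * g e x))"
    proof (rule integral_cong_AE)
      show "AE x in ?S. g d x * f x = (\<Sum>e\<in>\<delta> ` I. g d x * g e x)"
        using fg by eventually_elim (simp add: sum_distrib_left)
      show "(\<lambda>x. g d x * f x) \<in> borel_measurable ?S"
        using integrable_mult_square_integrable[OF gsq sq[OF fX]] by auto
      show "(\<lambda>x. \<Sum>e\<in>\<delta> ` I. g d x * g e x) \<in> borel_measurable ?S"
        using integrable_mult_square_integrable[OF gsq gsq] by (intro borel_measurable_sum) auto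
    qed
    also have "\<dots> = (\<Sum>e\<in>\<delta> ` I. (LINT x|?S. g d x * g e x))"
      by (intro Bochner_Integration.integral_sum integrable_mult_square_integrable gsq)
    also have "\<dots> = (\<Sum>e\<in>\<delta> ` I. if e = d then (LINT x|?S. g d x * g d x) else 0)"
      by (intro sum.cong) (auto simp: gg)
    also have "\<dots> = (LINT x|?S. g d x * g d x)" using I(1) d by simp
    finally show ?thesis by (simp add: power2_eq_square)
  qed
  have "L f f = (\<Sum>\<phi>\<in>I. c \<phi> * L f \<phi>)"
    using I(1) X fI by (intro lin[OF fX]) auto
  \<comment> \<open>Symmetry moves the eigenfunction into the first slot, where the eigenvalue
    equation applies with f as test function.\<close>
  also have "\<dots> = (\<Sum>\<phi>\<in>I. \<delta> \<phi> * (c \<phi> * (LINT x|?S. \<phi> x * f x)))"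
    by (intro sum.cong) (auto simp: sym[OF fX X] eig[OF _ fX])
  also have "\<dots> = (\<Sum>d\<in>\<delta> ` I. \<Sum>\<phi>\<in>{\<phi>\<in>I. \<delta> \<phi> = d}. \<delta> \<phi> * (c \<phi> * (LINT x|?S. \<phi> x * f x)))"
    by (rule sum.image_gen[OF I(1)])
  also have "\<dots> = (\<Sum>d\<in>\<delta> ` I. d * (LINT x|?S. (g d x)\<^sup>2))"
  proof (rule sum.cong[OF refl])
    fix d assume d: "d \<in> \<delta> ` I"
    have "(\<Sum>\<phi>\<in>{\<phi>\<in>I. \<delta> \<phi> = d}. \<delta> \<phi> * (c \<phi> * (LINT x|?S. \<phi> x * f x))) =
        d * (\<Sum>\<phi>\<in>{\<phi>\<in>I. \<delta> \<phi> = d}. (LINT x|?S. c \<phi> * (\<phi> x * f x)))"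
      unfolding sum_distrib_left by (intro sum.cong) auto
    also have "(\<Sum>\<phi>\<in>{\<phi>\<in>I. \<delta> \<phi> = d}. (LINT x|?S. c \<phi> * (\<phi> x * f x))) =
        (LINT x|?S. (\<Sum>\<phi>\<in>{\<phi>\<in>I. \<delta> \<phi> = d}. c \<phi> * (\<phi> x * f x)))"
      by (rule Bochner_Integration.integral_sum[symmetric])
         (auto intro!: integrable_mult_square_integrable sq X fX)
    also have "\<dots> = (LINT x|?S. g d x * f x)"
      by (simp add: g_def sum_distrib_right mult.assoc)
    finally show "(\<Sum>\<phi>\<in>{\<phi>\<in>I. \<delta> \<phi> = d}. \<delta> \<phi> * (c \<phi> * (LINT x|?S. \<phi> x * f x))) = d * (LINT x|?S. (g d x)\<^sup>2)"
      by (simp only: gf[OF d])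
  qed
  also have "\<dots> < 0"
  proof -
    have neg: "d * (LINT x|?S. (g d x)\<^sup>2) \<le> 0" if "d \<in> \<delta> ` I" for d
      using that \<delta>(1) by (auto intro!: mult_nonpos_nonneg simp: less_imp_le)
    \<comment> \<open>If no summand were negative, every component would vanish almost everywhere
      and f with it.\<close>
    have "\<exists>d\<in>\<delta> ` I. d * (LINT x|?S. (g d x)\<^sup>2) < 0"
    proof (rule ccontr)
      assume "\<not> ?thesis"
      then have z: "(LINT x|?S. (g d x)\<^sup>2) = 0" if "d \<in> \<delta> ` I" for d
        using that \<delta>(1) neg[OF that] by fastforce
      have "AE x in ?S. g d x = 0" if "d \<in> \<delta> ` I" for d
      proof -
        have "integrable ?S (\<lambda>x. (g d x)\<^sup>2)" using gsq[of d] by (simp add: square_integrable_def)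
        then have "AE x in ?S. (g d x)\<^sup>2 = 0"
          using z[OF that] by (subst (asm) integral_nonneg_eq_0_iff_AE) auto
        then show ?thesis by simp
      qed
      then have "AE x in ?S. \<forall>d\<in>\<delta> ` I. g d x = 0"
        using I(1) by (intro AE_finite_allI) auto
      with fg have "AE x in ?S. f x = 0" by eventually_elim simp
      then show False using nz by (simp add: boundary_zero_def)
    qed
    then show ?thesis
      using sum_strict_mono_ex1[of "\<delta> ` I" "\<lambda>d. d * (LINT x|?S. (g d x)\<^sup>2)" "\<lambda>_. 0"] I(1) neg by simp
  qed
  finally show ?thesis .
qed

section \<open>The material properties of the theorem and the conclusion\<close>

lemma AE_lebesgue_on_subset:
  assumes "S \<in> sets lebesgue" "T \<in> sets lebesgue" "S \<subseteq> T" "AE x in lebesgue_on T. P x"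
  shows "AE x in lebesgue_on S. P x"
  using assms by (auto simp: AE_restrict_space_iff elim!: eventually_mono)

lemma coefficient_linear:
  assumes "g \<in> borel_measurable (lebesgue_on \<Omega>)" "0 < l" "AE x in lebesgue_on \<Omega>. l \<le> g x \<and> g x \<le> C"
  shows "coefficient \<Omega> l C (\<lambda>x s. g x)"
  unfolding coefficient_def
proof (intro conjI allI impI)
  show "AE x in lebesgue_on \<Omega>. continuous_on {0..} (\<lambda>s. g x) \<and> (\<forall>s\<ge>0. 0 \<le> g x \<and> g x \<le> C) \<and>
      (\<forall>s t. 0 \<le> s \<longrightarrow> s \<le> t \<longrightarrow> l * (t - s) \<le> g x * t - g x * s)"
    using assms(3)
  proof eventually_elim
    case (elim x)
    then have "l * (t - s) \<le> g x * t - g x * s" if "s \<le> t" for s t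
      using mult_right_mono[of l "g x" "t - s"] that by (simp add: right_diff_distrib)
    then show ?case using elim assms(2) by auto
  qed
qed (use assms in auto)

lemma coefficient_with_inclusion:
  assumes A: "A \<in> sets lebesgue" and \<Omega>: "\<Omega> \<in> sets lebesgue" and bg: "coefficient \<Omega> \<kappa>1 C1 (\<lambda>x s. \<gamma>bg x)"
    and incl: "coefficient \<Omega> \<kappa>2 C2 \<gamma>in"
  shows "coefficient \<Omega> (min \<kappa>1 \<kappa>2) (max C1 C2) (with_inclusion \<gamma>bg A \<gamma>in)"
  unfolding coefficient_def
proof (intro conjI allI impI)
  show "0 < min \<kappa>1 \<kappa>2" using bg incl by (simp add: coefficient_def)
  show "(\<lambda>x. with_inclusion \<gamma>bg A \<gamma>in x s) \<in> borel_measurable (lebesgue_on \<Omega>)" if "0 \<le> s" for s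
  proof -
    have m: "(\<lambda>x. \<gamma>in x s) \<in> borel_measurable (lebesgue_on \<Omega>)" "\<gamma>bg \<in> borel_measurable (lebesgue_on \<Omega>)"
      using bg incl that by (auto simp: coefficient_def)
    have "A \<inter> space (lebesgue_on \<Omega>) \<in> sets (lebesgue_on \<Omega>)"
      using A \<Omega> by (auto simp: sets_restrict_space)
    then show ?thesis unfolding with_inclusion_def by (rule measurable_If_set[OF m])
  qed
  let ?k = "min \<kappa>1 \<kappa>2"
  show "AE x in lebesgue_on \<Omega>. continuous_on {0..} (with_inclusion \<gamma>bg A \<gamma>in x) \<and>
      (\<forall>s\<ge>0. 0 \<le> with_inclusion \<gamma>bg A \<gamma>in x s \<and> with_inclusion \<gamma>bg A \<gamma>in x s \<le> max C1 C2) \<and>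
      (\<forall>s t. 0 \<le> s \<longrightarrow> s \<le> t \<longrightarrow> ?k * (t - s) \<le> with_inclusion \<gamma>bg A \<gamma>in x t * t - with_inclusion \<gamma>bg A \<gamma>in x s * s)"
    using conjunct2[OF conjunct2[OF bg[unfolded coefficient_def]]] conjunct2[OF conjunct2[OF incl[unfolded coefficient_def]]]
  proof eventually_elim
    case (elim x)
    have k: "?k * (t - s) \<le> \<kappa>1 * (t - s)" "?k * (t - s) \<le> \<kappa>2 * (t - s)" if "s \<le> t" for s t
      using that by (auto intro!: mult_right_mono)
    show ?case
    proof (cases "x \<in> A")
      case True
      then have "with_inclusion \<gamma>bg A \<gamma>in x = \<gamma>in x" by (auto simp: with_inclusion_def)
      moreover have "\<forall>s t. 0 \<le> s \<longrightarrow> s \<le> t \<longrightarrow> ?k * (t - s) \<le> \<gamma>in x t * t - \<gamma>in x s * s"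
        by (intro allI impI order_trans[OF k(2)]) (use elim in auto)
      ultimately show ?thesis using elim by (auto simp: le_max_iff_disj)
    next
      case False
      then have "with_inclusion \<gamma>bg A \<gamma>in x = (\<lambda>s. \<gamma>bg x)" by (auto simp: with_inclusion_def)
      moreover have "\<forall>s t. 0 \<le> s \<longrightarrow> s \<le> t \<longrightarrow> ?k * (t - s) \<le> \<gamma>bg x * t - \<gamma>bg x * s"
        by (intro allI impI order_trans[OF k(1)]) (use elim in auto)
      ultimately show ?thesis using elim by (auto simp: le_max_iff_disj)
    qed
  qed
qed

lemma with_inclusion_const:
  "with_inclusion \<gamma>bg A (\<lambda>x s. c) = (\<lambda>x s. if x \<in> A then c else \<gamma>bg x)"
  by (simp add: with_inclusion_def fun_eq_iff)

theorem proposition4p1: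
  fixes \<Omega> A T F :: "'a::euclidean_space set"
    and \<gamma>bg :: "'a \<Rightarrow> real"
    and \<gamma>nl :: "'a \<Rightarrow> real \<Rightarrow> real"
    and cbgl cbgu cnll cnlu \<kappa> :: real
    and \<Lambda>Fu \<Lambda>Tl :: "('a \<Rightarrow> real) \<Rightarrow> ('a \<Rightarrow> real) \<Rightarrow> real"
  assumes dim: "DIM('a) \<ge> 2"
    and domain: "open \<Omega>" "bounded \<Omega>" "connected \<Omega>" "lipschitz_boundary \<Omega>"
    and bg_measurable: "\<gamma>bg \<in> borel_measurable (lebesgue_on \<Omega>)"
    and bg_consts: "0 < cbgl" "0 < cbgu"
    and bg_bounds: "AE x in lebesgue_on \<Omega>. cbgl \<le> \<gamma>bg x \<and> \<gamma>bg x \<le> cbgu"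
    and H1_measurable: "\<And>s. s \<ge> 0 \<Longrightarrow> (\<lambda>x. \<gamma>nl x s) \<in> borel_measurable (lebesgue_on (closure \<Omega>))"
    and H1_continuous: "AE x in lebesgue_on (closure \<Omega>). continuous_on {0..} (\<gamma>nl x)"
    and H2: "AE x in lebesgue_on (closure \<Omega>). strict_mono_on {0..} (\<lambda>s. \<gamma>nl x s * s)"
    and H3_consts: "0 < cnll" "cnll < cnlu"
    and H3: "AE x in lebesgue_on (closure \<Omega>). \<forall>s\<ge>0. cnll \<le> \<gamma>nl x s \<and> \<gamma>nl x s \<le> cnlu"
    and H4_const: "0 < \<kappa>"
    and H4: "AE x in lebesgue_on \<Omega>. \<forall>s1 s2 :: 'a.
        (\<gamma>nl x (norm s2) *\<^sub>R s2 - \<gamma>nl x (norm s1) *\<^sub>R s1) \<bullet> (s2 - s1) \<ge> \<kappa> * (norm (s2 - s1))\<^sup>2"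
    and contrast: "cbgu < cnll"
    and A: "A \<in> sets lebesgue" "A \<subseteq> \<Omega>"
    and T: "T \<in> sets lebesgue" "T \<subseteq> \<Omega>"
    and F: "F \<in> sets lebesgue" "F \<subseteq> \<Omega>"
    and A_subset_F: "A \<subseteq> F"
    and T_not_subset_F: "\<not> T \<subseteq> F"
    and \<Lambda>Fu_def: "\<Lambda>Fu = DtN \<Omega> (with_inclusion \<gamma>bg F (\<lambda>x s. cnlu))"
    and \<Lambda>Tl_def: "\<Lambda>Tl = DtN \<Omega> (with_inclusion \<gamma>bg T (\<lambda>x s. cnll))"
    and neg_eigenvalues: "\<exists>\<delta><0. is_eigenvalue \<Omega> (\<lambda>f \<phi>. \<Lambda>Fu f \<phi> - \<Lambda>Tl f \<phi>) \<delta>"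
  shows "\<forall>f \<in> boundary_span \<Omega>
             {\<phi>. \<exists>\<delta><0. is_eigenfunction \<Omega> (\<lambda>f \<phi>. \<Lambda>Fu f \<phi> - \<Lambda>Tl f \<phi>) \<delta> \<phi>}.
           \<not> boundary_zero \<Omega> f \<longrightarrow>
           avg_DtN \<Omega> (with_inclusion \<gamma>bg A \<gamma>nl) f f - avg_DtN \<Omega> (with_inclusion \<gamma>bg T \<gamma>nl) f f < 0"
proof (intro ballI impI)
  fix f
  assume f: "f \<in> boundary_span \<Omega> {\<phi>. \<exists>\<delta><0. is_eigenfunction \<Omega> (\<lambda>f \<phi>. \<Lambda>Fu f \<phi> - \<Lambda>Tl f \<phi>) \<delta> \<phi>}"
    and nz: "\<not> boundary_zero \<Omega> f"
  have \<Omega>: "\<Omega> \<in> sets lebesgue" and cl: "closure \<Omega> \<in> sets lebesgue"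
    using domain(1) by auto
  note sub = AE_lebesgue_on_subset[OF \<Omega> cl closure_subset]
  have bg: "coefficient \<Omega> cbgl cbgu (\<lambda>x s. \<gamma>bg x)"
    by (rule coefficient_linear[OF bg_measurable bg_consts(1) bg_bounds])
  have nl: "coefficient \<Omega> \<kappa> cnlu \<gamma>nl"
    unfolding coefficient_def
  proof (intro conjI allI impI H4_const)
    show "(\<lambda>x. \<gamma>nl x s) \<in> borel_measurable (lebesgue_on \<Omega>)" if "0 \<le> s" for s
      using H1_measurable[OF that] closure_subset by (rule measurable_restrict_mono)
    show "AE x in lebesgue_on \<Omega>. continuous_on {0..} (\<gamma>nl x) \<and> (\<forall>s\<ge>0. 0 \<le> \<gamma>nl x s \<and> \<gamma>nl x s \<le> cnlu) \<and>
        (\<forall>s t. 0 \<le> s \<longrightarrow> s \<le> t \<longrightarrow> \<kappa> * (t - s) \<le> \<gamma>nl x t * t - \<gamma>nl x s * s)"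
      using sub[OF H1_continuous] sub[OF H3] H4
    proof eventually_elim
      case (elim x)
      \<comment> \<open>(H4) is tested on the parallel vectors t e and s e with e a unit vector;
        division by t - s > 0 leaves the scalar inequality.\<close>
      obtain e :: 'a where e: "e \<in> Basis" using nonempty_Basis by blast
      have "\<kappa> * (t - s) \<le> \<gamma>nl x t * t - \<gamma>nl x s * s" if st: "0 \<le> s" "s \<le> t" for s t
      proof (cases "s = t")
        case False
        have "\<kappa> * (norm (t *\<^sub>R e - s *\<^sub>R e))\<^sup>2 \<le>
            (\<gamma>nl x (norm (t *\<^sub>R e)) *\<^sub>R (t *\<^sub>R e) - \<gamma>nl x (norm (s *\<^sub>R e)) *\<^sub>R (s *\<^sub>R e)) \<bullet> (t *\<^sub>R e - s *\<^sub>R e)"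
          using elim(3) by blast
        moreover have "norm (t *\<^sub>R e) = t" "norm (s *\<^sub>R e) = s" using st e by auto
        moreover have "t *\<^sub>R e - s *\<^sub>R e = (t - s) *\<^sub>R e" by (simp add: scaleR_left_diff_distrib)
        moreover have "\<gamma>nl x t *\<^sub>R (t *\<^sub>R e) - \<gamma>nl x s *\<^sub>R (s *\<^sub>R e) = (\<gamma>nl x t * t - \<gamma>nl x s * s) *\<^sub>R e"
          by (simp add: scaleR_left_diff_distrib)
        ultimately have "\<kappa> * (t - s)\<^sup>2 \<le> (\<gamma>nl x t * t - \<gamma>nl x s * s) * (t - s)"
          using e by (simp add: power2_norm_eq_inner power2_eq_square mult.commute)
        then have "(\<kappa> * (t - s)) * (t - s) \<le> (\<gamma>nl x t * t - \<gamma>nl x s * s) * (t - s)"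
          by (simp only: power2_eq_square mult.assoc)
        then show ?thesis using False st by (simp add: mult_le_cancel_right)
      qed simp
      moreover have "0 \<le> \<gamma>nl x s" "\<gamma>nl x s \<le> cnlu" if "0 \<le> s" for s
        using elim(2) that H3_consts(1) by (auto intro: order_trans[of 0 cnll])
      ultimately show ?case using elim(1) by blast
    qed
  qed
  have const: "coefficient \<Omega> c c (\<lambda>x s. c)" if "0 < c" for c
    by (rule coefficient_linear) (use that in auto)
  define gF where "gF x = (if x \<in> F then cnlu else \<gamma>bg x)" for x
  define gT where "gT x = (if x \<in> T then cnll else \<gamma>bg x)" for x
  have gF: "with_inclusion \<gamma>bg F (\<lambda>x s. cnlu) = (\<lambda>x s. gF x)" and gT: "with_inclusion \<gamma>bg T (\<lambda>x s. cnll) = (\<lambda>x s. gT x)"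
    by (simp_all add: with_inclusion_const gF_def gT_def)
  interpret PA: dirichlet_problem \<Omega> "with_inclusion \<gamma>bg A \<gamma>nl" "min cbgl \<kappa>" "max cbgu cnlu"
    by unfold_locales (rule domain dim coefficient_with_inclusion[OF A(1) \<Omega> bg nl])+
  interpret PT: dirichlet_problem \<Omega> "with_inclusion \<gamma>bg T \<gamma>nl" "min cbgl \<kappa>" "max cbgu cnlu"
    by unfold_locales (rule domain dim coefficient_with_inclusion[OF T(1) \<Omega> bg nl])+
  interpret PF: linear_dirichlet_problem \<Omega> gF "min cbgl cnlu" "max cbgu cnlu"
    unfolding linear_dirichlet_problem_def
    using coefficient_with_inclusion[OF F(1) \<Omega> bg const[of cnlu]] H3_consts
    by unfold_locales (auto simp: gF intro: domain dim)
  interpret PL: linear_dirichlet_problem \<Omega> gT "min cbgl cnll" "max cbgu cnll"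
    unfolding linear_dirichlet_problem_def
    using coefficient_with_inclusion[OF T(1) \<Omega> bg const[of cnll]] H3_consts
    by unfold_locales (auto simp: gT intro: domain dim)
  let ?L = "\<lambda>f \<phi>. \<Lambda>Fu f \<phi> - \<Lambda>Tl f \<phi>"
  have X: "\<phi> \<in> H_half \<Omega>" if "\<phi> \<in> X_diamond \<Omega>" for \<phi> using that by (simp add: X_diamond_def)
  have fX: "f \<in> H_half \<Omega>" using f by (simp add: boundary_span_def X)
  have "?L f f < 0"
  proof (rule negative_on_span_of_negative_eigenfunctions[OF _ _ f nz])
    show "?L \<phi> \<psi> = ?L \<psi> \<phi>" if "\<phi> \<in> X_diamond \<Omega>" "\<psi> \<in> X_diamond \<Omega>" for \<phi> \<psi>
      unfolding \<Lambda>Fu_def \<Lambda>Tl_def gF gT using PF.DtN_commute[OF X X] PL.DtN_commute[OF X X] that by metis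
    fix h I and c :: "('a \<Rightarrow> real) \<Rightarrow> real"
    assume h: "h \<in> X_diamond \<Omega>" "finite I" "I \<subseteq> X_diamond \<Omega>" "AE x in surface_measure \<Omega>. h x = (\<Sum>\<phi>\<in>I. c \<phi> * \<phi> x)"
    have I: "\<phi> \<in> H_half \<Omega>" if "\<phi> \<in> I" for \<phi> using h(3) X that by auto
    \<comment> \<open>Invariance of \<open>DtN\<close> under a.e. changes of the second argument is
      available inside \<open>H_half\<close>, so the linear combination must itself be recognised as
      a trace.\<close>
    have "has_trace \<Omega> (\<lambda>x. \<Sum>\<phi>\<in>I. c \<phi> * PF.solution \<phi> x) (\<lambda>x. \<Sum>\<phi>\<in>I. c \<phi> * \<phi> x)"
      using PA.has_trace_sum[of I PF.solution "\<lambda>\<phi>. \<phi>" c] h(2) PF.has_trace_solution[OF I] by blast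
    then have s: "(\<lambda>x. \<Sum>\<phi>\<in>I. c \<phi> * \<phi> x) \<in> H_half \<Omega>" by (auto simp: H_half_def)
    have "DtN \<Omega> (\<lambda>x s. gF x) h (\<lambda>x. \<Sum>\<phi>\<in>I. c \<phi> * \<phi> x) = (\<Sum>\<phi>\<in>I. c \<phi> * DtN \<Omega> (\<lambda>x s. gF x) h \<phi>)"
      "DtN \<Omega> (\<lambda>x s. gT x) h (\<lambda>x. \<Sum>\<phi>\<in>I. c \<phi> * \<phi> x) = (\<Sum>\<phi>\<in>I. c \<phi> * DtN \<Omega> (\<lambda>x s. gT x) h \<phi>)"
      using PF.DtN_sum[OF X[OF h(1)] h(2), of "\<lambda>\<phi>. \<phi>" c] PL.DtN_sum[OF X[OF h(1)] h(2), of "\<lambda>\<phi>. \<phi>" c] I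
      by simp_all
    then show "?L h h = (\<Sum>\<phi>\<in>I. c \<phi> * ?L h \<phi>)"
      unfolding \<Lambda>Fu_def \<Lambda>Tl_def gF gT
        PF.DtN_cong_AE[OF X[OF h(1)] X[OF h(1)] s h(4)] PL.DtN_cong_AE[OF X[OF h(1)] X[OF h(1)] s h(4)]
      by (simp add: right_diff_distrib sum_subtractf)
  qed
  moreover have "PA.min_energy f \<le> PF.min_energy f"
  proof (rule min_energy_mono[OF PA.dirichlet_problem_axioms PF.dirichlet_problem_axioms fX])
    \<comment> \<open>On A this is the upper bound of (H3); on F - A the background is at most
      \<open>cbgu\<close>, below \<open>cnll\<close> and hence below \<open>cnlu\<close>; outside F
      both sides are the background.\<close>
    show "AE x in lebesgue_on \<Omega>. \<forall>s\<ge>0. with_inclusion \<gamma>bg A \<gamma>nl x s \<le> gF x"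
      using bg_bounds sub[OF H3]
      by eventually_elim (use A_subset_F contrast H3_consts in \<open>auto simp: with_inclusion_def gF_def\<close>)
  qed
  moreover have "PL.min_energy f \<le> PT.min_energy f"
  proof (rule min_energy_mono[OF PL.dirichlet_problem_axioms PT.dirichlet_problem_axioms fX])
    show "AE x in lebesgue_on \<Omega>. \<forall>s\<ge>0. gT x \<le> with_inclusion \<gamma>bg T \<gamma>nl x s"
      using sub[OF H3] by eventually_elim (auto simp: with_inclusion_def gT_def)
  qed
  \<comment> \<open>The difference of the averages is at most
    \<open>PF.min_energy f - PL.min_energy f\<close>, which is half of
    \<open>?L f f\<close>.\<close>
  ultimately show "avg_DtN \<Omega> (with_inclusion \<gamma>bg A \<gamma>nl) f f - avg_DtN \<Omega> (with_inclusion \<gamma>bg T \<gamma>nl) f f < 0"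
    unfolding PA.avg_DtN_eq_min_energy[OF fX] PT.avg_DtN_eq_min_energy[OF fX] \<Lambda>Fu_def \<Lambda>Tl_def gF gT
      PF.DtN_eq_min_energy[OF fX] PL.DtN_eq_min_energy[OF fX] by linarith
qed

end
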